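(* Let $\mathbf V$ be a commutative semigroup variety (i.e., a semigroup variety satisfying the identity $xy\approx yx$). Then the following are equivalent: (a) $\mathbf V$ is a cancellable element of the lattice $\mathbf{SEM}$; (b) $\mathbf V$ is a modular element of the lattice $\mathbf{SEM}$; (c) $\mathbf V=\mathbf M\vee\mathbf N$ (join in $\mathbf{SEM}$), where $\mathbf M$ is one of the varieties $\mathbf T$ or $\mathbf{SL}$, while $\mathbf N$ is a semigroup variety satisfying the identities $x^2y\approx 0$ and $xy\approx yx$.
   Context: $\mathbf{SEM}$ denotes the lattice of all semigroup varieties ordered by class-theoretical inclusion; its meet is intersection and the join of two varieties is the smallest semigroup variety containing both. $\mathbf T$ is the trivial semigroup variety (consisting of the one-element semigroups), and $\mathbf{SL}$ is the variety of all semilattices (commutative idempotent semigroups). An element $x$ of a lattice $\langle L;\vee,\wedge\rangle$ is called modular if for all $y,z\in L$, $y\le z$ implies $(x\vee y)\wedge z=(x\wedge z)\vee y$. It is called cancellable if for all $y,z\in L$, $x\vee y=x\vee z$ and $x\wedge y=x\wedge z$ together imply $y=z$. Words are elements of the free semigroup over a countably infinite alphabet. For a word $\mathbf w$, the expression $\mathbf w\approx 0$ is short for the pair of identities $\mathbf wx\approx x\mathbf w\approx\mathbf w$, where $x$ is a variable not occurring in $\mathbf w$; a semigroup $S$ satisfies $\mathbf w\approx 0$ if and only if $S$ has a zero element $0$ and all values of $\mathbf w$ in $S$ are equal to $0$. *)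

theory Defs
  imports "HOL-Algebra.Lattice" "HOL-Library.Infinite_Typeclass" "HOL-Library.Countable_Set"
begin

record 'u magma = "'u partial_object" +
  mul :: "'u \<Rightarrow> 'u \<Rightarrow> 'u"

text \<open>
  The carrier is nonempty; values of the operation outside the carrier are irrelevant.
\<close>

definition is_semigroup :: "'u magma \<Rightarrow> bool" where
  "is_semigroup S \<longleftrightarrow>
     carrier S \<noteq> {} \<and>
     (\<forall>a\<in>carrier S. \<forall>b\<in>carrier S. mul S a b \<in> carrier S) \<and>
     (\<forall>a\<in>carrier S. \<forall>b\<in>carrier S. \<forall>c\<in>carrier S.
        mul S (mul S a b) c = mul S a (mul S b c))"

text \<open>
  A word is a nonempty list over the countably infinite alphabet \<^typ>\<open>nat\<close>; nonemptiness is
  imposed wherever sets of identities are used. The value of the empty list is left unspecified.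
\<close>

type_synonym word = "nat list"
type_synonym identity = "word \<times> word"

fun word_value :: "'u magma \<Rightarrow> (nat \<Rightarrow> 'u) \<Rightarrow> word \<Rightarrow> 'u" where
  "word_value S \<phi> [x] = \<phi> x"
| "word_value S \<phi> (x # y # w) = mul S (\<phi> x) (word_value S \<phi> (y # w))"

definition is_identity :: "identity \<Rightarrow> bool" where
  "is_identity e \<longleftrightarrow> fst e \<noteq> [] \<and> snd e \<noteq> []"

definition satisfies :: "'u magma \<Rightarrow> identity set \<Rightarrow> bool" where
  "satisfies S \<Sigma> \<longleftrightarrow>
     (\<forall>(u, v)\<in>\<Sigma>. \<forall>\<phi>. range \<phi> \<subseteq> carrier S \<longrightarrow> word_value S \<phi> u = word_value S \<phi> v)"

definition class_satisfies :: "'u magma set \<Rightarrow> identity set \<Rightarrow> bool" where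
  "class_satisfies V \<Sigma> \<longleftrightarrow> (\<forall>S\<in>V. satisfies S \<Sigma>)"

definition commutative_law :: "identity set" where
  "commutative_law = {([0, 1], [1, 0])}"

text \<open>
  The identities abbreviated by \<open>w \<approx> 0\<close>. All choices of the fresh variable \<open>x\<close> are
  included; they are renamings of one another.
\<close>

definition zero_identities :: "word \<Rightarrow> identity set" where
  "zero_identities w = (\<Union>x \<in> - set w. {(w @ [x], w), (x # w, w)})"

text \<open>
  Semigroup varieties are equational classes. HOL has no class of all semigroups, so a class is
  represented by its members whose carrier is a subset of a universe type \<open>'u\<close>. This loses
  nothing when \<open>'u\<close> is infinite: an identity that fails in a semigroup already fails in a
  countable subsemigroup, which has an isomorphic copy in \<open>'u\<close>
  (see \<open>consequence_any_universe\<close> below).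
  Hence inclusion, equality, meets and joins of varieties do not depend on \<open>'u\<close>.
\<close>

definition models :: "identity set \<Rightarrow> 'u magma set" where
  "models \<Sigma> = {S. is_semigroup S \<and> satisfies S \<Sigma>}"

definition is_variety :: "'u magma set \<Rightarrow> bool" where
  "is_variety V \<longleftrightarrow> (\<exists>\<Sigma>. (\<forall>e\<in>\<Sigma>. is_identity e) \<and> V = models \<Sigma>)"

definition SEM :: "'u magma set gorder" where
  "SEM = \<lparr>carrier = {V. is_variety V}, eq = (=), le = (\<subseteq>)\<rparr>"

definition trivial_variety :: "'u magma set" where
  "trivial_variety = {S. is_semigroup S \<and> (\<exists>a. carrier S = {a})}"

definition semilattice_variety :: "'u magma set" where
  "semilattice_variety =
     {S. is_semigroup S \<and>
         (\<forall>a\<in>carrier S. \<forall>b\<in>carrier S. mul S a b = mul S b a) \<and>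
         (\<forall>a\<in>carrier S. mul S a a = a)}"

definition modular_element :: "('a, 'm) gorder_scheme \<Rightarrow> 'a \<Rightarrow> bool" where
  "modular_element L x \<longleftrightarrow>
     x \<in> carrier L \<and>
     (\<forall>y\<in>carrier L. \<forall>z\<in>carrier L. y \<sqsubseteq>\<^bsub>L\<^esub> z \<longrightarrow>
        (x \<squnion>\<^bsub>L\<^esub> y) \<sqinter>\<^bsub>L\<^esub> z = (x \<sqinter>\<^bsub>L\<^esub> z) \<squnion>\<^bsub>L\<^esub> y)"

definition cancellable_element :: "('a, 'm) gorder_scheme \<Rightarrow> 'a \<Rightarrow> bool" where
  "cancellable_element L x \<longleftrightarrow>
     x \<in> carrier L \<and>
     (\<forall>y\<in>carrier L. \<forall>z\<in>carrier L.
        x \<squnion>\<^bsub>L\<^esub> y = x \<squnion>\<^bsub>L\<^esub> z \<and> x \<sqinter>\<^bsub>L\<^esub> y = x \<sqinter>\<^bsub>L\<^esub> z \<longrightarrow> y = z)"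

lemma is_varietyI:
  assumes "\<forall>e\<in>\<Sigma>. is_identity e" "V = models \<Sigma>"
  shows "is_variety V"
  using assms unfolding is_variety_def by blast

lemma satisfies_Un: "satisfies S (A \<union> B) \<longleftrightarrow> satisfies S A \<and> satisfies S B"
  unfolding satisfies_def by blast

lemma is_variety_Int:
  assumes "is_variety V" "is_variety W"
  shows "is_variety (V \<inter> W)"
proof -
  obtain A B where "\<forall>e\<in>A. is_identity e" "V = models A" "\<forall>e\<in>B. is_identity e" "W = models B"
    using assms unfolding is_variety_def by blast
  then show ?thesis
    by (intro is_varietyI[of "A \<union> B"]) (auto simp: models_def satisfies_Un)
qed

definition equational_theory :: "'u magma set \<Rightarrow> identity set" where
  "equational_theory K = {e. is_identity e \<and> class_satisfies K {e}}"

lemma models_theory_least: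
  fixes K W :: "'u magma set"
  assumes "\<forall>S\<in>K. is_semigroup S"
  shows "is_variety (models (equational_theory K) :: 'u magma set)"
    and "K \<subseteq> models (equational_theory K)"
    and "is_variety W \<Longrightarrow> K \<subseteq> W \<Longrightarrow> models (equational_theory K) \<subseteq> W"
proof -
  show "is_variety (models (equational_theory K) :: 'u magma set)"
    by (rule is_varietyI) (auto simp: equational_theory_def)
  show "K \<subseteq> models (equational_theory K)"
    using assms by (fastforce simp: models_def equational_theory_def class_satisfies_def satisfies_def)
  assume "is_variety W" "K \<subseteq> W"
  then obtain B where B: "\<forall>e\<in>B. is_identity e" "W = models B"
    unfolding is_variety_def by blast
  have "B \<subseteq> equational_theory K"
    using B \<open>K \<subseteq> W\<close>
    by (fastforce simp: models_def equational_theory_def class_satisfies_def satisfies_def)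
  then show "models (equational_theory K) \<subseteq> W"
    unfolding B(2) by (fastforce simp: models_def satisfies_def)
qed

lemma variety_semigroup: "is_variety V \<Longrightarrow> S \<in> V \<Longrightarrow> is_semigroup S"
  by (auto simp: is_variety_def models_def)

lemma SEM_join_least:
  assumes "is_variety V" "is_variety W"
  shows "least SEM (models (equational_theory (V \<union> W))) (Upper SEM {V, W})"
proof -
  have *: "\<forall>S\<in>V \<union> W. is_semigroup S"
    using assms variety_semigroup by blast
  show ?thesis
    using models_theory_least[OF *] assms
    by (auto simp: least_def Upper_def SEM_def)
qed

lemma SEM_meet_greatest:
  assumes "is_variety V" "is_variety W"
  shows "greatest SEM (V \<inter> W) (Lower SEM {V, W})"
  using assms is_variety_Int[OF assms] by (auto simp: greatest_def Lower_def SEM_def)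

lemma SEM_lattice: "lattice SEM"
proof unfold_locales
  fix V W :: "'a magma set"
  assume "V \<in> carrier SEM" "W \<in> carrier SEM"
  then have *: "is_variety V" "is_variety W"
    by (auto simp: SEM_def)
  show "\<exists>s. least SEM s (Upper SEM {V, W})"
    using SEM_join_least[OF *] by blast
  show "\<exists>s. greatest SEM s (Lower SEM {V, W})"
    using SEM_meet_greatest[OF *] by blast
qed (auto simp: SEM_def)

lemma SEM_meet:
  assumes "V \<in> carrier SEM" "W \<in> carrier SEM"
  shows "V \<sqinter>\<^bsub>SEM\<^esub> W = V \<inter> W"
proof -
  interpret lattice SEM by (rule SEM_lattice)
  have "greatest SEM (V \<inter> W) (Lower SEM {V, W})"
    using assms by (intro SEM_meet_greatest) (auto simp: SEM_def)
  then show ?thesis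
    unfolding meet_def inf_def using greatest_unique by (metis someI)
qed

lemma SEM_join:
  assumes "V \<in> carrier SEM" "W \<in> carrier SEM"
  shows "V \<squnion>\<^bsub>SEM\<^esub> W = models (equational_theory (V \<union> W))"
proof -
  interpret lattice SEM by (rule SEM_lattice)
  have "least SEM (models (equational_theory (V \<union> W))) (Upper SEM {V, W})"
    using assms by (intro SEM_join_least) (auto simp: SEM_def)
  then show ?thesis
    unfolding join_def sup_def using least_unique by (metis someI)
qed

lemma two_letter_valuation:
  assumes "a \<in> carrier S" "b \<in> carrier S"
  shows "range (\<lambda>i::nat. if i = 0 then a else b) \<subseteq> carrier S"
  using assms by auto

lemma trivial_variety_in_SEM: "(trivial_variety :: 'a magma set) \<in> carrier SEM"
proof -
  have "S \<in> trivial_variety" if "S \<in> models {([0], [1])}" for S :: "'a magma"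
  proof -
    have S: "is_semigroup S" "\<And>\<phi> :: nat \<Rightarrow> _. range \<phi> \<subseteq> carrier S \<Longrightarrow> \<phi> 0 = \<phi> 1"
      using that by (auto simp: models_def satisfies_def)
    have eq: "a = b" if "a \<in> carrier S" "b \<in> carrier S" for a b
      using S(2)[OF two_letter_valuation[OF that]] by simp
    obtain a where "a \<in> carrier S"
      using S(1) by (auto simp: is_semigroup_def)
    with eq have "carrier S = {a}"
      by blast
    with S(1) show ?thesis
      by (auto simp: trivial_variety_def)
  qed
  moreover have "S \<in> models {([0], [1])}" if "S \<in> trivial_variety" for S :: "'a magma"
    using that by (fastforce simp: trivial_variety_def models_def satisfies_def image_subset_iff)
  ultimately have "(trivial_variety :: 'a magma set) = models {([0], [1])}"
    by blast
  then show ?thesis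
    using is_varietyI[of "{([0], [1])}" trivial_variety] by (simp add: SEM_def is_identity_def)
qed

lemma semilattice_variety_in_SEM: "(semilattice_variety :: 'a magma set) \<in> carrier SEM"
proof -
  let ?B = "{([0, 1], [1, 0]), ([0, 0], [0])} :: identity set"
  have "(semilattice_variety :: 'a magma set) = models ?B"
  proof (intro Set.set_eqI iffI)
    fix S :: "'a magma"
    assume "S \<in> models ?B"
    then have S: "is_semigroup S"
      "\<And>\<phi> :: nat \<Rightarrow> _. range \<phi> \<subseteq> carrier S \<Longrightarrow> mul S (\<phi> 0) (\<phi> 1) = mul S (\<phi> 1) (\<phi> 0)"
      "\<And>\<phi> :: nat \<Rightarrow> _. range \<phi> \<subseteq> carrier S \<Longrightarrow> mul S (\<phi> 0) (\<phi> 0) = \<phi> 0"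
      by (auto simp: models_def satisfies_def)
    have "mul S a b = mul S b a" "mul S a a = a" if "a \<in> carrier S" "b \<in> carrier S" for a b
      using S(2,3)[OF two_letter_valuation[OF that]] by simp_all
    with S(1) show "S \<in> semilattice_variety"
      by (auto simp: semilattice_variety_def)
  qed (auto simp: semilattice_variety_def models_def satisfies_def image_subset_iff)
  then show ?thesis
    using is_varietyI[of ?B semilattice_variety] by (simp add: SEM_def is_identity_def)
qed

lemma word_value_closed:
  assumes "is_semigroup S" "range \<phi> \<subseteq> carrier S" "w \<noteq> []"
  shows "word_value S \<phi> w \<in> carrier S"
  using assms(3)
proof (induction w rule: induct_list012)
  case (3 x y w)
  then show ?case
    using assms(1,2) by (auto simp: is_semigroup_def)
qed (use assms(2) in auto)

lemma word_value_append:
  assumes S: "is_semigroup S" "range \<phi> \<subseteq> carrier S" and "u \<noteq> []" "v \<noteq> []"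
  shows "word_value S \<phi> (u @ v) = mul S (word_value S \<phi> u) (word_value S \<phi> v)"
  using assms(3)
proof (induction u rule: induct_list012)
  case (2 x)
  then show ?case
    using \<open>v \<noteq> []\<close> by (cases v) auto
next
  case (3 x y u)
  moreover have "\<phi> x \<in> carrier S" "word_value S \<phi> (y # u) \<in> carrier S" "word_value S \<phi> v \<in> carrier S"
    using assms word_value_closed[OF S] by auto
  ultimately show ?case
    using S(1) by (simp add: is_semigroup_def)
qed simp

lemma word_value_transfer:
  assumes "\<And>a b. a \<in> C \<Longrightarrow> b \<in> C \<Longrightarrow> mul S a b \<in> C"
    and "\<And>a b. a \<in> C \<Longrightarrow> b \<in> C \<Longrightarrow> f (mul S a b) = mul T (f a) (f b)"
    and "range \<phi> \<subseteq> C" and "w \<noteq> []"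
  shows "word_value S \<phi> w \<in> C \<and> word_value T (f \<circ> \<phi>) w = f (word_value S \<phi> w)"
  using assms(4)
proof (induction w rule: induct_list012)
  case (3 x y w)
  moreover have "\<phi> x \<in> C"
    using assms(3) by auto
  ultimately show ?case
    using assms(1,2) by simp
qed (use assms(3) in auto)

lemma consequence_any_universe:
  assumes \<Sigma>: "\<forall>e\<in>\<Sigma>. is_identity e" and e: "is_identity e"
    and holds: "class_satisfies (models \<Sigma> :: ('u::infinite) magma set) {e}"
  shows "class_satisfies (models \<Sigma> :: 'v magma set) {e}"
proof -
  have "word_value S \<phi> (fst e) = word_value S \<phi> (snd e)"
    if "S \<in> models \<Sigma>" and \<phi>: "range \<phi> \<subseteq> carrier S" for S :: "'v magma" and \<phi>
  proof -
    have S: "is_semigroup S" "satisfies S \<Sigma>"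
      using that(1) by (auto simp: models_def)
    define C where "C = word_value S \<phi> ` {w. w \<noteq> []}"
    have C_sub: "C \<subseteq> carrier S"
      using word_value_closed[OF S(1) \<phi>] by (auto simp: C_def)
    have C_elim: "\<exists>w. w \<noteq> [] \<and> a = word_value S \<phi> w" if "a \<in> C" for a
      using that by (auto simp: C_def)
    have C_intro: "word_value S \<phi> w \<in> C" if "w \<noteq> []" for w
      using that by (simp add: C_def)
    have C_mul: "mul S a b \<in> C" if "a \<in> C" "b \<in> C" for a b
    proof -
      obtain u v where "u \<noteq> []" "a = word_value S \<phi> u" "v \<noteq> []" "b = word_value S \<phi> v"
        using C_elim[OF \<open>a \<in> C\<close>] C_elim[OF \<open>b \<in> C\<close>] by metis
      then have "mul S a b = word_value S \<phi> (u @ v)"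
        using word_value_append[OF S(1) \<phi>] by simp
      then show ?thesis
        using C_intro[of "u @ v"] \<open>u \<noteq> []\<close> by simp
    qed
    have \<phi>C: "range \<phi> \<subseteq> C"
    proof
      fix a assume "a \<in> range \<phi>"
      then show "a \<in> C"
        using C_intro[of "[i]" for i] by auto
    qed
    have "countable C"
      by (auto simp: C_def)
    then have "inj_on (to_nat_on C) C"
      by (rule inj_on_to_nat_on)
    moreover obtain h :: "nat \<Rightarrow> 'u" where "inj h"
      using infinite_countable_subset[OF infinite_UNIV] by blast
    ultimately have f': "inj_on (h \<circ> to_nat_on C) C"
      by (blast intro: comp_inj_on inj_on_subset)
    define f where "f = h \<circ> to_nat_on C"
    have f: "inj_on f C"
      using f' by (simp add: f_def)
    define g where "g = inv_into C f"
    have gf: "g (f a) = a" if "a \<in> C" for a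
      using f that by (simp add: g_def)
    define T :: "'u magma" where "T = \<lparr>carrier = f ` C, mul = \<lambda>a b. f (mul S (g a) (g b))\<rparr>"
    have fmul: "f (mul S a b) = mul T (f a) (f b)" if "a \<in> C" "b \<in> C" for a b
      using that by (simp add: T_def gf)
    have T_sg: "is_semigroup T"
      unfolding is_semigroup_def
    proof (intro conjI ballI)
      show "carrier T \<noteq> {}"
        using \<phi>C by (auto simp: T_def)
    next
      fix a b assume "a \<in> carrier T" "b \<in> carrier T"
      then show "mul T a b \<in> carrier T"
        using C_mul gf by (auto simp: T_def)
    next
      fix a b c assume "a \<in> carrier T" "b \<in> carrier T" "c \<in> carrier T"
      then obtain a' b' c' where *: "a' \<in> C" "b' \<in> C" "c' \<in> C" "a = f a'" "b = f b'" "c = f c'"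
        by (auto simp: T_def)
      moreover have "mul S (mul S a' b') c' = mul S a' (mul S b' c')"
        using S(1) C_sub *(1-3) unfolding is_semigroup_def by blast
      ultimately show "mul T (mul T a b) c = mul T a (mul T b c)"
        using C_mul by (simp add: T_def gf)
    qed
    have T_sat: "satisfies T \<Sigma>"
      unfolding satisfies_def
    proof (clarify)
      fix u v and \<psi> :: "nat \<Rightarrow> 'u"
      assume uv: "(u, v) \<in> \<Sigma>" and \<psi>: "range \<psi> \<subseteq> carrier T"
      have ne: "u \<noteq> []" "v \<noteq> []"
        using \<Sigma> uv by (auto simp: is_identity_def)
      have \<psi>i: "g (\<psi> i) \<in> C \<and> f (g (\<psi> i)) = \<psi> i" for i
      proof -
        obtain c where "c \<in> C" "\<psi> i = f c"
          using \<psi> by (auto simp: T_def image_subset_iff)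
        then show ?thesis
          by (simp add: gf)
      qed
      have g\<psi>: "range (g \<circ> \<psi>) \<subseteq> C" and eq: "f \<circ> (g \<circ> \<psi>) = \<psi>"
        using \<psi>i by (auto simp: fun_eq_iff)
      have "word_value T \<psi> w = f (word_value S (g \<circ> \<psi>) w)" if "w \<noteq> []" for w
        using word_value_transfer[of C S f T "g \<circ> \<psi>" w, unfolded eq, OF C_mul fmul g\<psi> that]
        by simp
      moreover have "word_value S (g \<circ> \<psi>) u = word_value S (g \<circ> \<psi>) v"
        using S(2) uv g\<psi> C_sub unfolding satisfies_def by blast
      ultimately show "word_value T \<psi> u = word_value T \<psi> v"
        using ne by simp
    qed
    have ran: "range (f \<circ> \<phi>) \<subseteq> carrier T"
      using \<phi>C by (auto simp: T_def)
    have "satisfies T {e}"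
      using T_sg T_sat holds by (auto simp: models_def class_satisfies_def)
    then have "word_value T (f \<circ> \<phi>) (fst e) = word_value T (f \<circ> \<phi>) (snd e)"
      using ran by (auto simp: satisfies_def split: prod.splits)
    moreover have tr: "word_value S \<phi> w \<in> C \<and> word_value T (f \<circ> \<phi>) w = f (word_value S \<phi> w)"
      if "w \<noteq> []" for w
      by (rule word_value_transfer[OF C_mul fmul \<phi>C that])
    ultimately show ?thesis
      using e inj_onD[OF f] by (simp add: is_identity_def)
  qed
  then show ?thesis
    by (auto simp: class_satisfies_def satisfies_def split: prod.splits)
qed

end

theory Submission
  imports Defs "HOL-Library.Multiset"
begin

text \<open>
  A variety is determined by its equational theory, and the theories are exactly the fully
  invariant congruences on the free semigroup. The correspondence reverses inclusion, so joins of
  varieties become intersections of congruences and meets become joins of congruences. The proof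
  is carried out with congruences; \<open>theory_of_models\<close> (completeness of equational logic),
  \<open>theory_join\<close> and \<open>theory_meet\<close> are the dictionary.

  That cancellable elements are modular holds in every lattice.

  Suppose that \<open>V\<close> is modular with theory \<open>R\<close>. Applying modularity to a congruence \<open>\<alpha>\<close> and to its
  restriction to an ideal, where \<open>\<alpha>\<close> has small classes, shows that the class of a suitable word
  under \<open>R \<inter> \<alpha>\<close> is not a singleton (\<open>modular_test\<close>). Two choices of \<open>\<alpha>\<close> yield the identities
  \<open>x\<^sup>2y \<approx> xy\<^sup>2\<close> and \<open>x\<^sup>2y \<approx> x\<^sup>iy\<^sup>j\<close> for some \<open>i \<ge> 2\<close>, \<open>j \<ge> 1\<close> with \<open>i + j \<ge> 4\<close>. Together with
  commutativity they identify all nonlinear words of length at least three that have the same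
  letters. If \<open>V\<close> contains the semilattices, then identifying all such words with one another gives
  the theory of \<open>N\<close> and \<open>V = SL \<or> N\<close>; otherwise these words are already identified and \<open>V = N\<close>.

  Conversely, let \<open>R\<close> be the theory of \<open>N\<close>. The words equal to zero in \<open>N\<close> form one class of \<open>R\<close>,
  and the remaining words are linear or squares of letters and are related only to their own
  permutations. Let \<open>\<alpha>\<close> and \<open>\<beta>\<close> have the same intersection with \<open>R\<close> and the same join with \<open>R\<close>.
  They agree on the zero words, so it is enough to show that a word \<open>u\<close> outside this class
  that is related by \<open>\<alpha>\<close> to something new is related by both congruences to one and the same zero
  word. As the joins coincide, \<open>\<beta>\<close> also relates \<open>u\<close> to something new. For linear \<open>u\<close> the theorem
  \<open>linear_word_periodic\<close> now says that each of \<open>\<alpha>\<close> and \<open>\<beta>\<close> identifies \<open>u\<close> with a word obtained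
  from \<open>u\<close> by raising some factor \<open>P\<close> to a high power. Inspection of the relative position of the
  two factors shows that the two resulting words are congruent (\<open>power_rules_meet\<close>). The case
  \<open>V = SL \<or> N\<close> is reduced to the case \<open>V = N\<close>: if \<open>\<alpha>\<close> and \<open>\<beta>\<close> preserve the set of letters,
  then this is immediate, and otherwise both of them allow new letters to be inserted in a
  common way (\<open>common_content_extension\<close>).

  The main work is in \<open>linear_word_periodic\<close>. A rule \<open>u \<approx> w\<close> with linear \<open>u\<close> and longer \<open>w\<close>
  over the same letters may be applied to every factor of \<open>w\<close> of length at least \<open>|u|\<close>, in any
  decomposition into blocks. Unless \<open>w\<close> begins with a power of the first letter or ends with a power of the
  last letter and these letters do not occur elsewhere, such rewriting mixes the letters so well that every
  word, in particular \<open>uu\<close>, occurs as a factor of some word congruent to \<open>u\<close>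
  (\<open>factor_exists\<close>); periodicity then gives \<open>u \<approx> u\<^sup>d\<^sup>+\<^sup>1\<close>.
\<close>

section \<open>Fully invariant congruences on the free semigroup\<close>

text \<open>
  The endomorphism of the free semigroup that is given by the images of the letters. Words are
  nonempty lists, so the images have to be nonempty; this is required separately.
\<close>

definition subst :: "(nat \<Rightarrow> word) \<Rightarrow> word \<Rightarrow> word" where
  "subst f w = concat (map f w)"

definition nonerasing :: "(nat \<Rightarrow> word) \<Rightarrow> bool" where
  "nonerasing f \<longleftrightarrow> (\<forall>i. f i \<noteq> [])"

lemma subst_simps [simp]:
  "subst f [] = []" "subst f (x # w) = f x @ subst f w" "subst f (u @ v) = subst f u @ subst f v"
  by (simp_all add: subst_def)

lemma subst_Nil_iff: "nonerasing f \<Longrightarrow> subst f w = [] \<longleftrightarrow> w = []"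
  by (cases w) (auto simp: nonerasing_def)

lemma set_subst: "set (subst f w) = (\<Union>x\<in>set w. set (f x))"
  by (simp add: subst_def)

lemma subst_cong: "(\<And>x. x \<in> set w \<Longrightarrow> f x = g x) \<Longrightarrow> subst f w = subst g w"
  unfolding subst_def by (simp cong: map_cong)

lemma subst_singleton_id: "(\<And>x. x \<in> set w \<Longrightarrow> f x = [x]) \<Longrightarrow> subst f w = w"
  by (induction w) auto

lemma length_subst: "nonerasing f \<Longrightarrow> length w \<le> length (subst f w)"
proof (induction w)
  case (Cons x w)
  have "length (f x) \<ge> 1"
    using Cons.prems by (simp add: nonerasing_def Suc_le_eq)
  with Cons show ?case by simp
qed simp

text \<open>
  A congruence on the free semigroup of nonempty words that is closed under substitution. The
  contexts \<open>l\<close> and \<open>r\<close> may be empty.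
\<close>

locale fully_invariant_congruence =
  fixes R :: "identity set"
  assumes nonempty: "(u, v) \<in> R \<Longrightarrow> u \<noteq> [] \<and> v \<noteq> []"
    and refl: "u \<noteq> [] \<Longrightarrow> (u, u) \<in> R"
    and sym: "(u, v) \<in> R \<Longrightarrow> (v, u) \<in> R"
    and trans: "(u, v) \<in> R \<Longrightarrow> (v, w) \<in> R \<Longrightarrow> (u, w) \<in> R"
    and context_closed: "(u, v) \<in> R \<Longrightarrow> (l @ u @ r, l @ v @ r) \<in> R"
    and subst_closed: "(u, v) \<in> R \<Longrightarrow> nonerasing f \<Longrightarrow> (subst f u, subst f v) \<in> R"
begin

lemma append_left: "(u, v) \<in> R \<Longrightarrow> (l @ u, l @ v) \<in> R"
  using context_closed[of u v l "[]"] by simp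

lemma append_right: "(u, v) \<in> R \<Longrightarrow> (u @ r, v @ r) \<in> R"
  using context_closed[of u v "[]" r] by simp

lemma append_cong: "(u, v) \<in> R \<Longrightarrow> (u', v') \<in> R \<Longrightarrow> (u @ u', v @ v') \<in> R"
  using append_left append_right trans by blast

lemma subst_pointwise:
  assumes "w \<noteq> []" and "\<And>x. x \<in> set w \<Longrightarrow> (f x, g x) \<in> R"
  shows "(subst f w, subst g w) \<in> R"
  using assms
proof (induction w rule: induct_list012)
  case (3 x y w)
  have "(f x, g x) \<in> R" "(subst f (y # w), subst g (y # w)) \<in> R"
    using 3 by auto
  then show ?case
    using append_cong by fastforce
qed auto

end

lemma fully_invariant_congruence_Int:
  assumes "fully_invariant_congruence A" "fully_invariant_congruence B"
  shows "fully_invariant_congruence (A \<inter> B)"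
proof -
  interpret A: fully_invariant_congruence A by fact
  interpret B: fully_invariant_congruence B by fact
  show ?thesis
  proof
    show "(u, w) \<in> A \<inter> B" if "(u, v) \<in> A \<inter> B" "(v, w) \<in> A \<inter> B" for u v w
      using that A.trans[of u v w] B.trans[of u v w] by simp
    show "u \<noteq> [] \<and> v \<noteq> []" if "(u, v) \<in> A \<inter> B" for u v
      using that A.nonempty by blast
  qed (simp_all add: A.refl B.refl A.sym B.sym A.context_closed B.context_closed
        A.subst_closed B.subst_closed)
qed

text \<open>
  The transitive closure of the union is the join of two fully invariant congruences.
\<close>

lemma fully_invariant_congruence_join:
  assumes "fully_invariant_congruence A" "fully_invariant_congruence B"
  shows "fully_invariant_congruence ((A \<union> B)\<^sup>+)"
proof -
  interpret A: fully_invariant_congruence A by fact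
  interpret B: fully_invariant_congruence B by fact
  show ?thesis
  proof
    fix u v assume "(u, v) \<in> (A \<union> B)\<^sup>+"
    then show "u \<noteq> [] \<and> v \<noteq> []"
      by (induction rule: trancl_induct) (use A.nonempty B.nonempty in blast)+
    have "Relation.sym (A \<union> B)"
      using A.sym B.sym by (auto simp: sym_def)
    with \<open>(u, v) \<in> (A \<union> B)\<^sup>+\<close> show "(v, u) \<in> (A \<union> B)\<^sup>+"
      by (meson sym_trancl symE)
  next
    fix u v l r assume "(u, v) \<in> (A \<union> B)\<^sup>+"
    then show "(l @ u @ r, l @ v @ r) \<in> (A \<union> B)\<^sup>+"
    proof (induction rule: trancl_induct)
      case (base y)
      then show ?case using A.context_closed B.context_closed by blast
    next
      case (step y z)
      then have "(l @ y @ r, l @ z @ r) \<in> A \<union> B"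
        using A.context_closed B.context_closed by blast
      with step show ?case by (meson trancl.simps)
    qed
  next
    fix u v f assume "(u, v) \<in> (A \<union> B)\<^sup>+" "nonerasing f"
    then show "(subst f u, subst f v) \<in> (A \<union> B)\<^sup>+"
    proof (induction rule: trancl_induct)
      case (base y)
      then show ?case using A.subst_closed B.subst_closed by blast
    next
      case (step y z)
      then have "(subst f y, subst f z) \<in> A \<union> B"
        using A.subst_closed B.subst_closed by blast
      with step show ?case by (meson trancl.simps)
    qed
  qed (use A.refl in auto)
qed

section \<open>Varieties and their equational theories\<close>

lemma word_value_subst:
  assumes S: "is_semigroup S" "range \<phi> \<subseteq> carrier S" and f: "nonerasing f" and "w \<noteq> []"
  shows "word_value S \<phi> (subst f w) = word_value S (\<lambda>i. word_value S \<phi> (f i)) w"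
  using assms(4)
proof (induction w rule: induct_list012)
  case (3 x y w)
  have "word_value S \<phi> (subst f (x # y # w)) = word_value S \<phi> (f x @ subst f (y # w))"
    by simp
  also have "\<dots> = mul S (word_value S \<phi> (f x)) (word_value S \<phi> (subst f (y # w)))"
    using f subst_Nil_iff[OF f, of "y # w"] by (intro word_value_append[OF S]) (auto simp: nonerasing_def)
  finally show ?case
    using 3 by simp
qed auto

lemma in_equational_theory_iff:
  "(u, v) \<in> equational_theory K \<longleftrightarrow> u \<noteq> [] \<and> v \<noteq> [] \<and>
     (\<forall>S\<in>K. \<forall>\<phi>. range \<phi> \<subseteq> carrier S \<longrightarrow> word_value S \<phi> u = word_value S \<phi> v)"
  by (auto simp: equational_theory_def is_identity_def class_satisfies_def satisfies_def)

lemma fully_invariant_congruence_theory: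
  assumes "\<And>S. S \<in> K \<Longrightarrow> is_semigroup S"
  shows "fully_invariant_congruence (equational_theory K)"
proof
  fix u v l r assume uv: "(u, v) \<in> equational_theory K"
  have "word_value S \<phi> (l @ u @ r) = word_value S \<phi> (l @ v @ r)"
    if "S \<in> K" "range \<phi> \<subseteq> carrier S" for S \<phi>
  proof -
    note app = word_value_append[OF assms[OF that(1)] that(2)]
    have ne: "u \<noteq> []" "v \<noteq> []" and eq: "word_value S \<phi> u = word_value S \<phi> v"
      using uv that unfolding in_equational_theory_iff by blast+
    have "word_value S \<phi> (u @ r) = word_value S \<phi> (v @ r)"
      using app[OF ne(1), of r] app[OF ne(2), of r] eq by (cases "r = []") auto
    then show ?thesis
      using app[of l "u @ r"] app[of l "v @ r"] ne by (cases "l = []") auto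
  qed
  with uv show "(l @ u @ r, l @ v @ r) \<in> equational_theory K"
    by (auto simp: in_equational_theory_iff)
next
  fix u v f assume uv: "(u, v) \<in> equational_theory K" and f: "nonerasing f"
  have "word_value S \<phi> (subst f u) = word_value S \<phi> (subst f v)"
    if "S \<in> K" "range \<phi> \<subseteq> carrier S" for S \<phi>
  proof -
    have "range (\<lambda>i. word_value S \<phi> (f i)) \<subseteq> carrier S"
      using f word_value_closed[OF assms[OF that(1)] that(2)] by (auto simp: nonerasing_def)
    then show ?thesis
      using uv that word_value_subst[OF assms[OF that(1)] that(2) f]
      by (simp add: in_equational_theory_iff)
  qed
  with uv show "(subst f u, subst f v) \<in> equational_theory K"
    by (auto simp: in_equational_theory_iff subst_Nil_iff[OF f])
qed (auto simp: in_equational_theory_iff)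

text \<open>
  The quotient of the free semigroup by \<open>R\<close>, whose elements are the classes of nonempty words.
\<close>

definition quotient_semigroup :: "identity set \<Rightarrow> word set magma" where
  "quotient_semigroup R =
     \<lparr>carrier = {R `` {w} | w. w \<noteq> []}, mul = \<lambda>X Y. {w. \<exists>x\<in>X. \<exists>y\<in>Y. (x @ y, w) \<in> R}\<rparr>"

context fully_invariant_congruence
begin

lemma class_eq_iff: "u \<noteq> [] \<Longrightarrow> v \<noteq> [] \<Longrightarrow> R `` {u} = R `` {v} \<longleftrightarrow> (u, v) \<in> R"
proof -
  assume "u \<noteq> []" "v \<noteq> []"
  have "w \<in> R `` {u} \<longleftrightarrow> w \<in> R `` {v}" if "(u, v) \<in> R" for w
    using that sym[OF that] trans[of u v w] trans[of v u w] by auto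
  moreover have "v \<in> R `` {v}"
    using refl[OF \<open>v \<noteq> []\<close>] by simp
  ultimately show ?thesis
    by auto
qed

lemma mul_class:
  assumes "u \<noteq> []" "v \<noteq> []"
  shows "mul (quotient_semigroup R) (R `` {u}) (R `` {v}) = R `` {u @ v}"
proof -
  have "(u @ v, w) \<in> R" if "(u, x) \<in> R" "(v, y) \<in> R" "(x @ y, w) \<in> R" for x y w
    using append_cong[OF that(1,2)] that(3) by (rule trans)
  then show ?thesis
    using refl[OF assms(1)] refl[OF assms(2)] by (auto simp: quotient_semigroup_def)
qed

lemma quotient_is_semigroup: "is_semigroup (quotient_semigroup R)"
  unfolding is_semigroup_def
proof (intro conjI ballI)
  let ?Q = "quotient_semigroup R"
  show "carrier ?Q \<noteq> {}"
    by (auto simp: quotient_semigroup_def)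
  fix a b assume "a \<in> carrier ?Q" "b \<in> carrier ?Q"
  then obtain u v where uv: "u \<noteq> []" "v \<noteq> []" "a = R `` {u}" "b = R `` {v}"
    by (auto simp: quotient_semigroup_def)
  then have "mul ?Q a b = R `` {u @ v}"
    by (simp add: mul_class)
  then show "mul ?Q a b \<in> carrier ?Q"
    using uv by (auto simp: quotient_semigroup_def)
  fix c assume "c \<in> carrier ?Q"
  then obtain w where w: "w \<noteq> []" "c = R `` {w}"
    by (auto simp: quotient_semigroup_def)
  then show "mul ?Q (mul ?Q a b) c = mul ?Q a (mul ?Q b c)"
    using uv by (simp add: mul_class)
qed

lemma word_value_quotient:
  assumes "\<And>i. f i \<noteq> []" "w \<noteq> []"
  shows "word_value (quotient_semigroup R) (\<lambda>i. R `` {f i}) w = R `` {subst f w}"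
  using assms(2)
proof (induction w rule: induct_list012)
  case (3 x y w)
  then show ?case
    using assms(1) by (simp add: mul_class)
qed auto

lemma quotient_satisfies: "satisfies (quotient_semigroup R) R"
  unfolding satisfies_def
proof clarify
  fix u v and \<phi> :: "nat \<Rightarrow> word set"
  assume uv: "(u, v) \<in> R" and \<phi>: "range \<phi> \<subseteq> carrier (quotient_semigroup R)"
  have "\<forall>i. \<exists>w. w \<noteq> [] \<and> \<phi> i = R `` {w}"
    using \<phi> by (auto simp: quotient_semigroup_def)
  then obtain f where f: "\<And>i. f i \<noteq> []" "\<And>i. \<phi> i = R `` {f i}"
    by metis
  have \<phi>_eq: "\<phi> = (\<lambda>i. R `` {f i})"
    using f(2) by auto
  have ne: "u \<noteq> []" "v \<noteq> []"
    using nonempty[OF uv] by auto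
  have "nonerasing f"
    using f(1) by (simp add: nonerasing_def)
  with uv have "(subst f u, subst f v) \<in> R"
    by (rule subst_closed)
  then show "word_value (quotient_semigroup R) \<phi> u = word_value (quotient_semigroup R) \<phi> v"
    using ne nonempty unfolding \<phi>_eq by (simp add: word_value_quotient[OF f(1)] class_eq_iff)
qed

text \<open>
  Birkhoff's completeness theorem: the free object of the variety refutes every identity outside
  of \<open>R\<close>.
\<close>

theorem theory_of_models: "equational_theory (models R :: ('u::infinite) magma set) = R"
proof
  show "R \<subseteq> equational_theory (models R :: 'u magma set)"
  proof clarify
    fix u v assume "(u, v) \<in> R"
    then show "(u, v) \<in> equational_theory (models R :: 'u magma set)"
      using nonempty unfolding in_equational_theory_iff models_def satisfies_def by blast
  qed
  show "equational_theory (models R :: 'u magma set) \<subseteq> R"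
  proof clarify
    fix u v assume uv: "(u, v) \<in> equational_theory (models R :: 'u magma set)"
    then have "is_identity (u, v)" "class_satisfies (models R :: 'u magma set) {(u, v)}"
      by (simp_all add: equational_theory_def)
    moreover have "\<forall>e\<in>R. is_identity e"
      using nonempty by (auto simp: is_identity_def)
    ultimately have "class_satisfies (models R :: word set magma set) {(u, v)}"
      using consequence_any_universe by blast
    moreover have "quotient_semigroup R \<in> models R"
      using quotient_is_semigroup quotient_satisfies by (simp add: models_def)
    moreover have "range (\<lambda>i. R `` {[i]}) \<subseteq> carrier (quotient_semigroup R)"
      by (auto simp: quotient_semigroup_def)
    ultimately have "word_value (quotient_semigroup R) (\<lambda>i. R `` {[i]}) u
        = word_value (quotient_semigroup R) (\<lambda>i. R `` {[i]}) v"
      unfolding class_satisfies_def satisfies_def by blast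
    moreover have ne: "u \<noteq> []" "v \<noteq> []"
      using uv by (auto simp: in_equational_theory_iff)
    ultimately have "R `` {subst (\<lambda>i. [i]) u} = R `` {subst (\<lambda>i. [i]) v}"
      by (simp add: word_value_quotient)
    then show "(u, v) \<in> R"
      using class_eq_iff[OF ne] by (simp add: subst_singleton_id)
  qed
qed

lemma models_in_SEM: "models R \<in> carrier SEM"
proof -
  have "\<forall>e\<in>R. is_identity e"
    using nonempty by (auto simp: is_identity_def)
  then show ?thesis
    using is_varietyI[of R "models R"] by (simp add: SEM_def)
qed

end

lemma models_of_theory:
  assumes "V \<in> carrier SEM"
  shows "models (equational_theory V) = V"
proof -
  have V: "is_variety V"
    using assms by (simp add: SEM_def)
  have "\<forall>S\<in>V. is_semigroup S"
    using V variety_semigroup by blast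
  then show ?thesis
    using models_theory_least(2)[of V] models_theory_least(3)[of V V] V by blast
qed

lemma theory_fully_invariant:
  "V \<in> carrier SEM \<Longrightarrow> fully_invariant_congruence (equational_theory V)"
  by (rule fully_invariant_congruence_theory) (auto simp: SEM_def variety_semigroup)

lemma join_in_SEM:
  assumes "V \<in> carrier SEM" "W \<in> carrier SEM"
  shows "V \<squnion>\<^bsub>SEM\<^esub> W \<in> carrier SEM"
  using SEM_join_least[of V W] assms unfolding SEM_join[OF assms] by (simp add: SEM_def least_def Upper_def)

lemma meet_in_SEM:
  assumes "V \<in> carrier SEM" "W \<in> carrier SEM"
  shows "V \<sqinter>\<^bsub>SEM\<^esub> W \<in> carrier SEM"
  using is_variety_Int[of V W] assms unfolding SEM_meet[OF assms] by (simp add: SEM_def)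

lemma theory_join:
  fixes V W :: "('u::infinite) magma set"
  assumes "V \<in> carrier SEM" "W \<in> carrier SEM"
  shows "equational_theory (V \<squnion>\<^bsub>SEM\<^esub> W) = equational_theory V \<inter> equational_theory W"
proof -
  have "equational_theory (V \<union> W) = equational_theory V \<inter> equational_theory W"
    by (auto simp: equational_theory_def class_satisfies_def)
  moreover have "fully_invariant_congruence (equational_theory V \<inter> equational_theory W)"
    using assms by (intro fully_invariant_congruence_Int theory_fully_invariant)
  ultimately show ?thesis
    using fully_invariant_congruence.theory_of_models by (simp add: SEM_join[OF assms])
qed

lemma theory_meet:
  fixes V W :: "('u::infinite) magma set"
  assumes "V \<in> carrier SEM" "W \<in> carrier SEM"
  shows "equational_theory (V \<sqinter>\<^bsub>SEM\<^esub> W) = (equational_theory V \<union> equational_theory W)\<^sup>+"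
proof -
  let ?J = "(equational_theory V \<union> equational_theory W)\<^sup>+"
  have "satisfies S ?J" if S: "S \<in> V \<inter> W" for S
    unfolding satisfies_def
  proof clarify
    fix u v and \<phi> :: "nat \<Rightarrow> 'u" assume "(u, v) \<in> ?J" and \<phi>: "range \<phi> \<subseteq> carrier S"
    then show "word_value S \<phi> u = word_value S \<phi> v"
      by (induction rule: trancl_induct) (use S \<phi> in \<open>auto simp: in_equational_theory_iff\<close>)
  qed
  moreover have "satisfies S (equational_theory V) \<and> satisfies S (equational_theory W)"
    if "satisfies S ?J" for S :: "'u magma"
    using that by (auto simp: satisfies_def)
  ultimately have "V \<inter> W = models ?J"
    using models_of_theory[OF assms(1)] models_of_theory[OF assms(2)] by (auto simp: models_def)
  moreover have "fully_invariant_congruence ?J"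
    using assms by (intro fully_invariant_congruence_join theory_fully_invariant)
  ultimately show ?thesis
    using fully_invariant_congruence.theory_of_models by (simp add: SEM_meet[OF assms])
qed

lemma theory_inject:
  "V \<in> carrier SEM \<Longrightarrow> W \<in> carrier SEM \<Longrightarrow> equational_theory V = equational_theory W \<Longrightarrow> V = W"
  using models_of_theory by metis

lemma cancellable_SEM_I:
  fixes V :: "('u::infinite) magma set"
  assumes V: "V \<in> carrier SEM"
    and cancel: "\<And>\<alpha> \<beta>. fully_invariant_congruence \<alpha> \<Longrightarrow> fully_invariant_congruence \<beta> \<Longrightarrow>
      equational_theory V \<inter> \<alpha> = equational_theory V \<inter> \<beta> \<Longrightarrow>
      (equational_theory V \<union> \<alpha>)\<^sup>+ = (equational_theory V \<union> \<beta>)\<^sup>+ \<Longrightarrow> \<alpha> = \<beta>"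
  shows "cancellable_element SEM V"
  unfolding cancellable_element_def
proof (intro conjI ballI impI V)
  fix Y Z :: "'u magma set"
  assume "Y \<in> carrier SEM" "Z \<in> carrier SEM"
    and eq: "V \<squnion>\<^bsub>SEM\<^esub> Y = V \<squnion>\<^bsub>SEM\<^esub> Z \<and> V \<sqinter>\<^bsub>SEM\<^esub> Y = V \<sqinter>\<^bsub>SEM\<^esub> Z"
  note join_Y = theory_join[OF V \<open>Y \<in> carrier SEM\<close>] and join_Z = theory_join[OF V \<open>Z \<in> carrier SEM\<close>]
  note meet_Y = theory_meet[OF V \<open>Y \<in> carrier SEM\<close>] and meet_Z = theory_meet[OF V \<open>Z \<in> carrier SEM\<close>]
  have "equational_theory Y = equational_theory Z"
  proof (rule cancel)
    show "equational_theory V \<inter> equational_theory Y = equational_theory V \<inter> equational_theory Z"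
      using join_Y join_Z eq by simp
    show "(equational_theory V \<union> equational_theory Y)\<^sup>+ = (equational_theory V \<union> equational_theory Z)\<^sup>+"
      using meet_Y meet_Z eq by simp
  qed (use \<open>Y \<in> carrier SEM\<close> \<open>Z \<in> carrier SEM\<close> theory_fully_invariant in auto)
  then show "Y = Z"
    using \<open>Y \<in> carrier SEM\<close> \<open>Z \<in> carrier SEM\<close> theory_inject by blast
qed

text \<open>
  The modular law of \<open>SEM\<close>, read in the dual lattice of fully invariant congruences.
\<close>

lemma modular_SEM_D:
  fixes V :: "('u::infinite) magma set"
  assumes mod: "modular_element SEM V"
    and \<alpha>: "fully_invariant_congruence \<alpha>" and \<beta>: "fully_invariant_congruence \<beta>" and "\<beta> \<subseteq> \<alpha>"
  shows "(equational_theory V \<union> \<beta>)\<^sup>+ \<inter> \<alpha> = (equational_theory V \<inter> \<alpha> \<union> \<beta>)\<^sup>+"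
proof -
  let ?Y = "models \<alpha> :: 'u magma set" and ?Z = "models \<beta> :: 'u magma set"
  have V: "V \<in> carrier SEM"
    using mod unfolding modular_element_def by (rule conjunct1)
  have Y: "?Y \<in> carrier SEM"
    by (rule fully_invariant_congruence.models_in_SEM[OF \<alpha>])
  have Z: "?Z \<in> carrier SEM"
    by (rule fully_invariant_congruence.models_in_SEM[OF \<beta>])
  have "?Y \<subseteq> ?Z"
    using \<open>\<beta> \<subseteq> \<alpha>\<close> unfolding models_def satisfies_def by blast
  then have "?Y \<sqsubseteq>\<^bsub>SEM\<^esub> ?Z"
    by (simp add: SEM_def)
  then have eq: "(V \<squnion>\<^bsub>SEM\<^esub> ?Y) \<sqinter>\<^bsub>SEM\<^esub> ?Z = (V \<sqinter>\<^bsub>SEM\<^esub> ?Z) \<squnion>\<^bsub>SEM\<^esub> ?Y"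
    using mod Y Z unfolding modular_element_def by blast
  have th: "equational_theory ?Y = \<alpha>" "equational_theory ?Z = \<beta>"
    by (rule fully_invariant_congruence.theory_of_models[OF \<alpha>])
      (rule fully_invariant_congruence.theory_of_models[OF \<beta>])
  note J = join_in_SEM[OF V Y] and M = meet_in_SEM[OF V Z]
  show ?thesis
    using arg_cong[OF eq, of equational_theory]
    unfolding theory_meet[OF J Z] theory_join[OF M Y] theory_join[OF V Y] theory_meet[OF V Z] th
    by (rule HOL.sym)
qed

text \<open>
  For \<open>y \<le> z\<close> the two sides of the modular law have the same join and the same meet with \<open>x\<close>.
\<close>

lemma (in lattice) cancellable_imp_modular:
  assumes "cancellable_element L x"
  shows "modular_element L x"
  unfolding modular_element_def
proof (intro conjI ballI impI)
  show x: "x \<in> carrier L"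
    using assms unfolding cancellable_element_def by (rule conjunct1)
  fix y z assume y: "y \<in> carrier L" and z: "z \<in> carrier L" and yz: "y \<sqsubseteq> z"
  let ?p = "(x \<squnion> y) \<sqinter> z" and ?q = "(x \<sqinter> z) \<squnion> y"
  note s = join_closed[OF x y] and i = meet_closed[OF x z]
  note p = meet_closed[OF s z] and q = join_closed[OF i y]
  note xp = join_closed[OF x p] meet_closed[OF x p] and xq = join_closed[OF x q] meet_closed[OF x q]
  have "x \<sqinter> z \<sqsubseteq> ?p"
    by (rule meet_le[OF le_trans[OF meet_left[OF x z] join_left[OF x y] i x s] meet_right[OF x z] s z i])
  moreover have "y \<sqsubseteq> ?p"
    by (rule meet_le[OF join_right[OF x y] yz s z y])
  ultimately have qp: "?q \<sqsubseteq> ?p"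
    by (rule join_le[OF _ _ i y p])
  have "x \<squnion> ?p \<sqsubseteq> x \<squnion> y"
    by (rule join_le[OF join_left[OF x y] meet_left[OF s z] x p s])
  moreover have "x \<squnion> y \<sqsubseteq> x \<squnion> ?q"
    by (rule join_le[OF join_left[OF x q] le_trans[OF join_right[OF i y] join_right[OF x q] y q xq(1)] x y xq(1)])
  ultimately have "x \<squnion> ?p \<sqsubseteq> x \<squnion> ?q"
    by (rule le_trans[OF _ _ xp(1) s xq(1)])
  moreover have "x \<squnion> ?q \<sqsubseteq> x \<squnion> ?p"
    by (rule join_le[OF join_left[OF x p] le_trans[OF qp join_right[OF x p] q p xp(1)] x q xp(1)])
  ultimately have "x \<squnion> ?p = x \<squnion> ?q"
    by (rule le_antisym[OF _ _ xp(1) xq(1)])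
  moreover have "x \<sqinter> ?p = x \<sqinter> ?q"
  proof -
    have "x \<sqinter> ?p \<sqsubseteq> x \<sqinter> z"
      by (rule meet_le[OF meet_left[OF x p] le_trans[OF meet_right[OF x p] meet_right[OF s z] xp(2) p z] x z xp(2)])
    moreover have "x \<sqinter> z \<sqsubseteq> x \<sqinter> ?q"
      by (rule meet_le[OF meet_left[OF x z] join_left[OF i y] x q i])
    ultimately have "x \<sqinter> ?p \<sqsubseteq> x \<sqinter> ?q"
      by (rule le_trans[OF _ _ xp(2) i xq(2)])
    moreover have "x \<sqinter> ?q \<sqsubseteq> x \<sqinter> ?p"
      by (rule meet_le[OF meet_left[OF x q] le_trans[OF meet_right[OF x q] qp xq(2) q p] x p xq(2)])
    ultimately show ?thesis
      by (rule le_antisym[OF _ _ xp(2) xq(2)])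
  qed
  ultimately have "x \<squnion> ?p = x \<squnion> ?q \<and> x \<sqinter> ?p = x \<sqinter> ?q"
    by (rule conjI)
  then show "?p = ?q"
    by (rule assms[unfolded cancellable_element_def, THEN conjunct2, rule_format, OF p q])
qed

section \<open>Periodicity forced on linear words\<close>

text \<open>
  The power of a word, where the zeroth power is the empty list.
\<close>

definition word_power :: "word \<Rightarrow> nat \<Rightarrow> word" (infixl "\<^bold>^" 75) where
  "w \<^bold>^ k = concat (replicate k w)"

lemma word_power_simps [simp]:
  "w \<^bold>^ 0 = []" "w \<^bold>^ Suc k = w @ w \<^bold>^ k" "[] \<^bold>^ k = []"
  by (simp_all add: word_power_def)

lemma word_power_add: "w \<^bold>^ (m + n) = w \<^bold>^ m @ w \<^bold>^ n"
  by (simp add: word_power_def replicate_add)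

lemma word_power_mult: "(w \<^bold>^ m) \<^bold>^ n = w \<^bold>^ (m * n)"
  by (induction n) (simp_all add: word_power_add)

lemma word_power_Suc_right: "w \<^bold>^ k @ w = w \<^bold>^ Suc k"
  using word_power_add[of w k 1] by simp

lemma word_power_commute: "w @ w \<^bold>^ k = w \<^bold>^ k @ w"
  using word_power_Suc_right[of w k] by simp

lemma word_power_commute_append: "w \<^bold>^ k @ w @ v = w @ w \<^bold>^ k @ v"
  using word_power_commute[of w k] by (metis append_assoc)

lemma subst_word_power: "subst f (w \<^bold>^ k) = subst f w \<^bold>^ k"
  by (induction k) simp_all

lemma length_word_power: "length (w \<^bold>^ k) = k * length w"
  by (induction k) simp_all

lemma set_word_power: "set (w \<^bold>^ k) \<subseteq> set w"
  by (induction k) auto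

lemma rev_word_power: "rev (w \<^bold>^ k) = rev w \<^bold>^ k"
  by (induction k) (simp_all add: word_power_commute[symmetric])

lemma word_power_eq_Nil: "w \<^bold>^ k = [] \<longleftrightarrow> w = [] \<or> k = 0"
  by (induction k) auto

lemma word_power_singleton: "[x] \<^bold>^ k = replicate k x"
  by (induction k) simp_all

lemma subst_const: "(\<And>x. x \<in> set w \<Longrightarrow> f x = c) \<Longrightarrow> subst f w = c \<^bold>^ length w"
  by (induction w) auto

text \<open>
  The letters of a linear word can be assigned arbitrary nonempty blocks. Consequently every word
  that is at least as long as a nonempty linear word is a substitution instance of it.
\<close>

lemma assignment_exists:
  assumes "distinct xs" "length Ds = length xs" "[] \<notin> set Ds"
  shows "\<exists>f. nonerasing f \<and> map f xs = Ds"
proof -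
  define f where "f = (\<lambda>x. case map_of (zip xs Ds) x of Some D \<Rightarrow> D | None \<Rightarrow> [x])"
  have "f (xs ! i) = Ds ! i" if "i < length xs" for i
    using assms that by (simp add: f_def map_of_zip_nth)
  then have "map f xs = Ds"
    using assms(2) by (intro nth_equalityI) auto
  moreover have "nonerasing f"
    using assms(3) by (auto simp: nonerasing_def f_def split: option.splits dest!: map_of_SomeD set_zip_rightD)
  ultimately show ?thesis by blast
qed

lemma distribution_exists:
  assumes "distinct xs" "xs \<noteq> []" "length xs \<le> length w"
  shows "\<exists>f. nonerasing f \<and> subst f xs = w"
proof -
  let ?k = "length xs - 1"
  let ?Ds = "map (\<lambda>x. [x]) (take ?k w) @ [drop ?k w]"
  have "length xs > 0"
    using assms(2) by simp
  then have "?k < length w"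
    using assms(3) by linarith
  then have "length ?Ds = length xs" "[] \<notin> set ?Ds"
    using \<open>length xs > 0\<close> by auto
  from assignment_exists[OF assms(1) this] obtain f where f: "nonerasing f" "map f xs = ?Ds"
    by blast
  have "subst f xs = w"
    unfolding subst_def f(2) by simp
  with f(1) show ?thesis by blast
qed

lemma length_subst_mono:
  assumes "mset u \<subseteq># mset w" "mset u \<noteq> mset w" "nonerasing f"
  shows "length (subst f u) < length (subst f w)"
proof -
  have len: "length (subst f v) = (\<Sum>x\<in>#mset v. length (f x))" for v
    by (induction v) auto
  obtain M where M: "mset w = mset u + M" "M \<noteq> {#}"
    using assms(1,2) by (auto simp: mset_subset_eq_exists_conv)
  then obtain x M' where "M = add_mset x M'"
    by (meson multiset_cases)
  moreover have "length (f x) > 0"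
    using assms(3) by (simp add: nonerasing_def)
  ultimately show ?thesis
    by (simp add: len M(1))
qed

lemma mset_subset_of_distinct:
  assumes "distinct u" "set u \<subseteq> set w"
  shows "mset u \<subseteq># mset w"
proof (rule mset_subset_eqI)
  fix x
  show "count (mset u) x \<le> count (mset w) x"
  proof (cases "x \<in> set u")
    case True
    then have "count (mset u) x = 1" "x \<in># mset w"
      using assms by (auto simp: distinct_count_atmost_1)
    then show ?thesis
      by (simp add: Suc_le_eq)
  next
    case False
    then have "count (mset u) x = 0"
      by simp
    then show ?thesis by linarith
  qed
qed

subsection \<open>Words closed under a mixing rule\<close>

text \<open>
  A set \<open>X\<close> of words over the letters of the linear word \<open>a\<close> that is closed under the rewriting
  rule \<open>a \<rightarrow> W\<close>, applied to any factor in any decomposition into blocks. The word \<open>W\<close> is longer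
  than \<open>a\<close> and has the same letters; some occurrence of the first letter of \<open>a\<close> in \<open>W\<close> is preceded
  by another letter, and some occurrence of the last letter of \<open>a\<close> is followed by another one.
  These two adjacencies permit a later block to be moved directly in front of an earlier one.
\<close>

locale mixing_rule =
  fixes a W :: word and X :: "word set" and P Q P' Q' :: word and y y' :: nat
  assumes distinct_a: "distinct a" and set_W: "set W = set a" and length_W: "length a < length W"
    and a_in_X: "a \<in> X"
    and letters: "V \<in> X \<Longrightarrow> set V \<subseteq> set a"
    and rewrite: "l @ subst f a @ r \<in> X \<Longrightarrow> nonerasing f \<Longrightarrow> l @ subst f W @ r \<in> X"
    and descent_first: "W = P @ [y, hd a] @ Q" "y \<noteq> hd a"
    and descent_last: "W = P' @ [last a, y'] @ Q'" "y' \<noteq> last a"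
begin

lemma rewrite_blocks:
  assumes "l @ concat Ds @ r \<in> X" "length Ds = length a" "[] \<notin> set Ds"
  shows "\<exists>f. nonerasing f \<and> map f a = Ds \<and> l @ subst f W @ r \<in> X"
proof -
  obtain f where f: "nonerasing f" "map f a = Ds"
    using assignment_exists[OF distinct_a assms(2,3)] by blast
  then show ?thesis
    using rewrite[of l f r] assms(1) by (auto simp: subst_def)
qed

lemma set_subst_W: "set (subst f W) = set (subst f a)"
  by (simp add: set_subst set_W)

lemma a_split_first: "\<exists>a2 a3. a = hd a # a2 @ y # a3"
proof -
  have "y \<in> set a"
    using set_W descent_first(1) by auto
  then obtain a1 a3 where a: "a = a1 @ y # a3"
    by (meson split_list)
  then obtain a2 where "a1 = hd a # a2"
    using descent_first(2) by (cases a1) auto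
  with a show ?thesis by auto
qed

lemma a_split_last: "\<exists>a1 a2. a = a1 @ y' # a2 @ [last a]"
proof -
  have "y' \<in> set a"
    using set_W descent_last(1) by auto
  then obtain a1 a3 where a: "a = a1 @ y' # a3"
    by (meson split_list)
  then obtain a2 where "a3 = a2 @ [last a]"
    using descent_last(2) by (cases a3 rule: rev_cases) auto
  with a show ?thesis by auto
qed

lemma long_words: "\<exists>V\<in>X. k \<le> length V \<and> set V = set a"
proof (induction k)
  case 0
  show ?case using a_in_X by auto
next
  case (Suc k)
  then obtain V where V: "V \<in> X" "k \<le> length V" "set V = set a"
    by blast
  have "length a \<le> length V"
    using V(3) distinct_a by (metis card_length distinct_card)
  moreover have "a \<noteq> []"
    using set_W length_W by auto
  ultimately obtain f where f: "nonerasing f" "subst f a = V"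
    using distribution_exists[OF distinct_a] by blast
  have "length (subst f a) < length (subst f W)"
    using f(1) length_W set_W mset_subset_of_distinct[OF distinct_a, of W]
    by (intro length_subst_mono) (auto dest: mset_eq_length)
  moreover have "subst f W \<in> X"
    using rewrite[of "[]" f "[]"] V(1) f by simp
  ultimately show ?case
    using V f(2) set_subst_W[of f] by (intro bexI[of _ "subst f W"]) auto
qed

text \<open>
  The letter \<open>b\<close> has an occurrence in \<open>V\<close> at distance at least \<open>k\<close> from both ends.
\<close>

definition deep :: "nat \<Rightarrow> nat \<Rightarrow> word \<Rightarrow> bool" where
  "deep k b V \<longleftrightarrow> (\<exists>l r. V = l @ [b] @ r \<and> k \<le> length l \<and> k \<le> length r)"

lemma cut_right:
  assumes "V @ T = l @ [b] @ r" "length T \<le> length r"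
  shows "\<exists>r'. V = l @ [b] @ r' \<and> length r' = length r - length T"
proof -
  have len: "length V = length l + 1 + (length r - length T)"
    using arg_cong[OF assms(1), of length] assms(2) by simp
  have "V = take (length V) (V @ T)"
    by simp
  also have "\<dots> = l @ [b] @ take (length r - length T) r"
    by (simp add: assms(1) len)
  finally show ?thesis
    using assms(2) by (intro exI[of _ "take (length r - length T) r"]) simp
qed

lemma cut_left:
  assumes "T @ V = l @ [b] @ r" "length T \<le> length l"
  shows "\<exists>l'. V = l' @ [b] @ r \<and> length l' = length l - length T"
proof -
  have "V = drop (length T) (T @ V)"
    by simp
  also have "\<dots> = drop (length T) l @ [b] @ r"
    using assms(2) by (simp add: assms(1))
  finally show ?thesis
    by (intro exI[of _ "drop (length T) l"]) simp
qed

lemma split_three: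
  assumes "length V = i + j + k"
  shows "\<exists>u v w. V = u @ v @ w \<and> length u = i \<and> length v = j \<and> length w = k"
proof -
  have "V = take i V @ take j (drop i V) @ drop (i + j) V"
    by (metis append_take_drop_id drop_drop add.commute)
  moreover have "length (take i V) = i" "length (take j (drop i V)) = j" "length (drop (i + j) V) = k"
    using assms by simp_all
  ultimately show ?thesis by blast
qed

text \<open>
  The first block, which may be almost the whole word, acquires a long word on its left. Hence
  occurrences of letters that are far from the right end become far from both ends. The dual
  step treats the last block.
\<close>

lemma deep_step_first:
  assumes "V \<in> X" and long: "k + length a < length V" and k: "0 < k"
  shows "\<exists>L V' T S. V = V' @ T \<and> length T \<le> k + length a \<and> k \<le> length L \<and>
    L @ V' @ S \<in> X \<and> set (L @ V' @ S) = set V"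
proof -
  obtain a2 a3 where a: "a = hd a # a2 @ y # a3"
    using a_split_first by blast
  have len_a: "length a = length a2 + length a3 + 2"
    using arg_cong[OF a, of length] by simp
  let ?t = "length a2 + k + length a3"
  have t: "?t < length V"
    using long len_a by linarith
  define V' where "V' = take (length V - ?t) V"
  define T where "T = drop (length V - ?t) V"
  have V: "V = V' @ T" "length T = ?t" "V' \<noteq> []"
    using t by (auto simp: V'_def T_def)
  obtain m D s where T: "T = m @ D @ s" "length m = length a2" "length D = k" "length s = length a3"
    using split_three[OF V(2)] by blast
  let ?Ds = "V' # map (\<lambda>x. [x]) m @ D # map (\<lambda>x. [x]) s"
  have word: "[] @ concat ?Ds @ [] \<in> X"
    using assms(1) V(1) T(1) by simp
  have blocks: "length ?Ds = length a" "[] \<notin> set ?Ds"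
    using T V(3) k len_a by auto
  obtain f where f: "nonerasing f" "map f a = ?Ds" "[] @ subst f W @ [] \<in> X"
    using rewrite_blocks[OF word blocks] by (elim exE conjE)
  have "map f (hd a # a2 @ y # a3) = ?Ds"
    using f(2) a by simp
  then have fv: "f (hd a) = V'" "f y = D"
    using T(2) by auto
  have "subst f W = (subst f P @ D) @ V' @ subst f Q"
    by (simp add: descent_first(1) fv)
  moreover have "set (subst f W) = set V"
    using set_subst_W[of f] f(2) V(1) T(1) by (simp add: subst_def)
  moreover have "k \<le> length (subst f P @ D)" "length T \<le> k + length a"
    using T(3) V(2) len_a by simp_all
  ultimately show ?thesis
    using f(3) V(1) by (metis append_Nil append_Nil2)
qed

lemma deep_step_last:
  assumes "V \<in> X" and long: "k + length a < length V" and k: "0 < k"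
  shows "\<exists>S V' T L. V = T @ V' \<and> length T \<le> k + length a \<and> k \<le> length L \<and>
    S @ V' @ L \<in> X \<and> set (S @ V' @ L) = set V"
proof -
  obtain a1 a2 where a: "a = a1 @ y' # a2 @ [last a]"
    using a_split_last by blast
  have len_a: "length a = length a1 + length a2 + 2"
    using arg_cong[OF a, of length] by simp
  let ?t = "length a1 + k + length a2"
  have t: "?t < length V"
    using long len_a by linarith
  define V' where "V' = drop ?t V"
  define T where "T = take ?t V"
  have V: "V = T @ V'" "length T = ?t" "V' \<noteq> []"
    using t by (auto simp: V'_def T_def)
  obtain s D m where T: "T = s @ D @ m" "length s = length a1" "length D = k" "length m = length a2"
    using split_three[OF V(2)] by blast
  let ?Ds = "map (\<lambda>x. [x]) s @ D # map (\<lambda>x. [x]) m @ [V']"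
  have word: "[] @ concat ?Ds @ [] \<in> X"
    using assms(1) V(1) T(1) by simp
  have blocks: "length ?Ds = length a" "[] \<notin> set ?Ds"
    using T V(3) k len_a by auto
  obtain f where f: "nonerasing f" "map f a = ?Ds" "[] @ subst f W @ [] \<in> X"
    using rewrite_blocks[OF word blocks] by (elim exE conjE)
  have "map f (a1 @ y' # a2 @ [last a]) = ?Ds"
    using f(2) a by simp
  then have fv: "f (last a) = V'" "f y' = D"
    using T(2,4) by auto
  have "subst f W = subst f P' @ V' @ (D @ subst f Q')"
    by (simp add: descent_last(1) fv)
  moreover have "set (subst f W) = set V"
    using set_subst_W[of f] f(2) V(1) T(1) by (simp add: subst_def)
  moreover have "k \<le> length (D @ subst f Q')" "length T \<le> k + length a"
    using T(3) V(2) len_a by simp_all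
  ultimately show ?thesis
    using f(3) V(1) by (metis append_Nil append_Nil2)
qed

text \<open>
  Letters are treated one at a time. Each step reduces the margins of the letters treated before
  by at most \<open>k + 1 + |a|\<close>, so the induction hypothesis is used with a larger margin.
\<close>

lemma deep_letters:
  assumes "finite S" "S \<subseteq> set a"
  shows "\<exists>V\<in>X. set V = set a \<and> k \<le> length V \<and> (\<forall>b\<in>S. deep k b V)"
  using assms
proof (induction S arbitrary: k rule: finite_induct)
  case empty
  then show ?case using long_words by auto
next
  case (insert b S)
  define k' where "k' = Suc k"
  define m where "m = 2 * k' + length a"
  obtain V where V: "V \<in> X" "set V = set a" "2 * m + 1 \<le> length V" "\<And>c. c \<in> S \<Longrightarrow> deep (2 * m + 1) c V"
    using insert.IH[of "2 * m + 1"] insert.prems by auto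
  have "b \<in> set V"
    using insert.prems V(2) by simp
  then obtain l r where lr: "V = l @ [b] @ r"
    by (metis append_Cons append_Nil split_list)
  have long: "k' + length a < length V" "0 < k'"
    using V(3) by (auto simp: m_def k'_def)
  from lr V(3) consider "m \<le> length r" | "m \<le> length l"
    by fastforce
  then show ?case
  proof cases
    case 1
    obtain L V' T E where step: "V = V' @ T" "length T \<le> k' + length a" "k' \<le> length L"
      "L @ V' @ E \<in> X" "set (L @ V' @ E) = set V"
      using deep_step_first[OF V(1) long] by blast
    have deepI: "deep k c (L @ V' @ E)" if V_eq: "V = l @ [c] @ r" and margin: "m \<le> length r" for c l r
    proof -
      obtain r' where "V' = l @ [c] @ r'" "length r' = length r - length T"
        using cut_right[OF V_eq[unfolded step(1)]] step(2) margin by (auto simp: m_def)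
      moreover have "k \<le> length r - length T"
        using step(2) margin by (auto simp: m_def k'_def)
      ultimately show ?thesis
        using step(3) by (intro deep_def[THEN iffD2] exI[of _ "L @ l"] exI[of _ "r' @ E"]) (simp add: k'_def)
    qed
    have "deep k c (L @ V' @ E)" if c: "c \<in> S" for c
    proof -
      obtain l r where "V = l @ [c] @ r" "2 * m + 1 \<le> length l" "2 * m + 1 \<le> length r"
        using V(4)[OF c] unfolding deep_def by blast
      then show ?thesis
        by (intro deepI[of l c r]) simp_all
    qed
    then have "\<forall>c\<in>insert b S. deep k c (L @ V' @ E)"
      using deepI[OF lr 1] by simp
    moreover have "k \<le> length (L @ V' @ E)"
      using step(3) by (simp add: k'_def)
    ultimately show ?thesis
      using step(4,5) V(2) by blast
  next
    case 2
    obtain L V' T E where step: "V = T @ V'" "length T \<le> k' + length a" "k' \<le> length L"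
      "E @ V' @ L \<in> X" "set (E @ V' @ L) = set V"
      using deep_step_last[OF V(1) long] by blast
    have deepI: "deep k c (E @ V' @ L)" if V_eq: "V = l @ [c] @ r" and margin: "m \<le> length l" for c l r
    proof -
      obtain l' where "V' = l' @ [c] @ r" "length l' = length l - length T"
        using cut_left[OF V_eq[unfolded step(1)]] step(2) margin by (auto simp: m_def)
      moreover have "k \<le> length l - length T"
        using step(2) margin by (auto simp: m_def k'_def)
      ultimately show ?thesis
        using step(3) by (intro deep_def[THEN iffD2] exI[of _ "E @ l'"] exI[of _ "r @ L"]) (simp add: k'_def)
    qed
    have "deep k c (E @ V' @ L)" if c: "c \<in> S" for c
    proof -
      obtain l r where "V = l @ [c] @ r" "2 * m + 1 \<le> length l" "2 * m + 1 \<le> length r"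
        using V(4)[OF c] unfolding deep_def by blast
      then show ?thesis
        by (intro deepI[of l c r]) simp_all
    qed
    then have "\<forall>c\<in>insert b S. deep k c (E @ V' @ L)"
      using deepI[OF lr 2] by simp
    moreover have "k \<le> length (E @ V' @ L)"
      using step(3) by (simp add: k'_def)
    ultimately show ?thesis
      using step(4,5) V(2) by blast
  qed
qed

text \<open>
  Of two distant factors, the later one can be moved directly in front of the earlier one.
\<close>

lemma glue:
  assumes "l @ Y1 @ m @ Y2 @ r \<in> X" "k + length a \<le> length l" "k + length a \<le> length m"
    "k + length a \<le> length r" "Y2 \<noteq> []" "Y1 \<noteq> []"
  shows "\<exists>l' r'. l' @ Y2 @ Y1 @ r' \<in> X \<and> k \<le> length l' \<and> k \<le> length r'"
proof -
  obtain a2 a3 where a: "a = hd a # a2 @ y # a3"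
    using a_split_first by blast
  have len_a: "length a = length a2 + length a3 + 2"
    using arg_cong[OF a, of length] by simp
  define m1 where "m1 = take (length m - length a2) m"
  define m2 where "m2 = drop (length m - length a2) m"
  define r1 where "r1 = take (length a3) r"
  define r2 where "r2 = drop (length a3) r"
  have m: "m = m1 @ m2" "length m2 = length a2" "k \<le> length m1"
    and r: "r = r1 @ r2" "length r1 = length a3"
    using assms(3,4) len_a by (auto simp: m1_def m2_def r1_def r2_def)
  let ?Ds = "(Y1 @ m1) # map (\<lambda>x. [x]) m2 @ Y2 # map (\<lambda>x. [x]) r1"
  have word: "l @ concat ?Ds @ r2 \<in> X"
    using assms(1) m(1) r(1) by simp
  have blocks: "length ?Ds = length a" "[] \<notin> set ?Ds"
    using m(2) r(2) assms(5,6) len_a by auto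
  obtain f where f: "nonerasing f" "map f a = ?Ds" "l @ subst f W @ r2 \<in> X"
    using rewrite_blocks[OF word blocks] by (elim exE conjE)
  have "map f (hd a # a2 @ y # a3) = ?Ds"
    using f(2) a by simp
  then have fv: "f (hd a) = Y1 @ m1" "f y = Y2"
    using m(2) by auto
  have "(l @ subst f P) @ Y2 @ Y1 @ (m1 @ subst f Q @ r2) \<in> X"
    using f(3) by (simp add: descent_first(1) fv)
  then show ?thesis
    using assms(2) m(3)
    by (intro exI[of _ "l @ subst f P"] exI[of _ "m1 @ subst f Q @ r2"]) simp
qed

text \<open>
  Some letter occurs twice in \<open>W\<close>, because \<open>W\<close> is longer than \<open>a\<close>.
\<close>

lemma duplicate:
  assumes "l @ D @ r \<in> X" "k + length a \<le> length l" "k + length a \<le> length r" "D \<noteq> []"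
  shows "\<exists>l' m r'. l' @ D @ m @ D @ r' \<in> X \<and> k \<le> length l' \<and> k \<le> length m \<and> k \<le> length r'"
proof -
  have "\<not> distinct W"
    using set_W length_W distinct_a by (metis distinct_card less_irrefl)
  then obtain W1 W2 W3 q where W: "W = W1 @ [q] @ W2 @ [q] @ W3"
    using not_distinct_decomp by blast
  then have "q \<in> set a"
    using set_W by auto
  then obtain a1 a2 where a: "a = a1 @ q # a2"
    by (meson split_list)
  define l1 where "l1 = take (length l - length a1) l"
  define l2 where "l2 = drop (length l - length a1) l"
  define r1 where "r1 = take (length r - length a2) r"
  define r2 where "r2 = drop (length r - length a2) r"
  have l: "l = l1 @ l2" "length l2 = length a1" "k \<le> length l1"
    and r: "r = r1 @ r2" "length r2 = length a2" "k \<le> length r1"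
    using assms(2,3) a by (auto simp: l1_def l2_def r1_def r2_def)
  let ?Ds = "map (\<lambda>x. [x]) l2 @ (D @ r1) # map (\<lambda>x. [x]) r2"
  have word: "l1 @ concat ?Ds @ [] \<in> X"
    using assms(1) l(1) r(1) by simp
  have blocks: "length ?Ds = length a" "[] \<notin> set ?Ds"
    using l(2) r(2) assms(4) a by auto
  obtain f where f: "nonerasing f" "map f a = ?Ds" "l1 @ subst f W @ [] \<in> X"
    using rewrite_blocks[OF word blocks] by (elim exE conjE)
  then have fv: "f q = D @ r1"
    using l(2) by (simp add: a)
  have "(l1 @ subst f W1) @ D @ (r1 @ subst f W2) @ D @ (r1 @ subst f W3) \<in> X"
    using f(3) by (simp add: W fv)
  then show ?thesis
    using l(3) r(3)
    by (intro exI[of _ "l1 @ subst f W1"] exI[of _ "r1 @ subst f W2"] exI[of _ "r1 @ subst f W3"]) simp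
qed

text \<open>
  Every word over the letters of \<open>a\<close> occurs deep inside an element of \<open>X\<close>, surrounded by
  a factor \<open>D1 @ Y @ D2\<close> that contains all letters. This surrounding factor is the strengthening
  that lets the induction supply the next letter.
\<close>

lemma factor_exists:
  assumes "set Y \<subseteq> set a"
  shows "\<exists>l D1 D2 r. l @ (D1 @ Y @ D2) @ r \<in> X \<and> k \<le> length l \<and> k \<le> length r \<and>
    set (D1 @ Y @ D2) = set a"
  using assms
proof (induction Y arbitrary: k rule: rev_induct)
  case Nil
  obtain V where V: "V \<in> X" "set V = set a" "2 * k \<le> length V" "\<And>b. b \<in> set a \<Longrightarrow> deep (2 * k) b V"
    using deep_letters[of "set a" "2 * k"] by auto
  obtain l D r where split: "V = l @ D @ r" "length l = k" "length D = length V - 2 * k" "length r = k"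
    using split_three[of V k "length V - 2 * k" k] V(3) by auto
  have "b \<in> set D" if b: "b \<in> set a" for b
  proof -
    obtain l' r' where b: "l @ D @ r = l' @ [b] @ r'" "2 * k \<le> length l'" "2 * k \<le> length r'"
      using V(4)[OF b] split(1) by (auto simp: deep_def)
    have "length l \<le> length l'" "length r \<le> length r'"
      using b(2,3) split(2,4) by simp_all
    then obtain l'' where l'': "D @ r = l'' @ [b] @ r'"
      using cut_left[OF b(1)] by blast
    obtain r'' where "D = l'' @ [b] @ r''"
      using cut_right[OF l'' \<open>length r \<le> length r'\<close>] by blast
    then show ?thesis by simp
  qed
  then have "set D = set a"
    using V(2) split(1) by auto
  then show ?case
    using split V(1) by (intro exI[of _ l] exI[of _ D] exI[of _ "[]"] exI[of _ r]) simp
next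
  case (snoc z Y)
  define n where "n = length a"
  obtain l D1 D2 r where IH: "l @ (D1 @ Y @ D2) @ r \<in> X" "k + 3 * n \<le> length l" "k + 3 * n \<le> length r"
    "set (D1 @ Y @ D2) = set a"
    using snoc.IH[of "k + 3 * n"] snoc.prems by auto
  define D where "D = D1 @ Y @ D2"
  have "z \<in> set D"
    using IH(4) snoc.prems by (auto simp: D_def)
  then obtain D3 D4 where D34: "D = D3 @ z # D4"
    by (meson split_list)
  then have "D \<noteq> []"
    by simp
  obtain l1 m1 r1 where 1: "l1 @ D @ m1 @ D @ r1 \<in> X" "k + 2 * n \<le> length l1" "k + 2 * n \<le> length m1"
    "k + 2 * n \<le> length r1"
    using duplicate[of l D r "k + 2 * n"] IH \<open>D \<noteq> []\<close> by (auto simp: D_def n_def)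
  obtain l2 m2 r2 where 2: "l2 @ (D @ m1 @ D) @ m2 @ (D @ m1 @ D) @ r2 \<in> X"
    "k + n \<le> length l2" "k + n \<le> length m2" "k + n \<le> length r2"
    using duplicate[of l1 "D @ m1 @ D" r1 "k + n"] 1 \<open>D \<noteq> []\<close> by (auto simp: n_def)
  \<comment> \<open>The second block supplies an occurrence of \<open>Y\<close>, the first one an earlier occurrence of \<open>z\<close>
    followed by an intact copy of \<open>D\<close>.\<close>
  show ?case
  proof (cases "D1 @ Y = []")
    case True
    then show ?thesis
      using 1 D34 IH(4)
      by (intro exI[of _ l1] exI[of _ D3] exI[of _ D4] exI[of _ "m1 @ D @ r1"]) (simp add: D_def)
  next
    case False
    have "(l2 @ D3) @ (z # D4 @ m1 @ D) @ m2 @ (D1 @ Y) @ (D2 @ m1 @ D @ r2)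
        = l2 @ ((D3 @ z # D4) @ m1 @ D) @ m2 @ ((D1 @ Y @ D2) @ m1 @ D) @ r2"
      by simp
    also have "\<dots> \<in> X"
      using 2(1) unfolding D34[symmetric] D_def[symmetric] .
    finally obtain l3 r3 where 3: "l3 @ (D1 @ Y) @ (z # D4 @ m1 @ D) @ r3 \<in> X" "k \<le> length l3" "k \<le> length r3"
      using glue[of "l2 @ D3" "z # D4 @ m1 @ D" m2 "D1 @ Y" "D2 @ m1 @ D @ r2" k] 2(2-4) False
      by (auto simp: n_def)
    have "set (D1 @ Y @ z # D4 @ m1 @ D) \<subseteq> set a"
      using letters[OF 3(1)] by auto
    moreover have "set a \<subseteq> set D"
      using IH(4) by (simp add: D_def)
    ultimately show ?thesis
      using 3 by (intro exI[of _ l3] exI[of _ D1] exI[of _ "D4 @ m1 @ D"] exI[of _ r3]) auto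
  qed
qed

end


subsection \<open>Rewriting inside a linear word\<close>

context fully_invariant_congruence
begin

text \<open>
  The congruence satisfies \<open>c\<^sup>s\<^sup>+\<^sup>d \<approx> c\<^sup>s\<close> for all \<open>s \<ge> d\<close>. The same number serves as index and as
  period, so \<open>c\<^sup>d\<close> is idempotent.
\<close>

definition period :: "nat \<Rightarrow> bool" where
  "period d \<longleftrightarrow> 0 < d \<and> (\<forall>c s. c \<noteq> [] \<longrightarrow> d \<le> s \<longrightarrow> (c \<^bold>^ (s + d), c \<^bold>^ s) \<in> R)"

lemma period_exists:
  assumes uw: "(u, w) \<in> R" and longer: "length u < length w"
  shows "\<exists>d. period d"
proof -
  define n where "n = length u"
  define e where "e = length w - length u"
  have n: "0 < n" and e: "0 < e" and w: "length w = n + e"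
    using nonempty[OF uw] longer by (simp_all add: n_def e_def)
  have step: "(c \<^bold>^ (s + j * e), c \<^bold>^ s) \<in> R" if c: "c \<noteq> []" and s: "n \<le> s" for c s j
  proof (induction j)
    case 0
    then show ?case
      using c s n refl[of "c \<^bold>^ s"] by (simp add: word_power_eq_Nil)
  next
    case (Suc j)
    have "(subst (\<lambda>_. c) u, subst (\<lambda>_. c) w) \<in> R"
      using c by (intro subst_closed[OF uw]) (simp add: nonerasing_def)
    then have base: "(c \<^bold>^ n, c \<^bold>^ (n + e)) \<in> R"
      by (simp add: subst_const[of _ _ c] n_def[symmetric] w)
    have "s + j * e = n + (s - n + j * e)" "s + Suc j * e = (n + e) + (s - n + j * e)"
      using s by simp_all
    then have "(c \<^bold>^ (s + j * e), c \<^bold>^ (s + Suc j * e)) \<in> R"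
      using append_right[OF base] by (metis word_power_add)
    with Suc.IH show ?case
      using sym trans by blast
  qed
  have "n * e > 0" "n \<le> n * e"
    using n e by simp_all
  then have "period (n * e)"
    unfolding period_def using step by (metis le_trans)
  then show ?thesis ..
qed

lemma period_collapse:
  assumes "period d" "l @ c @ r \<noteq> []"
  shows "(l @ c \<^bold>^ (d + s + d) @ r, l @ c \<^bold>^ (d + s) @ r) \<in> R"
proof (cases "c = []")
  case True
  then show ?thesis using assms(2) refl by simp
next
  case False
  then have "(c \<^bold>^ (d + s + d), c \<^bold>^ (d + s)) \<in> R"
    using assms(1) by (auto simp: period_def)
  then show ?thesis
    by (rule context_closed)
qed

text \<open>
  Letters to the left and to the right of the rewritten part absorb arbitrary words, so the rule
  applies in every context that is long enough.
\<close>

lemma rewrite_in_context: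
  assumes rule: "(A @ a @ B, A @ V @ B) \<in> R" and dist: "distinct (A @ a @ B)"
    and V: "set V \<subseteq> set a" and f: "nonerasing f"
    and l: "length A \<le> length l" and r: "length B \<le> length r"
  shows "(l @ subst f a @ r, l @ subst f V @ r) \<in> R"
proof -
  obtain g l' where g: "nonerasing g" "l = l' @ subst g A"
  proof (cases "A = []")
    case True
    then show ?thesis
      using that[of "\<lambda>x. [x]" l] by (simp add: nonerasing_def)
  next
    case False
    then show ?thesis
      using distribution_exists[of A l] dist l that[of _ "[]"] by auto
  qed
  obtain h r' where h: "nonerasing h" "r = subst h B @ r'"
  proof (cases "B = []")
    case True
    then show ?thesis
      using that[of "\<lambda>x. [x]" r] by (simp add: nonerasing_def)
  next
    case False
    then show ?thesis
      using distribution_exists[of B r] dist r that[of _ "[]"] by auto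
  qed
  define k where "k = (\<lambda>x. if x \<in> set A then g x else if x \<in> set B then h x else f x)"
  have "nonerasing k"
    using f g(1) h(1) by (auto simp: nonerasing_def k_def)
  then have "(l' @ subst k (A @ a @ B) @ r', l' @ subst k (A @ V @ B) @ r') \<in> R"
    by (intro context_closed subst_closed[OF rule])
  moreover have "subst k A = subst g A" "subst k B = subst h B"
    using dist by (auto simp: k_def intro!: subst_cong)
  moreover have "subst k v = subst f v" if "set v \<subseteq> set a" for v
    using dist that by (intro subst_cong) (auto simp: k_def)
  then have "subst k a = subst f a" "subst k V = subst f V"
    using V by simp_all
  ultimately show ?thesis
    by (simp add: g(2) h(2))
qed

lemma rewrite_in_context_id:
  assumes "(A @ a @ B, A @ V @ B) \<in> R" "distinct (A @ a @ B)" "set V \<subseteq> set a"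
    "length A \<le> length l" "length B \<le> length r"
  shows "(l @ a @ r, l @ V @ r) \<in> R"
  using rewrite_in_context[OF assms(1-3), of "\<lambda>x. [x]" l r] assms(4,5)
  by (simp add: nonerasing_def subst_singleton_id)

text \<open>
  Iterating \<open>a \<approx> cae\<close> gives \<open>a \<approx> c\<^sup>kae\<^sup>k\<close>; for \<open>k = d\<close> the outer powers are idempotent and each
  of them can be split off separately.
\<close>

lemma absorb:
  assumes d: "period d" and rule: "(A @ a @ B, A @ (c @ a @ e) @ B) \<in> R"
    and dist: "distinct (A @ a @ B)" and V: "set (c @ a @ e) \<subseteq> set a"
  shows "(A @ a @ B, A @ (c \<^bold>^ d @ a) @ B) \<in> R" "(A @ a @ B, A @ (a @ e \<^bold>^ d) @ B) \<in> R"
proof -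
  have ne: "A @ a @ B \<noteq> []"
    using nonempty[OF rule] by simp
  have iterate: "(A @ a @ B, A @ c \<^bold>^ k @ a @ e \<^bold>^ k @ B) \<in> R" for k
  proof (induction k)
    case 0
    show ?case using refl[OF ne] by simp
  next
    case (Suc k)
    have "((A @ c \<^bold>^ k) @ a @ (e \<^bold>^ k @ B), (A @ c \<^bold>^ k) @ (c @ a @ e) @ (e \<^bold>^ k @ B)) \<in> R"
      by (rule rewrite_in_context_id[OF rule dist V]) simp_all
    then have "(A @ c \<^bold>^ k @ a @ e \<^bold>^ k @ B, A @ c \<^bold>^ Suc k @ a @ e \<^bold>^ Suc k @ B) \<in> R"
      by (simp add: word_power_commute_append)
    with Suc show ?case
      by (rule trans)
  qed
  have base: "(A @ a @ B, A @ c \<^bold>^ d @ a @ e \<^bold>^ d @ B) \<in> R"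
    by (rule iterate)
  have cc: "((A @ c \<^bold>^ d @ c \<^bold>^ d @ a @ e \<^bold>^ k @ B), A @ c \<^bold>^ d @ a @ e \<^bold>^ k @ B) \<in> R" for k
    using period_collapse[OF d, of A c "a @ e \<^bold>^ k @ B" 0] ne by (simp add: word_power_add)
  have ee: "((A @ c \<^bold>^ k @ a @ e \<^bold>^ d @ e \<^bold>^ d @ B), A @ c \<^bold>^ k @ a @ e \<^bold>^ d @ B) \<in> R" for k
    using period_collapse[OF d, of "A @ c \<^bold>^ k @ a" e B 0] ne by (simp add: word_power_add)
  have V': "set (c \<^bold>^ d @ a @ e \<^bold>^ d) \<subseteq> set a"
    using V set_word_power[of c d] set_word_power[of e d] by auto
  have base': "(A @ a @ B, A @ (c \<^bold>^ d @ a @ e \<^bold>^ d) @ B) \<in> R"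
    using base by simp
  have "((A @ c \<^bold>^ d) @ a @ B, (A @ c \<^bold>^ d) @ (c \<^bold>^ d @ a @ e \<^bold>^ d) @ B) \<in> R"
    by (rule rewrite_in_context_id[OF base' dist V']) simp_all
  then have left: "(A @ c \<^bold>^ d @ a @ B, A @ c \<^bold>^ d @ a @ e \<^bold>^ d @ B) \<in> R"
    using trans[OF _ cc[of d]] by simp
  have "(A @ a @ (e \<^bold>^ d @ B), A @ (c \<^bold>^ d @ a @ e \<^bold>^ d) @ (e \<^bold>^ d @ B)) \<in> R"
    by (rule rewrite_in_context_id[OF base' dist V']) simp_all
  then have right: "(A @ a @ e \<^bold>^ d @ B, A @ c \<^bold>^ d @ a @ e \<^bold>^ d @ B) \<in> R"
    using trans[OF _ ee[of d]] by simp
  show "(A @ a @ B, A @ (c \<^bold>^ d @ a) @ B) \<in> R" "(A @ a @ B, A @ (a @ e \<^bold>^ d) @ B) \<in> R"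
    using trans[OF base sym[OF left]] trans[OF base sym[OF right]] by simp_all
qed

text \<open>
  If \<open>a \<approx> laar\<close>, then \<open>a \<approx> a(ar)\<^sup>d = a\<cdot>a\<cdot>r'\<close> for some \<open>r'\<close>, and therefore \<open>a \<approx> a\<^sup>d\<cdot>a\<close>.
\<close>

lemma power_from_square:
  assumes d: "period d" and rule: "(A @ a @ B, A @ (l @ a @ a @ r) @ B) \<in> R"
    and dist: "distinct (A @ a @ B)" and V: "set (l @ a @ a @ r) \<subseteq> set a"
  shows "(A @ a @ B, A @ a \<^bold>^ (d + 1) @ B) \<in> R"
proof -
  obtain d' where d': "d = Suc d'"
    using d by (cases d) (auto simp: period_def)
  have "(A @ a @ B, A @ (a @ (a @ r) \<^bold>^ d) @ B) \<in> R"
    using V by (intro absorb(2)[OF d rule dist]) simp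
  then have "(A @ a @ B, A @ (a @ a @ (r @ (a @ r) \<^bold>^ d')) @ B) \<in> R"
    by (simp add: d')
  moreover have "set (a @ a @ (r @ (a @ r) \<^bold>^ d')) \<subseteq> set a"
    using V set_word_power[of "a @ r" d'] by auto
  ultimately have "(A @ a @ B, A @ (a \<^bold>^ d @ a) @ B) \<in> R"
    by (rule absorb(1)[OF d _ dist])
  then show ?thesis
    by (simp add: word_power_Suc_right)
qed

end

subsection \<open>Powers of factors of linear words\<close>

lemma subst_rev: "subst f (rev w) = rev (subst (\<lambda>x. rev (f x)) w)"
  by (induction w) simp_all

lemma in_reversal_iff: "(u, v) \<in> map_prod rev rev ` R \<longleftrightarrow> (rev u, rev v) \<in> R"
  by (force simp: image_iff)

context fully_invariant_congruence
begin

text \<open>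
  Reversing all words is an anti-automorphism of the free semigroup; it is used to transfer
  statements about leading letters to trailing letters.
\<close>

lemma reversal: "fully_invariant_congruence (map_prod rev rev ` R)"
proof
  fix u v f assume "(u, v) \<in> map_prod rev rev ` R" "nonerasing f"
  then have "(subst (\<lambda>x. rev (f x)) (rev u), subst (\<lambda>x. rev (f x)) (rev v)) \<in> R"
    by (intro subst_closed) (simp_all add: in_reversal_iff nonerasing_def)
  then show "(subst f u, subst f v) \<in> map_prod rev rev ` R"
    by (simp add: in_reversal_iff subst_rev)
next
  fix u v l r assume "(u, v) \<in> map_prod rev rev ` R"
  then show "(l @ u @ r, l @ v @ r) \<in> map_prod rev rev ` R"
    using context_closed[of "rev u" "rev v" "rev r" "rev l"] by (simp add: in_reversal_iff)
next
  fix u v w assume "(u, v) \<in> map_prod rev rev ` R" "(v, w) \<in> map_prod rev rev ` R"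
  then show "(u, w) \<in> map_prod rev rev ` R"
    unfolding in_reversal_iff by (rule trans)
next
  fix u v assume "(u, v) \<in> map_prod rev rev ` R"
  then show "u \<noteq> [] \<and> v \<noteq> []"
    using nonempty by (fastforce simp: in_reversal_iff)
qed (simp_all add: in_reversal_iff refl sym)

lemma period_reversal:
  assumes "period d"
  shows "fully_invariant_congruence.period (map_prod rev rev ` R) d"
  using assms
  by (simp add: period_def fully_invariant_congruence.period_def[OF reversal] in_reversal_iff rev_word_power)

lemma period_collapse_mult:
  assumes d: "period d" and "d \<le> s" and ne: "l @ c @ r \<noteq> []"
  shows "(l @ c \<^bold>^ (s + j * d) @ r, l @ c \<^bold>^ s @ r) \<in> R"
proof (induction j)
  case 0
  have "l @ c \<^bold>^ s @ r \<noteq> []"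
    using ne d \<open>d \<le> s\<close> by (auto simp: word_power_eq_Nil period_def)
  then show ?case
    using refl by simp
next
  case (Suc j)
  have "(l @ c \<^bold>^ (d + (s - d + j * d) + d) @ r, l @ c \<^bold>^ (d + (s - d + j * d)) @ r) \<in> R"
    by (rule period_collapse[OF d ne])
  then have "(l @ c \<^bold>^ (s + Suc j * d) @ r, l @ c \<^bold>^ (s + j * d) @ r) \<in> R"
    using \<open>d \<le> s\<close> by (simp add: algebra_simps)
  then show ?case
    using Suc by (rule trans)
qed

text \<open>
  If \<open>AxY \<approx> Ax\<^sup>pZ\<close> where \<open>x\<close> does not occur in \<open>Z\<close>, then the exponent of \<open>x\<close> can be raised to
  \<open>p\<^sup>d \<ge> d\<close>. Substituting \<open>x\<^sup>d\<^sup>+\<^sup>1\<close> for \<open>x\<close> does not change the class of such a power of \<open>x\<close>.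
\<close>

lemma power_from_leading_letter:
  assumes d: "period d" and rule: "(A @ [x] @ Y, A @ [x] \<^bold>^ p @ Z) \<in> R" and p: "2 \<le> p"
    and dist: "distinct (A @ [x] @ Y)" and Z: "set Z \<subseteq> set Y" "length Y \<le> length Z"
  shows "(A @ [x] @ Y, A @ [x] \<^bold>^ (d + 1) @ Y) \<in> R"
proof -
  obtain h where h: "nonerasing h" "subst h Y = Z"
  proof (cases "Y = []")
    case True
    then show ?thesis
      using that[of "\<lambda>x. [x]"] Z by (simp add: nonerasing_def)
  next
    case False
    then show ?thesis
      using distribution_exists[of Y Z] dist Z(2) that by auto
  qed
  define f where "f = (\<lambda>i. if i = x then [x] \<^bold>^ p else if i \<in> set Y then h i else [i])"
  have f: "nonerasing f"
    using h(1) p by (auto simp: f_def nonerasing_def word_power_eq_Nil)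
  have fA: "subst f A = A"
    using dist by (intro subst_singleton_id) (auto simp: f_def)
  have fY: "subst f Y = Z"
    unfolding h(2)[symmetric] using dist by (intro subst_cong) (auto simp: f_def)
  have fx: "f x = [x] \<^bold>^ p"
    by (simp add: f_def)
  have f_letters: "set (subst f T) \<subseteq> set Y" if "set T \<subseteq> set Y" for T
  proof -
    have "set (subst f T) \<subseteq> set (subst f Y)"
      using that by (auto simp: set_subst)
    then show ?thesis
      using Z(1) fY by simp
  qed
  have "\<exists>T. set T \<subseteq> set Y \<and> (A @ [x] @ Y, A @ [x] \<^bold>^ (p ^ k) @ T) \<in> R" for k
  proof (induction k)
    case 0
    have "(A @ [x] @ Y, A @ [x] @ Y) \<in> R"
      by (rule refl) simp
    then show ?case
      by (intro exI[of _ Y]) simp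
  next
    case (Suc k)
    then obtain T where T: "set T \<subseteq> set Y" "(A @ [x] @ Y, A @ [x] \<^bold>^ (p ^ k) @ T) \<in> R"
      by blast
    have "(subst f (A @ [x] @ Y), subst f (A @ [x] \<^bold>^ (p ^ k) @ T)) \<in> R"
      by (rule subst_closed[OF T(2) f])
    then have "(A @ [x] \<^bold>^ p @ Z, A @ [x] \<^bold>^ (p ^ Suc k) @ subst f T) \<in> R"
      by (simp add: fA fY fx subst_word_power word_power_mult)
    with rule have "(A @ [x] @ Y, A @ [x] \<^bold>^ (p ^ Suc k) @ subst f T) \<in> R"
      by (rule trans)
    then show ?case
      using f_letters[OF T(1)] by blast
  qed
  then obtain T where T: "set T \<subseteq> set Y" "(A @ [x] @ Y, A @ [x] \<^bold>^ (p ^ d) @ T) \<in> R"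
    by blast
  define g where "g = (\<lambda>i. if i = x then [x] \<^bold>^ (d + 1) else [i])"
  have g: "nonerasing g"
    by (auto simp: g_def nonerasing_def)
  have gx: "g x = [x] \<^bold>^ (d + 1)"
    by (simp add: g_def)
  have g_id: "subst g v = v" if "x \<notin> set v" for v
    using that by (intro subst_singleton_id) (auto simp: g_def)
  have "(subst g (A @ [x] @ Y), subst g (A @ [x] \<^bold>^ (p ^ d) @ T)) \<in> R"
    by (rule subst_closed[OF T(2) g])
  moreover have "subst g (A @ [x] @ Y) = A @ [x] \<^bold>^ (d + 1) @ Y"
    using dist gx by (simp add: g_id)
  moreover have "x \<notin> set T"
    using T(1) dist by auto
  then have "subst g (A @ [x] \<^bold>^ (p ^ d) @ T) = A @ ([x] \<^bold>^ (d + 1)) \<^bold>^ (p ^ d) @ T"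
    using dist gx by (simp add: g_id subst_word_power)
  moreover have "([x] \<^bold>^ (d + 1)) \<^bold>^ (p ^ d) = [x] \<^bold>^ (p ^ d + p ^ d * d)"
    unfolding word_power_mult by (simp add: algebra_simps)
  ultimately have "(A @ [x] \<^bold>^ (d + 1) @ Y, A @ [x] \<^bold>^ (p ^ d + p ^ d * d) @ T) \<in> R"
    by simp
  moreover have "(A @ [x] \<^bold>^ (p ^ d + p ^ d * d) @ T, A @ [x] \<^bold>^ (p ^ d) @ T) \<in> R"
  proof (rule period_collapse_mult[OF d])
    have "d < 2 ^ d" by (rule less_exp)
    also have "\<dots> \<le> p ^ d" using p by (rule power_mono) simp
    finally show "d \<le> p ^ d" by simp
  qed simp
  ultimately have "(A @ [x] \<^bold>^ (d + 1) @ Y, A @ [x] \<^bold>^ (p ^ d) @ T) \<in> R"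
    by (rule trans)
  then show ?thesis
    using T(2) sym trans by blast
qed

lemma power_from_trailing_letter:
  assumes d: "period d" and rule: "(Y @ [x] @ B, Z @ [x] \<^bold>^ p @ B) \<in> R" and p: "2 \<le> p"
    and dist: "distinct (Y @ [x] @ B)" and Z: "set Z \<subseteq> set Y" "length Y \<le> length Z"
  shows "(Y @ [x] @ B, Y @ [x] \<^bold>^ (d + 1) @ B) \<in> R"
proof -
  have "(rev B @ [x] @ rev Y, rev B @ [x] \<^bold>^ (d + 1) @ rev Y) \<in> map_prod rev rev ` R"
  proof (rule fully_invariant_congruence.power_from_leading_letter[OF reversal])
    show "(rev B @ [x] @ rev Y, rev B @ [x] \<^bold>^ p @ rev Z) \<in> map_prod rev rev ` R"
      using rule by (simp add: in_reversal_iff rev_word_power)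
  qed (use d p dist Z in \<open>auto simp: period_reversal\<close>)
  then show ?thesis
    by (simp add: in_reversal_iff rev_word_power word_power_singleton replicate_app_Cons_same)
qed

end

lemma leading_block:
  assumes "\<nexists>P y Q. w = P @ [y, x] @ Q \<and> y \<noteq> x"
  shows "\<exists>p v. w = [x] \<^bold>^ p @ v \<and> x \<notin> set v"
proof -
  define u where "u = takeWhile (\<lambda>z. z = x) w"
  define v where "v = dropWhile (\<lambda>z. z = x) w"
  have w: "w = u @ v"
    by (simp add: u_def v_def)
  have "set u \<subseteq> {x}"
    using set_takeWhileD by (fastforce simp: u_def)
  then have "u = [x] \<^bold>^ length u"
    by (induction u) auto
  moreover have "x \<notin> set v"
  proof
    assume "x \<in> set v"
    then obtain ys zs where v: "v = ys @ x # zs" "x \<notin> set ys"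
      by (meson split_list_first)
    have "v = [] \<or> hd v \<noteq> x"
      using hd_dropWhile[of "\<lambda>z. z = x" w] by (auto simp: v_def)
    then have "ys \<noteq> []"
      using v by auto
    then obtain ys' y where "ys = ys' @ [y]"
      by (meson rev_exhaust)
    then have "w = (u @ ys') @ [y, x] @ zs" "y \<noteq> x"
      using w v by auto
    then show False
      using assms by blast
  qed
  ultimately show ?thesis
    using w by metis
qed

lemma trailing_block:
  assumes "\<nexists>P y Q. w = P @ [x, y] @ Q \<and> y \<noteq> x"
  shows "\<exists>p v. w = v @ [x] \<^bold>^ p \<and> x \<notin> set v"
proof -
  have "\<nexists>P y Q. rev w = P @ [y, x] @ Q \<and> y \<noteq> x"
  proof
    assume "\<exists>P y Q. rev w = P @ [y, x] @ Q \<and> y \<noteq> x"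
    then obtain P y Q where "rev w = P @ [y, x] @ Q" "y \<noteq> x"
      by blast
    then have "w = rev Q @ [x, y] @ rev P"
      by (simp add: rev_swap)
    then show False
      using assms \<open>y \<noteq> x\<close> by blast
  qed
  then obtain p v where "rev w = [x] \<^bold>^ p @ v" "x \<notin> set v"
    using leading_block by blast
  then have "w = rev v @ [x] \<^bold>^ p" "x \<notin> set (rev v)"
    by (simp_all add: rev_swap rev_word_power)
  then show ?thesis by blast
qed

context fully_invariant_congruence
begin

text \<open>
  Induction on the length of the factor \<open>a\<close> that is changed by the rule. If the first letter of
  \<open>a\<close> is never preceded by another letter in \<open>W\<close>, then \<open>W\<close> begins with a power of this letter that
  contains all its occurrences: either the power is proper and the letter itself
  is the required factor, or the letter can be moved from \<open>a\<close> to the context \<open>A\<close>. The last letter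
  is treated dually. In the remaining case the words congruent to \<open>a\<close> in the context of \<open>A\<close> and
  \<open>B\<close> are closed under a mixing rule.
\<close>

lemma power_from_longer_word:
  assumes d: "period d" and "distinct (A @ a @ B)" "(A @ a @ B, A @ W @ B) \<in> R"
    "set W = set a" "length a < length W"
  shows "\<exists>A' P B'. A @ a @ B = A' @ P @ B' \<and> P \<noteq> [] \<and> (A @ a @ B, A' @ P \<^bold>^ (d + 1) @ B') \<in> R"
  using assms(2-)
proof (induction "length a" arbitrary: A a B W rule: less_induct)
  case less
  note dist = less.prems(1) and rule = less.prems(2) and set_W = less.prems(3) and len_W = less.prems(4)
  have "a \<noteq> []"
    using set_W len_W by auto
  have "W \<noteq> []"
    using len_W by auto
  define x where "x = hd a"
  define z where "z = last a"
  consider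
      (first) "\<nexists>P y Q. W = P @ [y, x] @ Q \<and> y \<noteq> x"
    | (last) "\<nexists>P y Q. W = P @ [z, y] @ Q \<and> y \<noteq> z"
    | (mixing) P y Q P' y' Q' where "W = P @ [y, x] @ Q" "y \<noteq> x" "W = P' @ [z, y'] @ Q'" "y' \<noteq> z"
    by blast
  then show ?case
  proof cases
    case first
    obtain a' where a: "a = [x] @ a'"
      using \<open>a \<noteq> []\<close> by (cases a) (auto simp: x_def)
    obtain p v where W: "W = [x] \<^bold>^ p @ v" "x \<notin> set v"
      using leading_block[OF first] by blast
    have "x \<in> set W"
      using set_W a by simp
    then have "p \<noteq> 0"
      using W by (cases p) auto
    have x: "x \<notin> set a'"
      using dist a by auto
    have set_v: "set v = set a'"
      using set_W W a x \<open>p \<noteq> 0\<close> set_word_power[of "[x]" p] by (cases p) auto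
    show ?thesis
    proof (cases "p = 1")
      case True
      have "\<exists>A' P B'. (A @ [x]) @ a' @ B = A' @ P @ B' \<and> P \<noteq> [] \<and> ((A @ [x]) @ a' @ B, A' @ P \<^bold>^ (d + 1) @ B') \<in> R"
      proof (rule less.hyps)
        show "length a' < length a" "distinct ((A @ [x]) @ a' @ B)" "set v = set a'"
          using dist a set_v by auto
        show "((A @ [x]) @ a' @ B, (A @ [x]) @ v @ B) \<in> R" "length a' < length v"
          using rule len_W W True a by auto
      qed
      then show ?thesis
        using a by simp
    next
      case False
      then have "2 \<le> p"
        using \<open>p \<noteq> 0\<close> by simp
      have dist': "distinct (A @ [x] @ (a' @ B))"
        using dist a by simp
      have "length a' \<le> length v"
        using set_v dist a by (metis card_length distinct.simps(2) distinct_append distinct_card append_Cons append_Nil)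
      moreover have "(A @ [x] @ (a' @ B), A @ [x] \<^bold>^ p @ (v @ B)) \<in> R"
        using rule W a by simp
      ultimately have "(A @ [x] @ (a' @ B), A @ [x] \<^bold>^ (d + 1) @ (a' @ B)) \<in> R"
        using set_v by (intro power_from_leading_letter[OF d _ \<open>2 \<le> p\<close> dist', of "v @ B"]) auto
      then show ?thesis
        using a by (intro exI[of _ A] exI[of _ "[x]"] exI[of _ "a' @ B"]) simp
    qed
  next
    case last
    obtain a' where a: "a = a' @ [z]"
      using \<open>a \<noteq> []\<close> by (cases a rule: rev_cases) (auto simp: z_def)
    obtain p v where W: "W = v @ [z] \<^bold>^ p" "z \<notin> set v"
      using trailing_block[OF last] by blast
    have "z \<in> set W"
      using set_W a by simp
    then have "p \<noteq> 0"
      using W by (cases p) auto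
    have z: "z \<notin> set a'"
      using dist a by auto
    have set_v: "set v = set a'"
      using set_W W a z \<open>p \<noteq> 0\<close> set_word_power[of "[z]" p] by (cases p) auto
    show ?thesis
    proof (cases "p = 1")
      case True
      have "\<exists>A' P B'. A @ a' @ ([z] @ B) = A' @ P @ B' \<and> P \<noteq> [] \<and> (A @ a' @ ([z] @ B), A' @ P \<^bold>^ (d + 1) @ B') \<in> R"
      proof (rule less.hyps)
        show "length a' < length a" "distinct (A @ a' @ [z] @ B)" "set v = set a'"
          using dist a set_v by auto
        show "(A @ a' @ [z] @ B, A @ v @ [z] @ B) \<in> R" "length a' < length v"
          using rule len_W W True a by auto
      qed
      then show ?thesis
        using a by simp
    next
      case False
      then have "2 \<le> p"
        using \<open>p \<noteq> 0\<close> by simp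
      have dist': "distinct ((A @ a') @ [z] @ B)"
        using dist a by simp
      have "length a' \<le> length v"
        using set_v dist a by (metis card_length distinct_append distinct_card)
      moreover have "((A @ a') @ [z] @ B, (A @ v) @ [z] \<^bold>^ p @ B) \<in> R"
        using rule W a by simp
      ultimately have "((A @ a') @ [z] @ B, (A @ a') @ [z] \<^bold>^ (d + 1) @ B) \<in> R"
        using set_v by (intro power_from_trailing_letter[OF d _ \<open>2 \<le> p\<close> dist', of "A @ v"]) auto
      then show ?thesis
        using a by (intro exI[of _ "A @ a'"] exI[of _ "[z]"] exI[of _ B]) simp
    qed
  next
    case mixing
    define X where "X = {V. set V \<subseteq> set a \<and> (A @ a @ B, A @ V @ B) \<in> R}"
    interpret mixing_rule a W X P Q P' Q' y y'
    proof
      show "distinct a" "set W = set a" "length a < length W"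
        using dist set_W len_W by auto
      show "a \<in> X"
        using refl[of "A @ a @ B"] \<open>a \<noteq> []\<close> by (simp add: X_def)
      fix V assume "V \<in> X"
      then show "set V \<subseteq> set a"
        by (simp add: X_def)
    next
      fix l f r assume *: "l @ subst f a @ r \<in> X" "nonerasing f"
      have "((A @ l) @ subst f a @ (r @ B), (A @ l) @ subst f W @ (r @ B)) \<in> R"
        using rule dist set_W *(2) by (intro rewrite_in_context[of A a B]) auto
      then have "(A @ a @ B, A @ (l @ subst f W @ r) @ B) \<in> R"
        using *(1) trans by (force simp: X_def)
      moreover have "set (subst f W) = set (subst f a)"
        by (simp add: set_subst set_W)
      ultimately show "l @ subst f W @ r \<in> X"
        using *(1) by (simp add: X_def)
    qed (use mixing in \<open>auto simp: x_def z_def\<close>)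
    obtain l D1 D2 r where "l @ (D1 @ (a @ a) @ D2) @ r \<in> X"
      using factor_exists[of "a @ a" 0] by auto
    then have sq: "(A @ a @ B, A @ ((l @ D1) @ a @ a @ (D2 @ r)) @ B) \<in> R" "set ((l @ D1) @ a @ a @ (D2 @ r)) \<subseteq> set a"
      by (auto simp: X_def)
    have "(A @ a @ B, A @ a \<^bold>^ (d + 1) @ B) \<in> R"
      by (rule power_from_square[OF d sq(1) dist sq(2)])
    then show ?thesis
      using \<open>a \<noteq> []\<close> by blast
  qed
qed

text \<open>
  A nontrivial identity \<open>u \<approx> w\<close> with a linear left-hand side, i.e. one in which \<open>w\<close> is not a
  permutation of \<open>u\<close>, implies \<open>u = APB \<approx> AP\<^sup>m\<^sup>+\<^sup>1B\<close> for some nonempty factor \<open>P\<close> and all multiples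
  \<open>m\<close> of some positive number.
\<close>

theorem linear_word_periodic:
  assumes uw: "(u, w) \<in> R" and dist: "distinct u" and not_perm: "mset u \<noteq> mset w"
  shows "\<exists>A P B d. u = A @ P @ B \<and> P \<noteq> [] \<and> 0 < d \<and> (\<forall>j. (u, A @ P \<^bold>^ (j * d + 1) @ B) \<in> R)"
proof (cases "set u \<subseteq> set w")
  case False
  \<comment> \<open>A letter of \<open>u\<close> that is missing in \<open>w\<close> can be replaced by all of its powers.\<close>
  then obtain x where "x \<in> set u" "x \<notin> set w"
    by blast
  then obtain A B where u: "u = A @ [x] @ B"
    by (metis append_Cons append_Nil split_list)
  have "(u, A @ [x] \<^bold>^ (j * 1 + 1) @ B) \<in> R" for j
  proof -
    define f where "f = (\<lambda>i. if i = x then [x] \<^bold>^ (j + 1) else [i])"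
    have "nonerasing f"
      by (auto simp: f_def nonerasing_def)
    then have "(subst f u, subst f w) \<in> R"
      by (rule subst_closed[OF uw])
    moreover have "subst f v = v" if "x \<notin> set v" for v
      using that by (intro subst_singleton_id) (auto simp: f_def)
    moreover have "f x = [x] \<^bold>^ (j + 1)"
      by (simp add: f_def)
    ultimately have "(A @ [x] \<^bold>^ (j + 1) @ B, w) \<in> R"
      using u dist \<open>x \<notin> set w\<close> by simp
    then show ?thesis
      using uw sym trans by (metis mult.right_neutral)
  qed
  then show ?thesis
    using u by (intro exI[of _ A] exI[of _ "[x]"] exI[of _ B] exI[of _ 1]) simp
next
  case True
  have ne: "u \<noteq> []"
    using nonempty[OF uw] by simp
  \<comment> \<open>Letters of \<open>w\<close> that do not occur in \<open>u\<close> are renamed to a letter of \<open>u\<close>.\<close>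
  define f where "f = (\<lambda>i. if i \<in> set u then [i] else [hd u])"
  define W where "W = subst f w"
  have f: "nonerasing f"
    by (auto simp: f_def nonerasing_def)
  have "subst f u = u"
    by (intro subst_singleton_id) (simp add: f_def)
  then have uW: "(u, W) \<in> R"
    using subst_closed[OF uw f] by (simp add: W_def)
  have set_W: "set W = set u"
    using True ne by (auto simp: W_def set_subst f_def split: if_splits)
  have "mset u \<subset># mset w"
    using mset_subset_of_distinct[OF dist True] not_perm by (simp add: subset_mset.less_le)
  then have "length u < length w"
    by (metis mset_subset_size size_mset)
  moreover have "length W = length w"
    unfolding W_def by (induction w) (auto simp: f_def)
  ultimately have len: "length u < length W"
    by simp
  obtain d where d: "period d"
    using period_exists[OF uW len] by blast
  have "\<exists>A' P B'. [] @ u @ [] = A' @ P @ B' \<and> P \<noteq> [] \<and> ([] @ u @ [], A' @ P \<^bold>^ (d + 1) @ B') \<in> R"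
    by (rule power_from_longer_word[OF d]) (use dist uW set_W len in auto)
  then obtain A P B where APB: "u = A @ P @ B" "P \<noteq> []" "(u, A @ P \<^bold>^ (d + 1) @ B) \<in> R"
    by auto
  have "(u, A @ P \<^bold>^ (j * d + 1) @ B) \<in> R" for j
  proof (cases j)
    case 0
    then show ?thesis
      using refl[OF ne] APB(1) by simp
  next
    case (Suc i)
    have "(A @ P \<^bold>^ ((d + 1) + i * d) @ B, A @ P \<^bold>^ (d + 1) @ B) \<in> R"
      using APB(2) by (intro period_collapse_mult[OF d]) auto
    then have "(A @ P \<^bold>^ (j * d + 1) @ B, A @ P \<^bold>^ (d + 1) @ B) \<in> R"
      using Suc by (simp add: algebra_simps)
    then show ?thesis
      using APB(3) sym trans by blast
  qed
  moreover have "0 < d"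
    using d by (simp add: period_def)
  ultimately show ?thesis
    using APB(1,2) by blast
qed

end

section \<open>Two congruences that agree on nonlinear words\<close>

lemma append_eq_append_cases:
  assumes "u @ v = u' @ v'"
  obtains w where "u' = u @ w" "v = w @ v'" | w where "u = u' @ w" "v' = w @ v"
  using assms unfolding append_eq_append_conv2 by blast

text \<open>
  Two congruences that agree on a set \<open>I\<close> of words containing all nonlinear words of length at
  least three. In the application \<open>I\<close> consists of the words that are equal to zero.
\<close>

locale agreeing_congruences =
  \<alpha>: fully_invariant_congruence \<alpha> + \<beta>: fully_invariant_congruence \<beta> for \<alpha> \<beta> +
  fixes I :: "word set"
  assumes agree: "p \<in> I \<Longrightarrow> q \<in> I \<Longrightarrow> (p, q) \<in> \<alpha> \<longleftrightarrow> (p, q) \<in> \<beta>"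
    and nonlinear_in_I: "\<not> distinct p \<Longrightarrow> 3 \<le> length p \<Longrightarrow> p \<in> I"
begin

lemma swap: "agreeing_congruences \<beta> \<alpha> I"
  by unfold_locales (simp_all add: agree nonlinear_in_I)

lemma power_in_I:
  assumes "P \<noteq> []" "2 \<le> m"
  shows "l @ P \<^bold>^ (m + 1) @ r \<in> I"
proof (rule nonlinear_in_I)
  obtain m' where "m = Suc (Suc m')"
    using assms(2) by (metis add_2_eq_Suc le_Suc_ex)
  moreover obtain x P' where "P = x # P'"
    using assms(1) by (cases P) auto
  ultimately show "\<not> distinct (l @ P \<^bold>^ (m + 1) @ r)" "3 \<le> length (l @ P \<^bold>^ (m + 1) @ r)"
    by simp_all
qed

text \<open>
  Let \<open>\<alpha>\<close> raise the factor \<open>P1\<close> of a linear word to the power \<open>m + 1\<close> and let \<open>\<beta>\<close> do the same with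
  the factor \<open>P2\<close>. Each rule applies to the result of the other one; these words belong to \<open>I\<close>,
  where \<open>\<alpha>\<close> and \<open>\<beta>\<close> agree. If the factors are disjoint or overlap, both applications lead to the
  same word \<open>s\<close>. If \<open>P2\<close> is contained in \<open>P1\<close>, then \<open>s\<close> is obtained by applying the second rule
  in each of the \<open>m + 1\<close> copies of \<open>P1\<close>.
\<close>

lemma power_rules_meet_aux:
  assumes u: "A1 @ P1 @ B1 = A2 @ P2 @ B2" and dist: "distinct (A1 @ P1 @ B1)"
    and ne: "P1 \<noteq> []" "P2 \<noteq> []" and m: "2 \<le> m"
    and \<alpha>_rule: "(A1 @ P1 @ B1, A1 @ P1 \<^bold>^ (m + 1) @ B1) \<in> \<alpha>"
    and \<beta>_rule: "(A2 @ P2 @ B2, A2 @ P2 \<^bold>^ (m + 1) @ B2) \<in> \<beta>"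
    and len: "length A1 \<le> length A2"
  shows "(A1 @ P1 \<^bold>^ (m + 1) @ B1, A2 @ P2 \<^bold>^ (m + 1) @ B2) \<in> \<alpha>"
proof -
  let ?p1 = "A1 @ P1 \<^bold>^ (m + 1) @ B1" and ?p2 = "A2 @ P2 \<^bold>^ (m + 1) @ B2"
  have dist2: "distinct (A2 @ P2 @ B2)"
    using dist u by simp
  have sets: "set (P1 \<^bold>^ (m + 1)) \<subseteq> set P1" "set (P2 \<^bold>^ (m + 1)) \<subseteq> set P2"
    by (rule set_word_power)+
  note \<alpha>_apply = \<alpha>.rewrite_in_context_id[OF \<alpha>_rule dist sets(1)]
  note \<beta>_apply = \<beta>.rewrite_in_context_id[OF \<beta>_rule dist2 sets(2)]
  have p1: "?p1 \<in> I" and p2: "?p2 \<in> I"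
    using power_in_I[OF ne(1) m] power_in_I[OF ne(2) m] by blast+
  have joined: "(?p1, ?p2) \<in> \<alpha>" if "(?p1, s) \<in> \<beta>" "(?p2, s) \<in> \<alpha>" "s \<in> I" for s
    using that agree[OF p1 that(3)] \<alpha>.sym \<alpha>.trans by blast
  obtain X where X: "A2 = A1 @ X" "P1 @ B1 = X @ P2 @ B2"
    using u
  proof (rule append_eq_append_cases)
    fix w assume "A1 = A2 @ w" "P2 @ B2 = w @ P1 @ B1"
    then show ?thesis
      using len that[of "[]"] by simp
  qed (rule that)
  consider (disjoint) M where "X = P1 @ M" "B1 = M @ P2 @ B2"
    | (overlap) Y Z where "P1 = X @ Y" "P2 = Y @ Z" "B1 = Z @ B2"
    | (nested) Z where "P1 = X @ P2 @ Z" "B2 = Z @ B1"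
    using X(2)
  proof (rule append_eq_append_cases)
    fix Y assume Y: "P1 = X @ Y" "P2 @ B2 = Y @ B1"
    from Y(2) show ?thesis
      by (rule append_eq_append_cases) (use Y(1) that(2,3) in auto)
  qed (rule that(1))
  then show ?thesis
  proof cases
    case disjoint
    let ?s = "A1 @ P1 \<^bold>^ (m + 1) @ M @ P2 \<^bold>^ (m + 1) @ B2"
    show ?thesis
    proof (rule joined)
      have "((A1 @ P1 \<^bold>^ (m + 1) @ M) @ P2 @ B2, (A1 @ P1 \<^bold>^ (m + 1) @ M) @ P2 \<^bold>^ (m + 1) @ B2) \<in> \<beta>"
        by (rule \<beta>_apply) (simp_all add: X disjoint)
      then show "(?p1, ?s) \<in> \<beta>"
        by (simp add: disjoint)
      have "(A1 @ P1 @ (M @ P2 \<^bold>^ (m + 1) @ B2), A1 @ P1 \<^bold>^ (m + 1) @ (M @ P2 \<^bold>^ (m + 1) @ B2)) \<in> \<alpha>"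
        by (rule \<alpha>_apply) (simp_all add: disjoint)
      then show "(?p2, ?s) \<in> \<alpha>"
        by (simp add: X disjoint)
      show "?s \<in> I"
        using power_in_I[OF ne(1) m] by blast
    qed
  next
    case overlap
    let ?s = "(A1 @ P1 \<^bold>^ m @ X) @ P2 \<^bold>^ (m + 1) @ B2"
    show ?thesis
    proof (rule joined)
      have "((A1 @ P1 \<^bold>^ m @ X) @ P2 @ B2, ?s) \<in> \<beta>"
        by (rule \<beta>_apply) (simp_all add: X)
      moreover have "(A1 @ P1 \<^bold>^ m @ X) @ P2 @ B2 = A1 @ (P1 \<^bold>^ m @ (X @ Y)) @ Z @ B2"
        by (simp add: overlap(2))
      moreover have "\<dots> = ?p1"
        unfolding overlap(1)[symmetric] word_power_Suc_right by (simp add: overlap(3))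
      ultimately show "(?p1, ?s) \<in> \<beta>"
        by simp
      have \<alpha>_step: "(A1 @ P1 @ (Z @ P2 \<^bold>^ m @ B2), A1 @ P1 \<^bold>^ (m + 1) @ (Z @ P2 \<^bold>^ m @ B2)) \<in> \<alpha>"
        by (rule \<alpha>_apply) (simp_all add: overlap)
      have eqs: "A1 @ P1 @ (Z @ P2 \<^bold>^ m @ B2) = ?p2"
        by (simp add: overlap X(1))
      have "A1 @ P1 \<^bold>^ (m + 1) @ (Z @ P2 \<^bold>^ m @ B2) = A1 @ (P1 \<^bold>^ m @ P1) @ Z @ P2 \<^bold>^ m @ B2"
        unfolding word_power_Suc_right by simp
      also have "\<dots> = ?s"
        by (simp add: overlap(1,2))
      finally show "(?p2, ?s) \<in> \<alpha>"
        using \<alpha>_step eqs by argo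
      show "?s \<in> I"
        using power_in_I[OF ne(2) m, of "A1 @ P1 \<^bold>^ m @ X"] by simp
    qed
  next
    case nested
    let ?Q = "X @ P2 \<^bold>^ (m + 1) @ Z"
    let ?s = "A1 @ ?Q \<^bold>^ (m + 1) @ B1"
    show ?thesis
    proof (rule joined)
      have "(?p1, A1 @ ?Q \<^bold>^ k @ P1 \<^bold>^ (m + 1 - k) @ B1) \<in> \<beta>" if "k \<le> m + 1" for k
        using that
      proof (induction k)
        case 0
        then show ?case using ne(1) by (auto intro: \<beta>.refl)
      next
        case (Suc k)
        let ?r = "P1 \<^bold>^ (m - k) @ B1"
        have "((A1 @ ?Q \<^bold>^ k @ X) @ P2 @ (Z @ ?r), (A1 @ ?Q \<^bold>^ k @ X) @ P2 \<^bold>^ (m + 1) @ (Z @ ?r)) \<in> \<beta>"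
          by (rule \<beta>_apply) (simp_all add: X nested)
        moreover have "(A1 @ ?Q \<^bold>^ k @ X) @ P2 \<^bold>^ (m + 1) @ (Z @ ?r) = A1 @ ?Q \<^bold>^ Suc k @ P1 \<^bold>^ (m + 1 - Suc k) @ B1"
          using word_power_commute_append[of ?Q k ?r] by simp
        moreover have "(A1 @ ?Q \<^bold>^ k @ X) @ P2 @ (Z @ ?r) = A1 @ ?Q \<^bold>^ k @ P1 \<^bold>^ (m + 1 - k) @ B1"
          using Suc.prems by (simp add: nested(1) Suc_diff_le)
        ultimately show ?case
          using Suc \<beta>.trans by (metis Suc_leD)
      qed
      from this[of "m + 1"] show "(?p1, ?s) \<in> \<beta>"
        by simp
      obtain P2' q where P2: "P2 = P2' @ [q]"
        using ne(2) by (cases P2 rule: rev_cases) auto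
      \<comment> \<open>The last letter of \<open>P2\<close> absorbs the additional \<open>m\<close> copies of \<open>P2\<close>.\<close>
      define f where "f = (\<lambda>i. if i = q then i # P2 \<^bold>^ m else [i])"
      have f: "nonerasing f" and fq: "f q = q # P2 \<^bold>^ m"
        by (simp_all add: f_def nonerasing_def)
      have "q \<notin> set X" "q \<notin> set Z" "q \<notin> set P2'"
        using dist by (auto simp: nested(1) P2)
      then have "subst f X = X" "subst f Z = Z" "subst f P2' = P2'"
        by (auto simp: f_def intro!: subst_singleton_id)
      moreover from this have "subst f P2 = P2 @ P2 \<^bold>^ m"
        using fq by (simp add: P2)
      ultimately have fP1: "subst f P1 = ?Q"
        by (simp add: nested(1))
      have "(A1 @ subst f P1 @ B1, A1 @ subst f (P1 \<^bold>^ (m + 1)) @ B1) \<in> \<alpha>"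
        by (rule \<alpha>.rewrite_in_context[OF \<alpha>_rule dist sets(1) f]) simp_all
      then show "(?p2, ?s) \<in> \<alpha>"
        unfolding subst_word_power fP1 by (simp add: X(1) nested(2))
      have "?Q \<noteq> []"
        using ne(2) by (simp add: word_power_eq_Nil)
      then show "?s \<in> I"
        using power_in_I m by blast
    qed
  qed
qed

lemma power_rules_meet:
  assumes u: "A1 @ P1 @ B1 = A2 @ P2 @ B2" and dist: "distinct (A1 @ P1 @ B1)"
    and ne: "P1 \<noteq> []" "P2 \<noteq> []" and m: "2 \<le> m"
    and \<alpha>_rule: "(A1 @ P1 @ B1, A1 @ P1 \<^bold>^ (m + 1) @ B1) \<in> \<alpha>"
    and \<beta>_rule: "(A2 @ P2 @ B2, A2 @ P2 \<^bold>^ (m + 1) @ B2) \<in> \<beta>"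
  shows "(A1 @ P1 \<^bold>^ (m + 1) @ B1, A2 @ P2 \<^bold>^ (m + 1) @ B2) \<in> \<beta>"
proof -
  have p: "A1 @ P1 \<^bold>^ (m + 1) @ B1 \<in> I" "A2 @ P2 \<^bold>^ (m + 1) @ B2 \<in> I"
    using power_in_I[OF ne(1) m] power_in_I[OF ne(2) m] by blast+
  show ?thesis
  proof (cases "length A1 \<le> length A2")
    case True
    then show ?thesis
      using power_rules_meet_aux[OF assms] agree[OF p] by blast
  next
    case False
    then have "length A2 \<le> length A1"
      by simp
    moreover have "distinct (A2 @ P2 @ B2)"
      using dist u by simp
    ultimately show ?thesis
      using agreeing_congruences.power_rules_meet_aux[OF swap u[symmetric] _ ne(2,1) m \<beta>_rule \<alpha>_rule]
        \<beta>.sym by blast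
  qed
qed

lemma linear_common_value:
  assumes dist: "distinct u"
    and \<alpha>: "(u, v) \<in> \<alpha>" "mset u \<noteq> mset v" and \<beta>: "(u, w) \<in> \<beta>" "mset u \<noteq> mset w"
  shows "\<exists>p\<in>I. (u, p) \<in> \<alpha> \<and> (u, p) \<in> \<beta>"
proof -
  obtain A1 P1 B1 d1 where 1: "u = A1 @ P1 @ B1" "P1 \<noteq> []" "0 < d1"
    "\<And>j. (u, A1 @ P1 \<^bold>^ (j * d1 + 1) @ B1) \<in> \<alpha>"
    using \<alpha>.linear_word_periodic[OF \<alpha>(1) dist \<alpha>(2)] by blast
  obtain A2 P2 B2 d2 where 2: "u = A2 @ P2 @ B2" "P2 \<noteq> []" "0 < d2"
    "\<And>j. (u, A2 @ P2 \<^bold>^ (j * d2 + 1) @ B2) \<in> \<beta>"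
    using \<beta>.linear_word_periodic[OF \<beta>(1) dist \<beta>(2)] by blast
  \<comment> \<open>The factor 2 guarantees that even the powers of a single letter are nonlinear of length at least three.\<close>
  define m where "m = 2 * d1 * d2"
  have "0 < d1 * d2"
    using 1(3) 2(3) by simp
  then have m: "2 \<le> m"
    by (simp add: m_def)
  have rules: "(u, A1 @ P1 \<^bold>^ (m + 1) @ B1) \<in> \<alpha>" "(u, A2 @ P2 \<^bold>^ (m + 1) @ B2) \<in> \<beta>"
    using 1(4)[of "2 * d2"] 2(4)[of "2 * d1"] by (simp_all add: m_def ac_simps)
  have "(A1 @ P1 \<^bold>^ (m + 1) @ B1, A2 @ P2 \<^bold>^ (m + 1) @ B2) \<in> \<beta>"
    using 1(1) 2(1) dist rules by (intro power_rules_meet[OF _ _ 1(2) 2(2) m]) auto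
  then have "(u, A1 @ P1 \<^bold>^ (m + 1) @ B1) \<in> \<beta>"
    using rules(2) \<beta>.sym \<beta>.trans by blast
  then show ?thesis
    using rules(1) power_in_I[OF 1(2) m] by blast
qed

end

section \<open>Commutative congruences\<close>

locale commutative_congruence = fully_invariant_congruence +
  assumes commutative: "([0, 1], [1, 0]) \<in> R"
begin

lemma commute:
  assumes "u @ v \<noteq> []"
  shows "(u @ v, v @ u) \<in> R"
proof (cases "u = [] \<or> v = []")
  case True
  then show ?thesis using assms refl by auto
next
  case False
  then have "nonerasing (\<lambda>i. if i = 0 then u else v)"
    by (simp add: nonerasing_def)
  from subst_closed[OF commutative this] show ?thesis
    by simp
qed

lemma permutation:
  assumes "mset u = mset v" "u \<noteq> []"
  shows "(u, v) \<in> R"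
  using assms
proof (induction u arbitrary: v)
  case (Cons x u)
  then have "x \<in> set v"
    by (metis list.set_intros(1) mset_eq_setD)
  then obtain v1 v2 where v: "v = v1 @ x # v2"
    by (meson split_list)
  then have m: "mset u = mset (v1 @ v2)"
    using Cons.prems(1) by simp
  have "([x] @ u, [x] @ v1 @ v2) \<in> R"
  proof (cases "u = []")
    case True
    then have "v1 @ v2 = []"
      using m by simp
    then show ?thesis using True refl by simp
  next
    case False
    then show ?thesis
      using Cons.IH[OF m] append_left by blast
  qed
  moreover have "(([x] @ v1) @ v2, (v1 @ [x]) @ v2) \<in> R"
    by (intro append_right commute) simp
  ultimately show ?case
    using trans v by simp
qed simp

lemma absorb_letters:
  assumes u: "u \<noteq> []" and "\<And>z. z \<in> set u \<Longrightarrow> (u @ [z], u) \<in> R" and "set v \<subseteq> set u"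
  shows "(u @ v, u) \<in> R"
  using assms(3)
proof (induction v)
  case Nil
  show ?case using refl[OF u] by simp
next
  case (Cons z v)
  then have "(u @ z # v, u @ v) \<in> R" "(u @ v, u) \<in> R"
    using append_right[OF assms(2)[of z], of v] by simp_all
  then show ?case
    by (rule trans)
qed

lemma same_content_related:
  assumes "u \<noteq> []" "v \<noteq> []" "set u = set v"
    and "\<And>z. z \<in> set u \<Longrightarrow> (u @ [z], u) \<in> R" "\<And>z. z \<in> set v \<Longrightarrow> (v @ [z], v) \<in> R"
  shows "(u, v) \<in> R"
proof -
  have u: "(u @ v, u) \<in> R"
    by (rule absorb_letters[OF assms(1,4)]) (simp_all add: assms(3))
  have v: "(v @ u, v) \<in> R"
    by (rule absorb_letters[OF assms(2,5)]) (simp_all add: assms(3))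
  have "(u @ v, v @ u) \<in> R"
    using assms(1) by (intro commute) simp
  then show ?thesis
    using trans[OF sym[OF u] trans[OF _ v]] by blast
qed

end

section \<open>The theories of the trivial variety and of the semilattices\<close>

text \<open>
  Two words are related if they contain the same letters. This is the theory of the semilattices.
\<close>

definition content_congruence :: "identity set" where
  "content_congruence = {(u, v). u \<noteq> [] \<and> v \<noteq> [] \<and> set u = set v}"

lemma content_congruence_fully_invariant: "fully_invariant_congruence content_congruence"
  by unfold_locales (auto simp: content_congruence_def set_subst subst_Nil_iff)

lemma (in commutative_congruence) content_congruence_least:
  assumes idem: "([0, 0], [0]) \<in> R"
  shows "content_congruence \<subseteq> R"
proof clarify
  fix u v assume uv: "(u, v) \<in> content_congruence"
  have double: "(w @ w, w) \<in> R" if "w \<noteq> []" for w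
    using subst_closed[OF idem, of "\<lambda>_. w"] that by (simp add: nonerasing_def)
  have "(w @ [z], w) \<in> R" if z: "z \<in> set w" for w z
  proof -
    obtain w1 w2 where w: "w = w1 @ [z] @ w2"
      using split_list[OF z] by auto
    have "(w @ [z], w1 @ ([z] @ [z]) @ w2) \<in> R"
      by (rule permutation) (simp_all add: w)
    moreover have "(w1 @ ([z] @ [z]) @ w2, w) \<in> R"
      unfolding w by (intro context_closed double) simp
    ultimately show ?thesis
      by (rule trans)
  qed
  note absorb = this
  have "u \<noteq> []" "v \<noteq> []" "set u = set v"
    using uv by (simp_all add: content_congruence_def)
  then show "(u, v) \<in> R"
    by (rule same_content_related) (rule absorb; assumption)+
qed

lemma models_content_congruence: "models content_congruence = semilattice_variety"
proof
  show "models content_congruence \<subseteq> (semilattice_variety :: 'u magma set)"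
  proof
    fix S :: "'u magma" assume "S \<in> models content_congruence"
    then have S: "is_semigroup S" "\<And>u v \<phi>. (u, v) \<in> content_congruence \<Longrightarrow> range \<phi> \<subseteq> carrier S \<Longrightarrow>
        word_value S \<phi> u = word_value S \<phi> v"
      by (auto simp: models_def satisfies_def)
    have "([0, 1], [1, 0]) \<in> content_congruence" "([0, 0], [0]) \<in> content_congruence"
      by (auto simp: content_congruence_def)
    note laws = S(2)[OF this(1)] S(2)[OF this(2)]
    have "mul S a b = mul S b a" "mul S a a = a" if "a \<in> carrier S" "b \<in> carrier S" for a b
      using laws[OF two_letter_valuation[OF that]] by simp_all
    then show "S \<in> semilattice_variety"
      using S(1) by (auto simp: semilattice_variety_def)
  qed
  show "(semilattice_variety :: 'u magma set) \<subseteq> models content_congruence"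
  proof
    fix S :: "'u magma" assume S: "S \<in> semilattice_variety"
    then have sg: "is_semigroup S"
      by (simp add: semilattice_variety_def)
    interpret commutative_congruence "equational_theory {S}"
    proof (intro commutative_congruence.intro commutative_congruence_axioms.intro)
      show "fully_invariant_congruence (equational_theory {S})"
        using sg by (intro fully_invariant_congruence_theory) simp
      show "([0, 1], [1, 0]) \<in> equational_theory {S}"
        using S by (auto simp: in_equational_theory_iff semilattice_variety_def image_subset_iff)
    qed
    have "([0, 0], [0]) \<in> equational_theory {S}"
      using S by (auto simp: in_equational_theory_iff semilattice_variety_def image_subset_iff)
    then have "content_congruence \<subseteq> equational_theory {S}"
      by (rule content_congruence_least)
    then show "S \<in> models content_congruence"
      using sg unfolding models_def satisfies_def by (auto simp: in_equational_theory_iff subset_iff)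
  qed
qed

lemma theory_semilattice_variety:
  "equational_theory (semilattice_variety :: ('u::infinite) magma set) = content_congruence"
  unfolding models_content_congruence[symmetric]
  by (rule fully_invariant_congruence.theory_of_models[OF content_congruence_fully_invariant])

lemma theory_trivial_variety:
  "equational_theory (trivial_variety :: 'u magma set) = {(u, v). u \<noteq> [] \<and> v \<noteq> []}"
proof -
  have "word_value S \<phi> u = word_value S \<phi> v"
    if S: "S \<in> trivial_variety" and \<phi>: "range \<phi> \<subseteq> carrier S" and "u \<noteq> []" "v \<noteq> []"
    for S :: "'u magma" and \<phi> u v
  proof -
    obtain a where a: "is_semigroup S" "carrier S = {a}"
      using S unfolding trivial_variety_def by blast
    have "word_value S \<phi> u \<in> {a}" "word_value S \<phi> v \<in> {a}"
      using word_value_closed[OF a(1) \<phi>] that(3,4) a(2) by auto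
    then show ?thesis by simp
  qed
  note values_eq = this
  have "(u, v) \<in> equational_theory (trivial_variety :: 'u magma set)" if "u \<noteq> []" "v \<noteq> []" for u v
    unfolding in_equational_theory_iff
    using that by (intro conjI ballI allI impI) (assumption | rule values_eq)+
  moreover have "u \<noteq> [] \<and> v \<noteq> []"
    if "(u, v) \<in> equational_theory (trivial_variety :: 'u magma set)" for u v
    using that unfolding in_equational_theory_iff by blast
  ultimately show ?thesis
    by blast
qed

section \<open>Theories of commutative varieties satisfying \<open>x\<^sup>2y \<approx> 0\<close>\<close>

text \<open>
  The theory of a variety that satisfies \<open>xy \<approx> yx\<close> and \<open>x\<^sup>2y \<approx> 0\<close>, with \<open>2\<close> as the fresh letter
  in the identities abbreviated by the latter. The set \<open>zero_words\<close> consists of the words that are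
  equal to zero in the variety.
\<close>

locale nil_congruence = commutative_congruence +
  assumes right_zero: "([0, 0, 1, 2], [0, 0, 1]) \<in> R"
    and left_zero: "([2, 0, 0, 1], [0, 0, 1]) \<in> R"
begin

definition zero_words :: "word set" where
  "zero_words = {w. (w, [0, 0, 1]) \<in> R}"

lemma zero_words_related: "u \<in> zero_words \<Longrightarrow> v \<in> zero_words \<Longrightarrow> (u, v) \<in> R"
  unfolding zero_words_def mem_Collect_eq by (rule trans[OF _ sym])

lemma zero_words_closed: "u \<in> zero_words \<Longrightarrow> (v, u) \<in> R \<Longrightarrow> v \<in> zero_words"
  unfolding zero_words_def mem_Collect_eq by (rule trans)

lemma subst_zero: "nonerasing f \<Longrightarrow> subst f [0, 0, 1] \<in> zero_words"
proof -
  assume f: "nonerasing f"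
  let ?s = "subst f [0, 0, 1]" and ?z = "[0, 0, 1] :: word"
  have ne: "?s \<noteq> []"
    using subst_Nil_iff[OF f, of ?z] by simp
  define g where "g = (\<lambda>i. if i = 2 then ?s else [i] :: word)"
  define h where "h = (\<lambda>i. if i = 2 then ?z else f i)"
  have gh: "nonerasing g" "nonerasing h"
    using f ne by (auto simp: g_def h_def nonerasing_def)
  have "(?z @ ?s, ?z) \<in> R"
    using subst_closed[OF right_zero gh(1)] by (simp add: g_def)
  moreover have "(?z @ ?s, ?s) \<in> R"
    using subst_closed[OF left_zero gh(2)] by (simp add: h_def)
  ultimately show ?thesis
    unfolding zero_words_def mem_Collect_eq by (rule trans[OF sym, rotated])
qed

lemma zero_words_subst:
  assumes "w \<in> zero_words" "nonerasing f"
  shows "subst f w \<in> zero_words"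
  using assms subst_closed[of w "[0, 0, 1]" f] subst_zero[of f] zero_words_closed by (simp add: zero_words_def)

lemma nonlinear_in_zero_words:
  assumes "\<not> distinct w" "3 \<le> length w"
  shows "w \<in> zero_words"
proof -
  obtain w1 w2 w3 x where w: "w = w1 @ [x] @ w2 @ [x] @ w3"
    using not_distinct_decomp[OF assms(1)] by blast
  let ?r = "w1 @ w2 @ w3"
  have "?r \<noteq> []"
    using assms(2) by (auto simp: w)
  then have "subst (\<lambda>i. if i = 0 then [x] else ?r) [0, 0, 1] \<in> zero_words"
    by (intro subst_zero) (simp add: nonerasing_def)
  moreover have "(w, [x] @ [x] @ ?r) \<in> R"
    by (rule permutation) (simp_all add: w)
  ultimately show ?thesis
    using zero_words_closed by simp
qed

lemma outside_zero_words:
  assumes "u \<notin> zero_words"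
  shows "distinct u \<or> (\<exists>x. u = [x, x])"
proof (rule ccontr)
  assume *: "\<not> ?thesis"
  then have "length u < 3"
    using nonlinear_in_zero_words assms by force
  then have "u = [] \<or> (\<exists>x. u = [x]) \<or> (\<exists>x y. u = [x, y])"
    by (cases u rule: remdups_adj.cases) (auto simp: Suc_length_conv less_Suc_eq numeral_3_eq_3)
  with * show False
    by auto
qed

lemma related_content:
  assumes "(u, v) \<in> R" "u \<notin> zero_words"
  shows "set v \<subseteq> set u"
proof (rule ccontr)
  assume "\<not> ?thesis"
  then obtain y where y: "y \<in> set v" "y \<notin> set u"
    by blast
  define f where "f = (\<lambda>i. if i = y then [y, y, y] else [i])"
  have f: "nonerasing f" and fy: "f y = [y, y, y]"
    by (auto simp: f_def nonerasing_def)
  have "subst f u = u"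
    using y(2) by (intro subst_singleton_id) (auto simp: f_def)
  then have "(u, subst f v) \<in> R"
    using subst_closed[OF assms(1) f] by simp
  moreover obtain v1 v2 where "v = v1 @ y # v2"
    using split_list[OF y(1)] by blast
  then have "subst f v \<in> zero_words"
    by (intro nonlinear_in_zero_words) (simp_all add: fy)
  ultimately show False
    using assms(2) zero_words_closed by blast
qed

text \<open>
  Outside the zero class only permutations are identified.
\<close>

lemma related_outside_zero_words:
  assumes uv: "(u, v) \<in> R" and u: "u \<notin> zero_words"
  shows "mset u = mset v"
proof -
  have v: "v \<notin> zero_words"
    using zero_words_closed uv u by blast
  have content: "set u = set v"
    using related_content[OF uv u] related_content[OF sym[OF uv] v] by blast
  have square: False if "([x], [x, x]) \<in> R" "[x] \<notin> zero_words" for x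
  proof -
    have "([x, x], [x, x, x]) \<in> R"
      using append_left[OF that(1), of "[x]"] by simp
    then have "([x], [x, x, x]) \<in> R"
      using that(1) trans by blast
    moreover have "[x, x, x] \<in> zero_words"
      by (rule nonlinear_in_zero_words) simp_all
    ultimately show False
      using that(2) zero_words_closed by blast
  qed
  have single: "w = [x]" if "distinct w" "set w = {x}" for w and x :: nat
    using that by (cases w) (auto simp: subset_singleton_iff dest: subset_antisym)
  consider "distinct u" "distinct v" | x where "u = [x, x]" "distinct v"
    | x where "distinct u" "v = [x, x]" | x y where "u = [x, x]" "v = [y, y]"
    using outside_zero_words[OF u] outside_zero_words[OF v] by blast
  then show ?thesis
  proof cases
    case 1
    then show ?thesis
      using content by (simp add: set_eq_iff_mset_eq_distinct)
  next
    case 2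
    then have "v = [x]"
      using content by (intro single) auto
    then show ?thesis
      using square[of x] sym[OF uv] v 2 by simp
  next
    case 3
    then have "u = [x]"
      using content by (intro single) auto
    then show ?thesis
      using square[of x] uv u 3 by simp
  next
    case 4
    then show ?thesis
      using content by simp
  qed
qed

end

text \<open>
  The analogue of \<open>linear_word_periodic\<close> for the square of a letter.
\<close>

lemma (in fully_invariant_congruence) square_rule:
  assumes "([x, x], v) \<in> R" "mset v \<noteq> {#x, x#}"
  shows "\<exists>k>0. \<forall>j. ([x, x], [x] \<^bold>^ (2 + j * k)) \<in> R"
proof -
  have "\<exists>k>0. ([x, x], [x] \<^bold>^ (2 + k)) \<in> R"
  proof (cases "v = [x]")
    case True
    then have "([x, x, x], [x, x]) \<in> R"
      using append_left[OF assms(1), of "[x]"] by simp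
    then have "([x, x], [x, x, x]) \<in> R"
      by (rule sym)
    then show ?thesis
      by (intro exI[of _ 1]) (simp add: numeral_2_eq_2)
  next
    case False
    define f where "f = (\<lambda>i. if i = x then [x] else [x, x, x])"
    have f: "nonerasing f"
      by (auto simp: f_def nonerasing_def)
    have power: "subst f w = [x] \<^bold>^ length (subst f w)" for w
      by (induction w) (auto simp: f_def)
    have "([x, x], subst f v) \<in> R"
      using subst_closed[OF assms(1) f] by (simp add: f_def)
    moreover have "3 \<le> length (subst f v)"
    proof (cases "\<exists>y\<in>set v. y \<noteq> x")
      case True
      then obtain y v1 v2 where "y \<noteq> x" "v = v1 @ y # v2"
        by (meson split_list)
      then show ?thesis
        by (simp add: f_def)
    next
      case all_x: False
      then have "v = replicate (length v) x"
        by (simp add: replicate_length_same)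
      moreover have "length v \<noteq> 0"
        using nonempty[OF assms(1)] by simp
      moreover have "length v \<noteq> 1"
        using False \<open>v = replicate (length v) x\<close> by (metis One_nat_def replicate_0 replicate_Suc)
      moreover have "length v \<noteq> 2"
        using assms(2) \<open>v = replicate (length v) x\<close> by (metis numeral_2_eq_2 replicate_0 replicate_Suc mset.simps)
      ultimately have "3 \<le> length v"
        by linarith
      then show ?thesis
        using length_subst[OF f, of v] by linarith
    qed
    moreover define k where "k = length (subst f v) - 2"
    ultimately have "0 < k" "length (subst f v) = 2 + k"
      by simp_all
    moreover from this have "subst f v = [x] \<^bold>^ (2 + k)"
      using power[of v] by metis
    ultimately show ?thesis
      using \<open>([x, x], subst f v) \<in> R\<close> by metis
  qed
  then obtain k where k: "0 < k" "([x, x], [x] \<^bold>^ (2 + k)) \<in> R"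
    by blast
  have "([x, x], [x] \<^bold>^ (2 + j * k)) \<in> R" for j
  proof (induction j)
    case 0
    then show ?case using refl by (simp add: numeral_2_eq_2)
  next
    case (Suc j)
    have "([x] \<^bold>^ (2 + j * k), [x] \<^bold>^ (2 + Suc j * k)) \<in> R"
      using append_right[OF k(2), of "[x] \<^bold>^ (j * k)"]
      by (simp add: numeral_2_eq_2 word_power_add[symmetric] ac_simps)
    with Suc show ?case
      by (rule trans)
  qed
  with k(1) show ?thesis
    by blast
qed

section \<open>Cancellability\<close>

context nil_congruence
begin

text \<open>
  A chain of \<open>R\<close>-steps and \<open>\<beta>\<close>-steps that leads from \<open>u\<close> to a word other than its permutations must
  leave the set of permutations of \<open>u\<close> by a \<open>\<beta>\<close>-step. The step starts at a permutation \<open>u'\<close> of \<open>u\<close>;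
  the letters are then renamed so that it starts at \<open>u\<close>.
\<close>

lemma exit_rule:
  assumes \<beta>: "fully_invariant_congruence \<beta>" and u: "u \<notin> zero_words"
    and uv: "(u, v) \<in> (R \<union> \<beta>)\<^sup>+" "mset u \<noteq> mset v"
  shows "\<exists>w. (u, w) \<in> \<beta> \<and> mset u \<noteq> mset w"
proof -
  interpret \<beta>: fully_invariant_congruence \<beta> by fact
  have "mset u = mset v \<or> (\<exists>u' w. mset u = mset u' \<and> (u', w) \<in> \<beta> \<and> mset u' \<noteq> mset w)"
    using uv(1)
  proof (induction rule: trancl_induct)
    case (base y)
    then show ?case
      using related_outside_zero_words[OF _ u] by blast
  next
    case (step y z)
    have "mset y = mset z" if "(y, z) \<in> R" "mset u = mset y"
    proof (rule related_outside_zero_words[OF that(1)])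
      have "u \<noteq> []"
        using fully_invariant_congruence.nonempty[OF
            fully_invariant_congruence_join[OF fully_invariant_congruence_axioms \<beta>] uv(1)] by simp
      then show "y \<notin> zero_words"
        using permutation[OF that(2)] zero_words_closed u by blast
    qed
    note related = this
    show ?case
    proof (cases "mset u = mset y \<and> mset y \<noteq> mset z")
      case True
      then show ?thesis
        using step.hyps(2) related by blast
    next
      case False
      then show ?thesis
        using step.IH by metis
    qed
  qed
  then obtain u' w where w: "mset u = mset u'" "(u', w) \<in> \<beta>" "mset u' \<noteq> mset w"
    using uv(2) by blast
  from outside_zero_words[OF u] show ?thesis
  proof
    assume dist: "distinct u"
    then have dist': "distinct u'"
      using w(1) by (metis mset_eq_imp_distinct_iff)
    obtain A P B d where P: "u' = A @ P @ B" "P \<noteq> []" "0 < d" "\<And>j. (u', A @ P \<^bold>^ (j * d + 1) @ B) \<in> \<beta>"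
      using \<beta>.linear_word_periodic[OF w(2) dist' w(3)] by blast
    have len: "length u' = length u"
      using w(1) by (metis size_mset)
    obtain f where f: "nonerasing f" "map f u' = map (\<lambda>x. [x]) u"
      using assignment_exists[OF dist', of "map (\<lambda>x. [x]) u"] len by auto
    \<comment> \<open>The periodic form is longer than \<open>u\<close>, so it remains different from the permutations of \<open>u\<close> after renaming.\<close>
    have "subst f u' = u"
      unfolding subst_def f(2) by simp
    then have "(u, subst f (A @ P \<^bold>^ (1 * d + 1) @ B)) \<in> \<beta>"
      using \<beta>.subst_closed[OF P(4) f(1)] by metis
    moreover have "length u < length (subst f (A @ P \<^bold>^ (1 * d + 1) @ B))"
    proof -
      have "0 < d * length P"
        using P(2,3) by simp
      then have "length u < length (A @ P \<^bold>^ (1 * d + 1) @ B)"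
        by (simp add: len[symmetric] P(1) length_word_power)
      also have "\<dots> \<le> length (subst f (A @ P \<^bold>^ (1 * d + 1) @ B))"
        by (rule length_subst[OF f(1)])
      finally show ?thesis .
    qed
    ultimately show ?thesis
      by (metis less_irrefl size_mset)
  next
    assume "\<exists>x. u = [x, x]"
    then obtain x where x: "u = [x, x]" ..
    then have "length u' = 2" "set u' = {x}"
      using arg_cong[OF w(1), of size] arg_cong[OF w(1), of set_mset] x by simp_all
    then obtain y z where "u' = [y, z]"
      by (auto simp: length_Suc_conv numeral_2_eq_2)
    then have "u' = u"
      using x \<open>set u' = {x}\<close> by (metis insertI1 insertI2 list.simps(15) singletonD)
    then show ?thesis
      using w by auto
  qed
qed

lemma cancel_inclusion:
  assumes \<alpha>: "fully_invariant_congruence \<alpha>" and \<beta>: "fully_invariant_congruence \<beta>"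
    and meet: "R \<inter> \<alpha> = R \<inter> \<beta>" and join: "(R \<union> \<alpha>)\<^sup>+ = (R \<union> \<beta>)\<^sup>+"
  shows "\<alpha> \<subseteq> \<beta>"
proof -
  interpret \<alpha>: fully_invariant_congruence \<alpha> by fact
  interpret \<beta>: fully_invariant_congruence \<beta> by fact
  interpret agreeing_congruences \<alpha> \<beta> zero_words
  proof
    fix p q assume "p \<in> zero_words" "q \<in> zero_words"
    then have "(p, q) \<in> R"
      by (rule zero_words_related)
    then show "(p, q) \<in> \<alpha> \<longleftrightarrow> (p, q) \<in> \<beta>"
      using meet by blast
  qed (rule nonlinear_in_zero_words)
  have common: "\<exists>p\<in>zero_words. (u, p) \<in> \<alpha> \<and> (u, p) \<in> \<beta>"
    if u: "u \<notin> zero_words" and uv: "(u, v) \<in> \<alpha>" "mset u \<noteq> mset v" for u v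
  proof -
    have "(u, v) \<in> (R \<union> \<beta>)\<^sup>+"
      using uv(1) join by blast
    then obtain w where w: "(u, w) \<in> \<beta>" "mset u \<noteq> mset w"
      using exit_rule[OF \<beta> u] uv(2) by blast
    from outside_zero_words[OF u] show ?thesis
    proof
      assume "distinct u"
      then show ?thesis
        using linear_common_value uv w by blast
    next
      assume "\<exists>x. u = [x, x]"
      then obtain x where x: "u = [x, x]" ..
      then have m: "mset v \<noteq> {#x, x#}" "mset w \<noteq> {#x, x#}"
        using uv(2) w(2) by auto
      \<comment> \<open>The square rules of \<open>\<alpha>\<close> and \<open>\<beta>\<close> have the instance \<open>x\<^sup>2 \<approx> x\<^sup>2\<^sup>+\<^sup>k\<^sup>l\<close> in common.\<close>
      obtain k where k: "0 < k" "\<And>j. (u, [x] \<^bold>^ (2 + j * k)) \<in> \<alpha>"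
        using \<alpha>.square_rule[OF uv(1)[unfolded x] m(1)] x by blast
      obtain l where l: "0 < l" "\<And>j. (u, [x] \<^bold>^ (2 + j * l)) \<in> \<beta>"
        using \<beta>.square_rule[OF w(1)[unfolded x] m(2)] x by blast
      have "0 < k * l"
        using k l by simp
      then have "[x] \<^bold>^ (2 + k * l) \<in> zero_words"
        by (intro nonlinear_in_zero_words) (auto simp: length_word_power word_power_singleton numeral_2_eq_2)
      then show ?thesis
        using k(2)[of l] l(2)[of k] by (auto simp: mult.commute)
    qed
  qed
  show ?thesis
  proof clarify
    fix u v assume uv: "(u, v) \<in> \<alpha>"
    show "(u, v) \<in> \<beta>"
    proof (cases "mset u = mset v \<or> u \<in> zero_words \<and> v \<in> zero_words")
      case True
      then have "(u, v) \<in> R"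
        using permutation zero_words_related \<alpha>.nonempty[OF uv] by blast
      then show ?thesis
        using uv meet by blast
    next
      case False
      have witness: "\<exists>p\<in>zero_words. (w, p) \<in> \<alpha> \<and> (w, p) \<in> \<beta>"
        if "w = u \<or> w = v" for w
      proof (cases "w \<in> zero_words")
        case True
        moreover have "w \<noteq> []"
          using that \<alpha>.nonempty[OF uv] by blast
        ultimately show ?thesis
          using \<alpha>.refl \<beta>.refl by blast
      next
        case w: False
        show ?thesis
          using that common[OF w] uv \<alpha>.sym[OF uv] False by metis
      qed
      obtain p q where p: "p \<in> zero_words" "(u, p) \<in> \<alpha>" "(u, p) \<in> \<beta>" and q: "q \<in> zero_words" "(v, q) \<in> \<alpha>" "(v, q) \<in> \<beta>"
        using witness[of u] witness[of v] by blast
      have "(p, q) \<in> \<alpha>"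
        using \<alpha>.trans[OF \<alpha>.sym[OF p(2)] \<alpha>.trans[OF uv q(2)]] .
      then have "(p, q) \<in> \<beta>"
        using agree[OF p(1) q(1)] by simp
      then show ?thesis
        using \<beta>.trans[OF p(3) \<beta>.trans[OF _ \<beta>.sym[OF q(3)]]] by blast
    qed
  qed
qed

lemma cancel:
  assumes "fully_invariant_congruence \<alpha>" "fully_invariant_congruence \<beta>"
    "R \<inter> \<alpha> = R \<inter> \<beta>" "(R \<union> \<alpha>)\<^sup>+ = (R \<union> \<beta>)\<^sup>+"
  shows "\<alpha> = \<beta>"
  using cancel_inclusion[OF assms] cancel_inclusion[OF assms(2,1) assms(3,4)[symmetric]] by blast

end

subsection \<open>Adding the semilattices\<close>

text \<open>
  A congruence that does not preserve the set of letters satisfies an identity \<open>x\<^sup>k \<approx> g(x, y)\<close> where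
  \<open>y\<close> occurs in \<open>g\<close>. The letters \<open>x\<close> and \<open>y\<close> are represented by \<open>0\<close> and \<open>1\<close>.
\<close>

lemma content_breaking_pair:
  assumes "fully_invariant_congruence \<alpha>" "\<not> \<alpha> \<subseteq> content_congruence"
  shows "\<exists>k g. (replicate k 0, g) \<in> \<alpha> \<and> set g \<subseteq> {0, 1} \<and> 1 \<in> set g"
proof -
  interpret fully_invariant_congruence \<alpha> by fact
  obtain u v where "(u, v) \<in> \<alpha>" "(u, v) \<notin> content_congruence"
    using assms(2) by auto
  then have uv: "(u, v) \<in> \<alpha>" "set u \<noteq> set v"
    using nonempty[of u v] by (simp_all add: content_congruence_def)
  obtain p q y where pq: "(p, q) \<in> \<alpha>" "y \<in> set q" "y \<notin> set p"
    using uv sym[OF uv(1)] by blast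
  define f where "f = (\<lambda>i. if i = y then [1] else [0] :: word)"
  have "nonerasing f"
    by (auto simp: f_def nonerasing_def)
  then have "(subst f p, subst f q) \<in> \<alpha>"
    by (rule subst_closed[OF pq(1)])
  moreover have "subst f p = [0] \<^bold>^ length p"
    using pq(3) by (intro subst_const) (auto simp: f_def)
  moreover have "set (subst f q) \<subseteq> {0, 1}" "1 \<in> set (subst f q)"
    using pq(2) by (auto simp: set_subst f_def split: if_splits)
  ultimately show ?thesis
    by (metis word_power_singleton)
qed

text \<open>
  Let \<open>\<alpha>\<close> satisfy \<open>x\<^sup>k \<approx> g(x, y)\<close> and let \<open>\<beta>\<close> satisfy \<open>x\<^sup>s \<approx> h(x, y)\<close>. Then \<open>g(x, x\<^sup>s)\<close>
  and \<open>g(x, h(x, t))\<close> are related by \<open>\<alpha>\<close>, since both are related to \<open>x\<^sup>k\<close>, and by \<open>\<beta>\<close>, since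
  \<open>x\<^sup>s \<approx> h(x, t)\<close>. A further factor \<open>x\<close> ensures that \<open>x\<close> occurs.
\<close>

lemma common_content_extension:
  assumes \<alpha>: "fully_invariant_congruence \<alpha>" "\<not> \<alpha> \<subseteq> content_congruence"
    and \<beta>: "fully_invariant_congruence \<beta>" "\<not> \<beta> \<subseteq> content_congruence"
  shows "\<exists>e E. \<forall>x t. t \<noteq> [] \<longrightarrow> (e x, E x t) \<in> \<alpha> \<and> (e x, E x t) \<in> \<beta> \<and> set (E x t) = insert x (set t)"
proof -
  interpret \<alpha>: fully_invariant_congruence \<alpha> by fact
  interpret \<beta>: fully_invariant_congruence \<beta> by fact
  obtain k g where g: "(replicate k 0, g) \<in> \<alpha>" "set g \<subseteq> {0, 1}" "1 \<in> set g"
    using content_breaking_pair[OF \<alpha>] by blast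
  obtain s h where h: "(replicate s 0, h) \<in> \<beta>" "set h \<subseteq> {0, 1}" "1 \<in> set h"
    using content_breaking_pair[OF \<beta>] by blast
  have s: "s \<noteq> 0"
    using \<beta>.nonempty[OF h(1)] by auto
  define pick :: "word \<Rightarrow> word \<Rightarrow> nat \<Rightarrow> word" where "pick = (\<lambda>a t i. if i = 0 then a else t)"
  have pick: "nonerasing (pick a t)" if "a \<noteq> []" "t \<noteq> []" for a t
    using that by (simp add: pick_def nonerasing_def)
  define H where "H = (\<lambda>x t. subst (pick [x] t) h)"
  define E where "E = (\<lambda>x t. x # subst (pick [x] (H x t)) g)"
  define e where "e = (\<lambda>x. x # subst (pick [x] ([x] \<^bold>^ s)) g)"
  have pick_0: "subst (pick [x] t) (replicate n 0) = [x] \<^bold>^ n" for x t n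
    by (induction n) (simp_all add: pick_def)
  have "(e x, E x t) \<in> \<alpha> \<and> (e x, E x t) \<in> \<beta> \<and> set (E x t) = insert x (set t)" if t: "t \<noteq> []" for x t
  proof (intro conjI)
    have H: "H x t \<noteq> []"
      using subst_Nil_iff[OF pick[of "[x]" t]] \<beta>.nonempty[OF h(1)] t by (simp add: H_def)
    have power: "[x] \<^bold>^ s \<noteq> []"
      using s by (simp add: word_power_eq_Nil)
    have "([x] \<^bold>^ k, subst (pick [x] T) g) \<in> \<alpha>" if "T \<noteq> []" for T
      using \<alpha>.subst_closed[OF g(1) pick[of "[x]" T]] that by (simp add: pick_0)
    from \<alpha>.trans[OF \<alpha>.sym[OF this[OF power]] this[OF H]]
    show "(e x, E x t) \<in> \<alpha>"
      unfolding e_def E_def using \<alpha>.append_left[of _ _ "[x]"] by simp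
    have H_power: "([x] \<^bold>^ s, H x t) \<in> \<beta>"
      using \<beta>.subst_closed[OF h(1) pick[of "[x]" t]] t by (simp add: pick_0 H_def)
    have "(subst (pick [x] ([x] \<^bold>^ s)) g, subst (pick [x] (H x t)) g) \<in> \<beta>"
      using \<alpha>.nonempty[OF g(1)] H_power \<beta>.refl by (intro \<beta>.subst_pointwise) (auto simp: pick_def)
    then show "(e x, E x t) \<in> \<beta>"
      unfolding e_def E_def using \<beta>.append_left[of _ _ "[x]"] by simp
    have "set t \<subseteq> set (H x t)" "set (H x t) \<subseteq> insert x (set t)"
      using h(2,3) by (auto simp: H_def set_subst pick_def)
    moreover have "set (H x t) \<subseteq> set (E x t)" "set (E x t) \<subseteq> insert x (set (H x t))" "x \<in> set (E x t)"
      using g(2,3) by (auto simp: E_def set_subst pick_def)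
    ultimately show "set (E x t) = insert x (set t)"
      by blast
  qed
  then show ?thesis
    by blast
qed

context nil_congruence
begin

text \<open>
  Let \<open>p\<close> and \<open>q\<close> be zero words related by \<open>\<alpha>\<close>. The word \<open>q\<close> is related by both congruences to a
  zero word that contains the letters of \<open>p\<close> as well: replacing the letters of \<open>p\<close> missing in \<open>q\<close>
  changes \<open>p\<close> without changing \<open>q\<close>, and the replacement can be chosen to produce first exactly
  the letters of \<open>q\<close>, where \<open>\<beta>\<close> has to agree with \<open>\<alpha>\<close>, and then all letters of \<open>p\<close> and \<open>q\<close>.
\<close>

lemma agree_on_zero_words:
  assumes \<alpha>: "fully_invariant_congruence \<alpha>" "\<not> \<alpha> \<subseteq> content_congruence"
    and \<beta>: "fully_invariant_congruence \<beta>" "\<not> \<beta> \<subseteq> content_congruence"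
    and meet: "content_congruence \<inter> R \<inter> \<alpha> \<subseteq> \<beta>"
    and uv: "(u, v) \<in> \<alpha>" "u \<in> zero_words" "v \<in> zero_words"
  shows "(u, v) \<in> \<beta>"
proof -
  interpret \<alpha>: fully_invariant_congruence \<alpha> by fact
  interpret \<beta>: fully_invariant_congruence \<beta> by fact
  obtain e E where eE: "\<And>x t. t \<noteq> [] \<Longrightarrow> (e x, E x t) \<in> \<alpha>" "\<And>x t. t \<noteq> [] \<Longrightarrow> (e x, E x t) \<in> \<beta>"
    "\<And>x t. t \<noteq> [] \<Longrightarrow> set (E x t) = insert x (set t)"
    using common_content_extension[OF \<alpha> \<beta>] by blast
  have same_content: "(p, q) \<in> \<beta>" if "(p, q) \<in> \<alpha>" "p \<in> zero_words" "q \<in> zero_words" "set p = set q" for p q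
    using meet that zero_words_related[OF that(2,3)] \<alpha>.nonempty[OF that(1)] by (auto simp: content_congruence_def)
  have pad: "\<exists>w\<in>zero_words. set w = set p \<union> set q \<and> (q, w) \<in> \<alpha> \<and> (q, w) \<in> \<beta>"
    if pq: "(p, q) \<in> \<alpha>" "p \<in> zero_words" "q \<in> zero_words" for p q
  proof (cases "set p \<subseteq> set q")
    case True
    then show ?thesis
      using pq \<alpha>.nonempty[OF pq(1)] \<alpha>.refl \<beta>.refl by (intro bexI[of _ q]) auto
  next
    case False
    then obtain x where x: "x \<in> set p" "x \<notin> set q"
      by blast
    have ne: "p \<noteq> []" "q \<noteq> []"
      using \<alpha>.nonempty[OF pq(1)] by simp_all
    define y where "y = hd q"
    have y: "y \<in> set q"
      using ne(2) by (simp add: y_def)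
    define f where "f = (\<lambda>t i. if i \<in> set q then [i] else E y t)"
    have f: "nonerasing (f t)" if "t \<noteq> []" for t
      using eE(1)[OF that] \<alpha>.nonempty by (auto simp: f_def nonerasing_def)
    have f_q: "subst (f t) q = q" for t
      by (intro subst_singleton_id) (simp add: f_def)
    have set_f: "set (subst (f t) p) = (set p \<inter> set q) \<union> insert y (set t)" if "t \<noteq> []" for t
      using x eE(3)[OF that] by (auto simp: set_subst f_def split: if_splits)
    let ?u1 = "subst (f q) p" and ?w = "subst (f (p @ q)) p"
    have "(?u1, q) \<in> \<alpha>"
      using \<alpha>.subst_closed[OF pq(1) f[OF ne(2)]] f_q by simp
    moreover have in_zero: "?u1 \<in> zero_words" "?w \<in> zero_words"
      using ne by (auto intro!: zero_words_subst[OF pq(2)] f)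
    moreover have "set ?u1 = set q"
      using set_f[OF ne(2)] y by auto
    ultimately have u1: "(?u1, q) \<in> \<alpha>" "(?u1, q) \<in> \<beta>"
      using same_content pq(3) by auto
    have ne': "p @ q \<noteq> []"
      using ne by simp
    have \<alpha>E: "(E y q, E y (p @ q)) \<in> \<alpha>"
      by (rule \<alpha>.trans[OF \<alpha>.sym[OF eE(1)[OF ne(2)]] eE(1)[OF ne']])
    have \<beta>E: "(E y q, E y (p @ q)) \<in> \<beta>"
      by (rule \<beta>.trans[OF \<beta>.sym[OF eE(2)[OF ne(2)]] eE(2)[OF ne']])
    have "(?u1, ?w) \<in> \<alpha>" "(?u1, ?w) \<in> \<beta>"
      using ne(1) \<alpha>E \<beta>E \<alpha>.refl \<beta>.refl
      by (auto intro!: \<alpha>.subst_pointwise \<beta>.subst_pointwise simp: f_def)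
    then have "(q, ?w) \<in> \<alpha>" "(q, ?w) \<in> \<beta>"
      using \<alpha>.trans[OF \<alpha>.sym[OF u1(1)]] \<beta>.trans[OF \<beta>.sym[OF u1(2)]] by blast+
    moreover have "set ?w = set p \<union> set q"
      using set_f[OF ne'] y by auto
    ultimately show ?thesis
      using in_zero(2) by blast
  qed
  obtain w w' where w: "w \<in> zero_words" "set w = set u \<union> set v" "(v, w) \<in> \<alpha>" "(v, w) \<in> \<beta>"
    and w': "w' \<in> zero_words" "set w' = set v \<union> set u" "(u, w') \<in> \<alpha>" "(u, w') \<in> \<beta>"
    using pad[OF uv] pad[OF \<alpha>.sym[OF uv(1)] uv(3,2)] by blast
  have "(w', w) \<in> \<alpha>"
    by (rule \<alpha>.trans[OF \<alpha>.sym[OF w'(3)] \<alpha>.trans[OF uv(1) w(3)]])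
  then have "(w', w) \<in> \<beta>"
    using same_content w(1,2) w'(1,2) by (auto simp: Un_commute)
  then show ?thesis
    using \<beta>.trans[OF w'(4) \<beta>.trans[OF _ \<beta>.sym[OF w(4)]]] by blast
qed

text \<open>
  Cancellability of the join with the semilattices, by reduction to the assumptions of \<open>cancel\<close>.
\<close>

lemma cancel_with_content:
  assumes \<alpha>: "fully_invariant_congruence \<alpha>" and \<beta>: "fully_invariant_congruence \<beta>"
    and meet: "content_congruence \<inter> R \<inter> \<alpha> = content_congruence \<inter> R \<inter> \<beta>"
    and join: "(content_congruence \<inter> R \<union> \<alpha>)\<^sup>+ = (content_congruence \<inter> R \<union> \<beta>)\<^sup>+"
  shows "\<alpha> = \<beta>"
proof (rule cancel[OF \<alpha> \<beta>])
  interpret C: fully_invariant_congruence content_congruence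
    by (rule content_congruence_fully_invariant)
  have join_R: "(R \<union> \<gamma>)\<^sup>+ = (R \<union> (content_congruence \<inter> R \<union> \<gamma>)\<^sup>+)\<^sup>+" for \<gamma>
  proof
    show "(R \<union> \<gamma>)\<^sup>+ \<subseteq> (R \<union> (content_congruence \<inter> R \<union> \<gamma>)\<^sup>+)\<^sup>+"
      by (intro trancl_mono_subset) auto
    have "(content_congruence \<inter> R \<union> \<gamma>)\<^sup>+ \<subseteq> (R \<union> \<gamma>)\<^sup>+"
      by (intro trancl_mono_subset) auto
    then have "R \<union> (content_congruence \<inter> R \<union> \<gamma>)\<^sup>+ \<subseteq> (R \<union> \<gamma>)\<^sup>+"
      by auto
    then have "(R \<union> (content_congruence \<inter> R \<union> \<gamma>)\<^sup>+)\<^sup>+ \<subseteq> ((R \<union> \<gamma>)\<^sup>+)\<^sup>+"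
      by (rule trancl_mono_subset)
    then show "(R \<union> (content_congruence \<inter> R \<union> \<gamma>)\<^sup>+)\<^sup>+ \<subseteq> (R \<union> \<gamma>)\<^sup>+"
      by simp
  qed
  show "(R \<union> \<alpha>)\<^sup>+ = (R \<union> \<beta>)\<^sup>+"
    unfolding join_R[of \<alpha>] join_R[of \<beta>] join ..
  have content_iff: "\<gamma> \<subseteq> content_congruence \<longleftrightarrow> (content_congruence \<inter> R \<union> \<gamma>)\<^sup>+ \<subseteq> content_congruence" for \<gamma>
  proof
    assume "\<gamma> \<subseteq> content_congruence"
    then have "(content_congruence \<inter> R \<union> \<gamma>)\<^sup>+ \<subseteq> content_congruence\<^sup>+"
      by (intro trancl_mono_subset) auto
    moreover have "Relation.trans content_congruence"
      using C.trans by (intro transI)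
    ultimately show "(content_congruence \<inter> R \<union> \<gamma>)\<^sup>+ \<subseteq> content_congruence"
      by (simp add: trancl_id)
  qed auto
  show "R \<inter> \<alpha> = R \<inter> \<beta>"
  proof (cases "\<alpha> \<subseteq> content_congruence")
    case True
    then have "\<beta> \<subseteq> content_congruence"
      using content_iff[of \<alpha>] content_iff[of \<beta>] join by simp
    with True show ?thesis
      using meet by blast
  next
    case False
    then have not_\<beta>: "\<not> \<beta> \<subseteq> content_congruence"
      using content_iff[of \<alpha>] content_iff[of \<beta>] join by simp
    have "(u, v) \<in> \<delta>"
      if \<gamma>: "fully_invariant_congruence \<gamma>" "\<not> \<gamma> \<subseteq> content_congruence"
        and \<delta>: "fully_invariant_congruence \<delta>" "\<not> \<delta> \<subseteq> content_congruence"
        and sub: "content_congruence \<inter> R \<inter> \<gamma> \<subseteq> \<delta>" and uv: "(u, v) \<in> R" "(u, v) \<in> \<gamma>" for \<gamma> \<delta> u v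
    proof (cases "u \<in> zero_words")
      case True
      then have "v \<in> zero_words"
        using zero_words_closed sym[OF uv(1)] by blast
      then show ?thesis
        using agree_on_zero_words[OF \<gamma> \<delta> sub uv(2) True] by blast
    next
      case False
      then have "set u = set v"
        using related_outside_zero_words[OF uv(1)] by (metis set_mset_mset)
      then show ?thesis
        using sub uv nonempty[OF uv(1)] by (auto simp: content_congruence_def)
    qed
    note step = this
    have "content_congruence \<inter> R \<inter> \<alpha> \<subseteq> \<beta>" "content_congruence \<inter> R \<inter> \<beta> \<subseteq> \<alpha>"
      using meet by blast+
    note subs = this
    have "(u, v) \<in> \<beta>" if "(u, v) \<in> R" "(u, v) \<in> \<alpha>" for u v
      by (rule step[OF \<alpha> False \<beta> not_\<beta> subs(1) that])
    moreover have "(u, v) \<in> \<alpha>" if "(u, v) \<in> R" "(u, v) \<in> \<beta>" for u v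
      by (rule step[OF \<beta> not_\<beta> \<alpha> False subs(2) that])
    ultimately show ?thesis
      by auto
  qed
qed

end

section \<open>Consequences of modularity\<close>

text \<open>
  The congruence that agrees with \<open>\<alpha>\<close> on the ideal \<open>K\<close> and is trivial outside of it.
\<close>

definition restrict_congruence :: "identity set \<Rightarrow> word set \<Rightarrow> identity set" where
  "restrict_congruence \<alpha> K = {(u, v). u \<noteq> [] \<and> (u = v \<or> (u, v) \<in> \<alpha> \<and> u \<in> K \<and> v \<in> K)}"

lemma restrict_congruence_fully_invariant:
  assumes "fully_invariant_congruence \<alpha>"
    and ideal: "\<And>w l r. w \<in> K \<Longrightarrow> l @ w @ r \<in> K"
    and inv: "\<And>w f. w \<in> K \<Longrightarrow> nonerasing f \<Longrightarrow> subst f w \<in> K"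
  shows "fully_invariant_congruence (restrict_congruence \<alpha> K)"
proof -
  interpret fully_invariant_congruence \<alpha> by fact
  show ?thesis
  proof
    fix u v w assume "(u, v) \<in> restrict_congruence \<alpha> K" "(v, w) \<in> restrict_congruence \<alpha> K"
    then show "(u, w) \<in> restrict_congruence \<alpha> K"
      using trans[of u v w] by (auto simp: restrict_congruence_def)
  next
    fix u v l r :: word assume "(u, v) \<in> restrict_congruence \<alpha> K"
    then show "(l @ u @ r, l @ v @ r) \<in> restrict_congruence \<alpha> K"
      using context_closed ideal by (auto simp: restrict_congruence_def)
  next
    fix u v f assume "(u, v) \<in> restrict_congruence \<alpha> K" "nonerasing f"
    then show "(subst f u, subst f v) \<in> restrict_congruence \<alpha> K"
      using subst_closed inv subst_Nil_iff by (auto simp: restrict_congruence_def)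
  next
    fix u v assume uv: "(u, v) \<in> restrict_congruence \<alpha> K"
    then show "u \<noteq> [] \<and> v \<noteq> []"
      using nonempty by (auto simp: restrict_congruence_def)
    with uv show "(v, u) \<in> restrict_congruence \<alpha> K"
      using sym[of u v] by (auto simp: restrict_congruence_def)
  qed (simp add: restrict_congruence_def)
qed

lemma leaves_isolated_word:
  assumes "(p, q) \<in> (A \<union> B)\<^sup>+" "p \<noteq> q" and isolated: "\<And>w. (p, w) \<in> B \<Longrightarrow> w = p"
  shows "\<exists>w. w \<noteq> p \<and> (p, w) \<in> A"
proof -
  have "q = p \<or> (\<exists>w. w \<noteq> p \<and> (p, w) \<in> A)"
    using assms(1) by (induction rule: trancl_induct) (use isolated in blast)+
  with assms(2) show ?thesis by blast
qed

text \<open>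
  A fully invariant ideal that contains \<open>xyx\<close>, but none of its rearrangements \<open>x\<^sup>2y\<close> and \<open>yx\<^sup>2\<close> for
  distinct letters.
\<close>

definition test_ideal :: "word set" where
  "test_ideal = {w. 4 \<le> length w \<or> (\<exists>x y. w = [x, y, x])}"

lemma test_ideal_context: "w \<in> test_ideal \<Longrightarrow> l @ w @ r \<in> test_ideal"
  by (cases l; cases r) (auto simp: test_ideal_def)

lemma subst_three:
  assumes "nonerasing f"
  shows "(\<exists>x' y' z'. f x = [x'] \<and> f y = [y'] \<and> f z = [z']) \<or> 4 \<le> length (f x) + length (f y) + length (f z)"
proof -
  have "f x \<noteq> []" "f y \<noteq> []" "f z \<noteq> []"
    using assms by (simp_all add: nonerasing_def)
  then show ?thesis
    by (cases "f x"; cases "f y"; cases "f z") (auto simp: Suc_le_eq)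
qed

lemma test_ideal_subst:
  assumes "w \<in> test_ideal" "nonerasing f"
  shows "subst f w \<in> test_ideal"
proof (cases "4 \<le> length w")
  case True
  then show ?thesis
    using length_subst[OF assms(2), of w] by (simp add: test_ideal_def)
next
  case False
  then obtain x y where "w = [x, y, x]"
    using assms(1) by (auto simp: test_ideal_def)
  then show ?thesis
    using subst_three[OF assms(2), of x y x] by (auto simp: test_ideal_def)
qed

text \<open>
  The relation that exchanges \<open>x\<^sup>2y\<close> with \<open>xy\<^sup>2\<close> and \<open>xyx\<close> with \<open>yxy\<close>.
\<close>

definition swapped :: "word \<Rightarrow> word \<Rightarrow> bool" where
  "swapped u v \<longleftrightarrow> (\<exists>x y. (u = [x, x, y] \<and> v = [x, y, y]) \<or> (u = [x, y, y] \<and> v = [x, x, y]) \<or>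
     (u = [x, y, x] \<and> v = [y, x, y]))"

lemma swapped_triples: "swapped [x, x, y] [x, y, y]" "swapped [x, y, y] [x, x, y]" "swapped [x, y, x] [y, x, y]"
  unfolding swapped_def by blast+

text \<open>
  All words of length at least four are identified, and of the words of length three exactly
  \<open>x\<^sup>2y\<close> with \<open>xy\<^sup>2\<close> and \<open>xyx\<close> with \<open>yxy\<close>. Thus the class of \<open>x\<^sup>2y\<close> is \<open>{x\<^sup>2y, xy\<^sup>2}\<close>.
\<close>

definition swap_congruence :: "identity set" where
  "swap_congruence = {(u, v). u \<noteq> [] \<and> v \<noteq> [] \<and> (u = v \<or> 4 \<le> length u \<and> 4 \<le> length v \<or> swapped u v)}"

lemma swap_congruence_fully_invariant: "fully_invariant_congruence swap_congruence"
proof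
  fix u v assume "(u, v) \<in> swap_congruence"
  then show "(v, u) \<in> swap_congruence"
    by (auto simp: swap_congruence_def swapped_def)
next
  fix u v w assume "(u, v) \<in> swap_congruence" "(v, w) \<in> swap_congruence"
  then show "(u, w) \<in> swap_congruence"
    by (auto simp: swap_congruence_def swapped_def)
next
  fix u v l r :: word assume uv: "(u, v) \<in> swap_congruence"
  have "length u = 3 \<and> length v = 3" if "swapped u v"
    using that by (auto simp: swapped_def)
  then show "(l @ u @ r, l @ v @ r) \<in> swap_congruence"
    using uv by (cases l; cases r) (auto simp: swap_congruence_def)
next
  fix u v f assume uv: "(u, v) \<in> swap_congruence" and f: "nonerasing f"
  have "4 \<le> length (subst f u) \<and> 4 \<le> length (subst f v) \<or> subst f u = subst f v \<or> swapped (subst f u) (subst f v)"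
    if uv: "swapped u v"
  proof -
    from uv obtain x y where xy: "(u = [x, x, y] \<and> v = [x, y, y]) \<or> (u = [x, y, y] \<and> v = [x, x, y]) \<or>
       (u = [x, y, x] \<and> v = [y, x, y])"
      unfolding swapped_def by blast
    show ?thesis
    proof (cases "\<exists>x' y'. f x = [x'] \<and> f y = [y']")
      case True
      then obtain x' y' where f: "f x = [x']" "f y = [y']"
        by blast
      from xy have "swapped (subst f u) (subst f v)"
        by (elim disjE) (simp_all add: f swapped_triples)
      then show ?thesis by blast
    next
      case False
      have "f x \<noteq> []" "f y \<noteq> []"
        using f by (simp_all add: nonerasing_def)
      then have "2 \<le> length (f x) \<and> 1 \<le> length (f y) \<or> 1 \<le> length (f x) \<and> 2 \<le> length (f y)"
        using False by (cases "f x"; cases "f y") (auto simp: Suc_le_eq)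
      with xy show ?thesis
        by auto
    qed
  qed
  moreover have "4 \<le> length (subst f w)" if "4 \<le> length w" for w
    using length_subst[OF f, of w] that by linarith
  ultimately have "subst f u = subst f v \<or> 4 \<le> length (subst f u) \<and> 4 \<le> length (subst f v) \<or>
      swapped (subst f u) (subst f v)"
    using uv unfolding swap_congruence_def by blast
  then show "(subst f u, subst f v) \<in> swap_congruence"
    using uv by (simp add: swap_congruence_def subst_Nil_iff[OF f])
qed (auto simp: swap_congruence_def)

text \<open>
  Words with the same letters and the same prefix of length three are identified. All other words
  in the class of \<open>yx\<^sup>2\<close> have length at least four.
\<close>

definition prefix_congruence :: "identity set" where
  "prefix_congruence = {(u, v). u \<noteq> [] \<and> v \<noteq> [] \<and> take 3 u = take 3 v \<and> set u = set v}"

lemma take_3_eq: "take 3 u = take 3 v \<Longrightarrow> u = v \<or> 3 \<le> length u \<and> 3 \<le> length v"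
proof -
  assume eq: "take 3 u = take 3 v"
  then have "min (length u) 3 = min (length v) 3"
    by (metis length_take)
  then have "3 \<le> length u \<and> 3 \<le> length v \<or> length u \<le> 3 \<and> length v \<le> 3"
    by linarith
  then show ?thesis
    using eq by auto
qed

lemma prefix_congruence_fully_invariant: "fully_invariant_congruence prefix_congruence"
proof
  fix u v l r :: word assume uv: "(u, v) \<in> prefix_congruence"
  moreover have "take n (u @ r) = take n (v @ r)" if "n \<le> 3" "take 3 u = take 3 v" for n
  proof -
    have "take n u = take n v"
      using that by (metis min.absorb1 take_take)
    then show ?thesis
      using take_3_eq[OF that(2)] that(1) by auto
  qed
  ultimately have "take (3 - length l) (u @ r) = take (3 - length l) (v @ r)"
    by (simp add: prefix_congruence_def del: take_append)
  then have "take 3 (l @ u @ r) = take 3 (l @ v @ r)"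
    unfolding take_append[of 3 l] by simp
  with uv show "(l @ u @ r, l @ v @ r) \<in> prefix_congruence"
    by (simp add: prefix_congruence_def del: take_append)
next
  fix u v f assume uv: "(u, v) \<in> prefix_congruence" and f: "nonerasing f"
  have *: "take 3 (subst f w) = take 3 (subst f (take 3 w))" for w
  proof (cases "3 \<le> length w")
    case True
    have "3 \<le> length (subst f (take 3 w))"
      using length_subst[OF f, of "take 3 w"] True by simp
    moreover have "subst f w = subst f (take 3 w) @ subst f (drop 3 w)"
      using subst_simps(3)[of f "take 3 w" "drop 3 w"] by simp
    ultimately show ?thesis
      by simp
  qed simp
  show "(subst f u, subst f v) \<in> prefix_congruence"
    using uv *[of u] *[of v] by (auto simp: prefix_congruence_def set_subst subst_Nil_iff[OF f])
qed (auto simp: prefix_congruence_def)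

text \<open>
  The theory of a commutative variety that is modular in \<open>SEM\<close>.
\<close>

locale modular_congruence = commutative_congruence +
  assumes modular: "fully_invariant_congruence \<alpha> \<Longrightarrow> fully_invariant_congruence \<beta> \<Longrightarrow> \<beta> \<subseteq> \<alpha> \<Longrightarrow>
    (R \<union> \<beta>)\<^sup>+ \<inter> \<alpha> = (R \<inter> \<alpha> \<union> \<beta>)\<^sup>+"
begin

text \<open>
  Commutativity links \<open>p\<close> and \<open>q\<close> through their permutations \<open>p'\<close> and \<open>q'\<close>, which are related by the
  restriction of \<open>\<alpha>\<close> to the ideal. By modularity the congruence generated by \<open>R \<inter> \<alpha>\<close> and this
  restriction relates \<open>p\<close> and \<open>q\<close>. As \<open>p\<close> lies outside the ideal, the first proper step away from it
  is made by \<open>R \<inter> \<alpha>\<close>.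
\<close>

lemma modular_test:
  assumes \<alpha>: "fully_invariant_congruence \<alpha>"
    and p: "p \<noteq> []" "mset p = mset p'" and q: "q' \<noteq> []" "mset q' = mset q"
    and K: "p \<notin> test_ideal" "p' \<in> test_ideal" "q' \<in> test_ideal"
    and \<alpha>_pairs: "(p, q) \<in> \<alpha>" "(p', q') \<in> \<alpha>" and "p \<noteq> q"
  shows "\<exists>w. w \<noteq> p \<and> (p, w) \<in> R \<inter> \<alpha>"
proof (rule leaves_isolated_word)
  let ?\<beta> = "restrict_congruence \<alpha> test_ideal"
  have \<beta>: "fully_invariant_congruence ?\<beta>"
    using \<alpha> test_ideal_context test_ideal_subst by (rule restrict_congruence_fully_invariant)
  have "?\<beta> \<subseteq> \<alpha>"
    using fully_invariant_congruence.refl[OF \<alpha>] by (auto simp: restrict_congruence_def)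
  have "p' \<noteq> []"
    using p by auto
  then have "(p, p') \<in> R" "(p', q') \<in> ?\<beta>" "(q', q) \<in> R"
    using K \<alpha>_pairs(2) permutation[OF p(2,1)] permutation[OF q(2,1)]
    by (auto simp: restrict_congruence_def)
  then have "(p, q) \<in> (R \<union> ?\<beta>)\<^sup>+"
    by (meson UnI1 UnI2 trancl.simps)
  with \<alpha>_pairs(1) show "(p, q) \<in> (R \<inter> \<alpha> \<union> ?\<beta>)\<^sup>+"
    using modular[OF \<alpha> \<beta> \<open>?\<beta> \<subseteq> \<alpha>\<close>] by blast
  show "w = p" if "(p, w) \<in> ?\<beta>" for w
    using that K(1) by (auto simp: restrict_congruence_def)
qed fact

lemma square_shift: "([0, 0, 1], [0, 1, 1]) \<in> R"
proof -
  have "\<exists>w. w \<noteq> [0, 0, 1] \<and> ([0, 0, 1], w) \<in> R \<inter> swap_congruence"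
    by (rule modular_test[OF swap_congruence_fully_invariant, where p' = "[0, 1, 0]" and q' = "[1, 0, 1]"
          and q = "[0, 1, 1]"])
      (auto simp: test_ideal_def swap_congruence_def swapped_def)
  then obtain w where "w \<noteq> [0, 0, 1]" "([0, 0, 1], w) \<in> R" "([0, 0, 1], w) \<in> swap_congruence"
    by blast
  moreover from this have "w = [0, 1, 1]"
    by (auto simp: swap_congruence_def swapped_def)
  ultimately show ?thesis by simp
qed

lemma square_extends: "\<exists>s. s \<noteq> [] \<and> set s \<subseteq> {0, 1} \<and> ([1, 0, 0], [1, 0, 0] @ s) \<in> R"
proof -
  have "\<exists>w. w \<noteq> [1, 0, 0] \<and> ([1, 0, 0], w) \<in> R \<inter> prefix_congruence"
    by (rule modular_test[OF prefix_congruence_fully_invariant, where p' = "[0, 1, 0]" and q' = "[0, 1, 0, 0]"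
          and q = "[1, 0, 0, 0]"])
      (auto simp: test_ideal_def prefix_congruence_def)
  then obtain w where w: "w \<noteq> [1, 0, 0]" "([1, 0, 0], w) \<in> R" "([1, 0, 0], w) \<in> prefix_congruence"
    by blast
  have "w = take 3 w @ drop 3 w"
    by simp
  moreover have "take 3 w = [1, 0, 0]" "set w = {0, 1}"
    using w(3) by (auto simp: prefix_congruence_def)
  ultimately have "w = [1, 0, 0] @ drop 3 w" "drop 3 w \<noteq> []" "set (drop 3 w) \<subseteq> {0, 1}"
    using w(1) set_drop_subset[of 3 w] by (metis, metis append_Nil2, metis)
  then show ?thesis
    using w(2) by metis
qed

lemma square_absorbs: "([0, 0, 1, 0], [0, 0, 1]) \<in> R" "([0, 0, 1, 1], [0, 0, 1]) \<in> R"
proof -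
  \<comment> \<open>In powers: \<open>x\<^sup>3y = x\<^sup>2y\<^sup>2 = x\<^sup>3y\<^sup>2 = x\<^sup>4y\<close>, so \<open>x\<^sup>3y\<close> absorbs \<open>x\<close> and \<open>y\<close>.\<close>
  let ?w = "[0, 0, 0, 1] :: word"
  have a: "(?w, [0, 0, 1, 1]) \<in> R"
    using append_left[OF square_shift, of "[0]"] by simp
  have "nonerasing (\<lambda>i. if i = 0 then [0] else [0, 1])"
    by (simp add: nonerasing_def)
  from subst_closed[OF square_shift this] have "(?w, [0, 0, 1, 0, 1]) \<in> R"
    by simp
  then have "(?w, ?w @ [1]) \<in> R"
    by (rule trans) (rule permutation; simp)
  then have w1: "(?w @ [1], ?w) \<in> R"
    by (rule sym)
  have p: "(?w @ [0], [0] @ ?w) \<in> R" "([0] @ [0, 0, 1, 1], ?w @ [1]) \<in> R"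
    by (rule permutation; simp)+
  have w0: "(?w @ [0], ?w) \<in> R"
    by (rule trans[OF p(1) trans[OF append_left[OF a] trans[OF p(2) w1]]])
  have absorb: "(?w @ s, ?w) \<in> R" if "set s \<subseteq> {0, 1}" for s
  proof (rule absorb_letters)
    fix z assume "z \<in> set ?w"
    then have "z = 0 \<or> z = 1"
      by simp
    then show "(?w @ [z], ?w) \<in> R"
      using w0 w1 by (elim disjE) simp_all
  qed (use that in auto)
  obtain s where s: "s \<noteq> []" "set s \<subseteq> {0, 1}" "([1, 0, 0], [1, 0, 0] @ s) \<in> R"
    using square_extends by blast
  obtain z t where t: "s = z # t" "z = 0 \<or> z = 1" "set t \<subseteq> {0, 1}"
    using s(1,2) by (cases s) auto
  have "([1, 0, 0, z], ?w) \<in> R"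
    using t(2)
  proof
    assume "z = 1"
    then have "([1, 0, 0, z], [0, 0, 1, 1]) \<in> R"
      by (intro permutation) simp_all
    then show ?thesis
      using sym[OF a] by (rule trans)
  qed (auto intro: permutation)
  from append_right[OF this, of t] have "([1, 0, 0] @ s, ?w @ t) \<in> R"
    by (simp add: t(1))
  from trans[OF s(3) trans[OF this absorb[OF t(3)]]] have "([1, 0, 0], ?w) \<in> R" .
  moreover have "([0, 0, 1], [1, 0, 0]) \<in> R"
    by (rule permutation) simp_all
  ultimately have "([0, 0, 1], ?w) \<in> R"
    using trans by blast
  then have w: "(?w, [0, 0, 1]) \<in> R"
    by (rule sym)
  show "([0, 0, 1, 1], [0, 0, 1]) \<in> R"
    by (rule trans[OF sym[OF a] w])
  have "([0, 0, 1, 0], ?w) \<in> R"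
    by (rule permutation) simp_all
  then show "([0, 0, 1, 0], [0, 0, 1]) \<in> R"
    using w by (rule trans)
qed

lemma nonlinear_absorbs:
  assumes w: "\<not> distinct w" "3 \<le> length w" and z: "z \<in> set w"
  shows "(w @ [z], w) \<in> R"
proof -
  obtain w1 w2 w3 x where w': "w = w1 @ [x] @ w2 @ [x] @ w3"
    using not_distinct_decomp[OF w(1)] by blast
  let ?r = "w1 @ w2 @ w3"
  have ne: "w \<noteq> []" "?r \<noteq> []"
    using w(2) by (auto simp: w')
  have perm: "(w, [x, x] @ ?r) \<in> R"
    using ne(1) by (intro permutation) (simp_all add: w')
  have rule: "([x, x] @ v @ [x], [x, x] @ v) \<in> R" "([x, x] @ v @ v, [x, x] @ v) \<in> R" if "v \<noteq> []" for v
    using square_absorbs[THEN subst_closed, of "\<lambda>i. if i = 0 then [x] else v"] that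
    by (simp_all add: nonerasing_def)
  have "([x, x] @ ?r @ [z], [x, x] @ ?r) \<in> R"
  proof (cases "z = x")
    case True
    then show ?thesis
      using rule(1)[OF ne(2)] by simp
  next
    case False
    then have "z \<in> set ?r"
      using z by (auto simp: w')
    then obtain r1 r2 where r: "?r = r1 @ [z] @ r2"
      using split_list[of z ?r] by auto
    have 1: "([x, x] @ ?r @ [z], ([x, x] @ [z] @ [z]) @ r1 @ r2) \<in> R"
      unfolding r by (rule permutation) simp_all
    have 2: "(([x, x] @ [z] @ [z]) @ r1 @ r2, ([x, x] @ [z]) @ r1 @ r2) \<in> R"
      by (intro append_right rule) simp
    have 3: "(([x, x] @ [z]) @ r1 @ r2, [x, x] @ ?r) \<in> R"
      unfolding r by (rule permutation) simp_all
    show ?thesis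
      by (rule trans[OF 1 trans[OF 2 3]])
  qed
  then have "([x, x] @ ?r @ [z], w) \<in> R"
    using sym[OF perm] by (rule trans)
  then show ?thesis
    using trans[OF append_right[OF perm, of "[z]"]] by simp
qed

lemma nonlinear_same_content:
  assumes "\<not> distinct u" "3 \<le> length u" "\<not> distinct v" "3 \<le> length v" "set u = set v"
  shows "(u, v) \<in> R"
  by (rule same_content_related) (use assms nonlinear_absorbs in auto)

text \<open>
  The words that are equal in the variety to a nonlinear word of length at least three, and the
  theory of the subvariety in which all of them are identified. This subvariety is the nil
  component in the required decomposition.
\<close>

definition nil_part :: "word set" where
  "nil_part = {u. \<exists>p. \<not> distinct p \<and> 3 \<le> length p \<and> (u, p) \<in> R}"

definition nil_extension :: "identity set" where
  "nil_extension = R \<union> nil_part \<times> nil_part"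

lemma nonlinear_in_nil_part: "\<not> distinct p \<Longrightarrow> 3 \<le> length p \<Longrightarrow> p \<in> nil_part"
  using refl[of p] by (cases "p = []") (auto simp: nil_part_def)

lemma nil_part_closed: "(u, v) \<in> R \<Longrightarrow> v \<in> nil_part \<Longrightarrow> u \<in> nil_part"
  using trans by (auto simp: nil_part_def)

lemma nil_extension_fully_invariant: "fully_invariant_congruence nil_extension"
proof
  fix u v assume uv: "(u, v) \<in> nil_extension"
  then show "u \<noteq> [] \<and> v \<noteq> []"
    using nonempty by (auto simp: nil_extension_def nil_part_def)
  show "(v, u) \<in> nil_extension"
    using uv sym by (auto simp: nil_extension_def)
next
  fix u v w assume uvw: "(u, v) \<in> nil_extension" "(v, w) \<in> nil_extension"
  show "(u, w) \<in> nil_extension"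
  proof (cases "(u, v) \<in> R \<and> (v, w) \<in> R")
    case True
    then show ?thesis
      using trans by (auto simp: nil_extension_def)
  next
    case False
    then have "u \<in> nil_part" "w \<in> nil_part"
      using uvw nil_part_closed[of u v] nil_part_closed[of w v] sym[of v w]
      by (auto simp: nil_extension_def)
    then show ?thesis
      by (simp add: nil_extension_def)
  qed
next
  fix u v l r :: word assume uv: "(u, v) \<in> nil_extension"
  have "l @ w @ r \<in> nil_part" if w: "w \<in> nil_part" for w
  proof -
    obtain p where "\<not> distinct p" "3 \<le> length p" "(w, p) \<in> R"
      using w by (auto simp: nil_part_def)
    moreover from this have "l @ p @ r \<in> nil_part"
      by (intro nonlinear_in_nil_part) auto
    ultimately show ?thesis
      using nil_part_closed context_closed by blast
  qed
  then show "(l @ u @ r, l @ v @ r) \<in> nil_extension"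
    using uv context_closed by (auto simp: nil_extension_def)
next
  fix u v f assume uv: "(u, v) \<in> nil_extension" and f: "nonerasing f"
  have "subst f w \<in> nil_part" if w: "w \<in> nil_part" for w
  proof -
    obtain p where p: "\<not> distinct p" "3 \<le> length p" "(w, p) \<in> R"
      using w by (auto simp: nil_part_def)
    obtain p1 p2 p3 x where px: "p = p1 @ [x] @ p2 @ [x] @ p3"
      using not_distinct_decomp[OF p(1)] by blast
    obtain y ys where "f x = y # ys"
      using f by (cases "f x") (auto simp: nonerasing_def)
    then have "\<not> distinct (subst f p)"
      by (simp add: px)
    moreover have "3 \<le> length (subst f p)"
      using length_subst[OF f, of p] p(2) by simp
    ultimately show ?thesis
      using subst_closed[OF p(3) f] by (intro nil_part_closed[OF _ nonlinear_in_nil_part])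
  qed
  then show "(subst f u, subst f v) \<in> nil_extension"
    using uv subst_closed[OF _ f] by (auto simp: nil_extension_def)
qed (simp add: nil_extension_def refl)

lemma content_preserving_case:
  assumes "R \<subseteq> content_congruence"
  shows "R = content_congruence \<inter> nil_extension"
proof -
  have "(u, v) \<in> R" if uv: "u \<in> nil_part" "v \<in> nil_part" "set u = set v" for u v
  proof -
    obtain p q where p: "\<not> distinct p" "3 \<le> length p" "(u, p) \<in> R"
      and q: "\<not> distinct q" "3 \<le> length q" "(v, q) \<in> R"
      using uv by (auto simp: nil_part_def)
    have "set u = set p" "set v = set q"
      using p(3) q(3) assms by (auto simp: content_congruence_def)
    then have "(p, q) \<in> R"
      using p q uv(3) by (intro nonlinear_same_content) simp_all
    then show ?thesis
      using trans[OF p(3) trans[OF _ sym[OF q(3)]]] by simp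
  qed
  then show ?thesis
    using assms by (auto simp: nil_extension_def content_congruence_def)
qed

lemma content_breaking_case:
  assumes "\<not> R \<subseteq> content_congruence"
  shows "R = nil_extension"
proof -
  obtain k g where g: "(replicate k 0, g) \<in> R" "set g \<subseteq> {0, 1}" "1 \<in> set g"
    using content_breaking_pair[OF fully_invariant_congruence_axioms assms] by blast
  have extend: "(p @ t, p) \<in> R" if p: "\<not> distinct p" "3 \<le> length p" and t: "t \<noteq> []" for p t
  proof -
    have ne: "p \<noteq> []"
      using p(2) by auto
    define x where "x = hd p"
    have x: "x \<in> set p"
      using ne by (simp add: x_def)
    define f where "f = (\<lambda>i :: nat. if i = 0 then [x] else t)"
    have f: "nonerasing f"
      using t by (simp add: f_def nonerasing_def)
    have "subst f (replicate n 0) = replicate n x" for n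
      by (induction n) (simp_all add: f_def)
    then have 1: "(p @ replicate k x, p @ subst f g) \<in> R"
      using append_left[OF subst_closed[OF g(1) f]] by simp
    have 2: "(p @ replicate k x, p) \<in> R"
    proof (rule absorb_letters[OF ne])
      show "set (replicate k x) \<subseteq> set p"
        using x by auto
    qed (rule nonlinear_absorbs[OF p])
    have "set (p @ subst f g) = set (p @ t)"
      using g(2,3) x by (auto simp: set_subst f_def split: if_splits)
    then have 3: "(p @ t, p @ subst f g) \<in> R"
      using p by (intro nonlinear_same_content) auto
    show ?thesis
      by (rule trans[OF 3 trans[OF sym[OF 1] 2]])
  qed
  have "(u, v) \<in> R" if uv: "u \<in> nil_part" "v \<in> nil_part" for u v
  proof -
    obtain p q where p: "\<not> distinct p" "3 \<le> length p" "(u, p) \<in> R"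
      and q: "\<not> distinct q" "3 \<le> length q" "(v, q) \<in> R"
      using uv by (auto simp: nil_part_def)
    have "p \<noteq> []" "q \<noteq> []"
      using p q by auto
    then have pq: "(p @ q, p) \<in> R" "(q @ p, q) \<in> R" "(p @ q, q @ p) \<in> R"
      using extend[OF p(1,2), of q] extend[OF q(1,2), of p] commute[of p q] by simp_all
    have "(p, q) \<in> R"
      by (rule trans[OF sym[OF pq(1)] trans[OF pq(3,2)]])
    then show ?thesis
      using trans[OF p(3) trans[OF _ sym[OF q(3)]]] by simp
  qed
  then show ?thesis
    by (auto simp: nil_extension_def)
qed

end

section \<open>The characterization\<close>

lemma law_in_theory:
  "class_satisfies K \<Sigma> \<Longrightarrow> (u, v) \<in> \<Sigma> \<Longrightarrow> u \<noteq> [] \<Longrightarrow> v \<noteq> [] \<Longrightarrow> (u, v) \<in> equational_theory K"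
  by (fastforce simp: equational_theory_def is_identity_def class_satisfies_def satisfies_def)

lemma theory_satisfies: "\<Sigma> \<subseteq> equational_theory K \<Longrightarrow> class_satisfies K \<Sigma>"
  by (fastforce simp: equational_theory_def class_satisfies_def satisfies_def)

lemma join_cancellable:
  fixes V :: "('u::infinite) magma set"
  assumes V: "V = M \<squnion>\<^bsub>SEM\<^esub> N" "V \<in> carrier SEM"
    and M: "M \<in> {trivial_variety, semilattice_variety}" and N: "N \<in> carrier SEM"
    and zero: "class_satisfies N (zero_identities [0, 0, 1])"
    and comm: "class_satisfies N commutative_law"
  shows "cancellable_element SEM V"
proof (rule cancellable_SEM_I[OF V(2)])
  fix \<alpha> \<beta> assume \<alpha>: "fully_invariant_congruence \<alpha>" and \<beta>: "fully_invariant_congruence \<beta>"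
    and meet: "equational_theory V \<inter> \<alpha> = equational_theory V \<inter> \<beta>"
    and join: "(equational_theory V \<union> \<alpha>)\<^sup>+ = (equational_theory V \<union> \<beta>)\<^sup>+"
  interpret nil_congruence "equational_theory N"
  proof (intro nil_congruence.intro commutative_congruence.intro commutative_congruence_axioms.intro
      nil_congruence_axioms.intro)
    show "fully_invariant_congruence (equational_theory N)"
      by (rule theory_fully_invariant[OF N])
    show "([0, 1], [1, 0]) \<in> equational_theory N"
      by (rule law_in_theory[OF comm]) (simp_all add: commutative_law_def)
    show "([0, 0, 1, 2], [0, 0, 1]) \<in> equational_theory N" "([2, 0, 0, 1], [0, 0, 1]) \<in> equational_theory N"
      by (rule law_in_theory[OF zero]; force simp: zero_identities_def)+
  qed
  have "M \<in> carrier SEM"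
    using M trivial_variety_in_SEM semilattice_variety_in_SEM by blast
  then have theory_V: "equational_theory V = equational_theory M \<inter> equational_theory N"
    using theory_join N V(1) by blast
  from M consider "M = trivial_variety" | "M = semilattice_variety"
    by blast
  then show "\<alpha> = \<beta>"
  proof cases
    case 1
    then have "equational_theory V = equational_theory N"
      using nonempty by (auto simp: theory_V theory_trivial_variety)
    then show ?thesis
      using cancel[OF \<alpha> \<beta>] meet join by simp
  next
    case 2
    then have "equational_theory V = content_congruence \<inter> equational_theory N"
      by (simp add: theory_V theory_semilattice_variety)
    then show ?thesis
      using cancel_with_content[OF \<alpha> \<beta>] meet join by simp
  qed
qed

lemma modular_decomposition:
  fixes V :: "('u::infinite) magma set"
  assumes V: "V \<in> carrier SEM" "class_satisfies V commutative_law" and mod: "modular_element SEM V"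
  shows "\<exists>M N. M \<in> {trivial_variety, semilattice_variety} \<and> N \<in> carrier SEM \<and>
    class_satisfies N (zero_identities [0, 0, 1]) \<and> class_satisfies N commutative_law \<and>
    V = M \<squnion>\<^bsub>SEM\<^esub> N"
proof -
  interpret modular_congruence "equational_theory V"
  proof (intro modular_congruence.intro commutative_congruence.intro commutative_congruence_axioms.intro
      modular_congruence_axioms.intro)
    show "fully_invariant_congruence (equational_theory V)"
      by (rule theory_fully_invariant[OF V(1)])
    show "([0, 1], [1, 0]) \<in> equational_theory V"
      by (rule law_in_theory[OF V(2)]) (simp_all add: commutative_law_def)
  qed (rule modular_SEM_D[OF mod])
  interpret N: fully_invariant_congruence nil_extension
    by (rule nil_extension_fully_invariant)
  define N :: "'u magma set" where "N = models nil_extension"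
  have N: "N \<in> carrier SEM"
    unfolding N_def by (rule N.models_in_SEM)
  have theory_N: "equational_theory N = nil_extension"
    unfolding N_def by (rule N.theory_of_models)
  have "zero_identities [0, 0, 1] \<subseteq> nil_extension"
    by (auto simp: zero_identities_def nil_extension_def intro!: nonlinear_in_nil_part)
  then have zero: "class_satisfies N (zero_identities [0, 0, 1])"
    using theory_N by (intro theory_satisfies) simp
  have "commutative_law \<subseteq> nil_extension"
    using commutative by (auto simp: commutative_law_def nil_extension_def)
  then have comm: "class_satisfies N commutative_law"
    using theory_N by (intro theory_satisfies) simp
  define M :: "'u magma set" where
    "M = (if equational_theory V \<subseteq> content_congruence then semilattice_variety else trivial_variety)"
  have M: "M \<in> {trivial_variety, semilattice_variety}" "M \<in> carrier SEM"
    using trivial_variety_in_SEM semilattice_variety_in_SEM by (auto simp: M_def)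
  have "equational_theory V = equational_theory M \<inter> equational_theory N"
  proof (cases "equational_theory V \<subseteq> content_congruence")
    case True
    then show ?thesis
      using content_preserving_case by (simp add: M_def theory_N theory_semilattice_variety)
  next
    case False
    then show ?thesis
      using content_breaking_case N.nonempty by (auto simp: M_def theory_N theory_trivial_variety)
  qed
  also have "\<dots> = equational_theory (M \<squnion>\<^bsub>SEM\<^esub> N)"
    by (rule theory_join[OF M(2) N, symmetric])
  finally have "V = M \<squnion>\<^bsub>SEM\<^esub> N"
    using join_in_SEM[OF M(2) N] theory_inject[OF V(1)] by blast
  then show ?thesis
    using M(1) N zero comm by blast
qed

theorem theorem1p1:
  fixes V :: "('u::infinite) magma set"
  assumes "V \<in> carrier SEM"
    and "class_satisfies V commutative_law"
  shows "(cancellable_element SEM V \<longleftrightarrow> modular_element SEM V) \<and>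
         (modular_element SEM V \<longleftrightarrow>
            (\<exists>M N. M \<in> {trivial_variety, semilattice_variety} \<and>
                   N \<in> carrier SEM \<and>
                   class_satisfies N (zero_identities [0, 0, 1]) \<and>
                   class_satisfies N commutative_law \<and>
                   V = M \<squnion>\<^bsub>SEM\<^esub> N))"
proof -
  have "cancellable_element SEM V"
    if "\<exists>M N. M \<in> {trivial_variety, semilattice_variety} \<and> N \<in> carrier SEM \<and>
      class_satisfies N (zero_identities [0, 0, 1]) \<and> class_satisfies N commutative_law \<and>
      V = M \<squnion>\<^bsub>SEM\<^esub> N"
    using that join_cancellable assms(1) by blast
  moreover have "modular_element SEM V" if "cancellable_element SEM V"
    using lattice.cancellable_imp_modular[OF SEM_lattice that] .
  ultimately show ?thesis
    using modular_decomposition[OF assms] by blast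
qed

end
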